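(* The characteristic function of the anticyclic operad $\operatorname{Dend}$ is $$\mathbf{Ch}(\operatorname{Dend})=1-p_1-\sqrt{1-4p_1}-\sum_{n\ge1}\Big(\frac{1}{2n}\sum_{d\mid n}\varphi(d)\binom{2n/d}{n/d}p_d^{n/d}\Big),$$ where $\varphi$ is the Euler totient function and $\sqrt{1-4p_1}$ is the formal power series with constant term $1$.
   Context: All vector spaces are over $\mathbb{Q}$. The symmetric group $\mathfrak{S}_n$ acts on $\mathcal{P}(n)$ by $(\sigma\cdot E)(x_1,\dots,x_n)=E(x_{\sigma(1)},\dots,x_{\sigma(n)})$. An anticyclic operad is a symmetric operad $\mathcal{P}$ (unit $1\in\mathcal{P}(1)$, partial compositions $\circ_i$) together with an action of $\mathfrak{S}_{n+1}$ on each $\mathcal{P}(n)$ extending the action of $\mathfrak{S}_n$ (the stabilizer of $n+1$), such that, writing $\tau_n$ for the action of the long cycle $(n+1,n,\dots,2,1)$ ($1\mapsto n+1$, $i\mapsto i-1$ for $i\ge 2$): $\tau_1(1)=-1$ and, for $f\in\mathcal{P}(m)$, $g\in\mathcal{P}(n)$, $\tau(f\circ_i g)=\tau_m(f)\circ_{i-1}g$ for $2\le i\le m$ and $\tau(f\circ_1 g)=-\tau_n(g)\circ_n\tau_m(f)$. A non-symmetric anticyclic operad is a non-symmetric operad with endomorphisms $\tau_n$ of $\mathcal{P}(n)$ satisfying $\tau_n^{n+1}=\mathrm{Id}$ and these same identities. If $\mathcal{P}$ is a non-symmetric anticyclic operad, the symmetric operad with components $\mathcal{P}(n)\otimes\mathbb{Q}\mathfrak{S}_n\cong\operatorname{Ind}_{\mathbb{Z}/(n+1)\mathbb{Z}}^{\mathfrak{S}_{n+1}}\mathcal{P}(n)$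 is naturally an anticyclic operad, with $\tau_n(E\otimes 1)=\tau_n(E)\otimes 1$ (here $\mathbb{Z}/(n+1)\mathbb{Z}$ is the subgroup of $\mathfrak{S}_{n+1}$ generated by $(n+1,n,\dots,2,1)$, acting through $\tau_n$). The characteristic function of an anticyclic operad $\mathcal{P}$ is $\mathbf{Ch}(\mathcal{P})=\sum_{n\ge1}\mathbf{Ch}_{n+1}(\mathcal{P}(n))$, where $\mathbf{Ch}_{n+1}(\mathcal{P}(n))$ is the symmetric function (Frobenius characteristic, homogeneous of degree $n+1$) of the $\mathfrak{S}_{n+1}$-module $\mathcal{P}(n)$, i.e. $\frac{1}{(n+1)!}\sum_{\sigma\in\mathfrak{S}_{n+1}}\operatorname{tr}(\sigma)\,p_{\text{cycle type of }\sigma}$. The $p_k$ are the power sum symmetric functions; identities hold in the completed ring of symmetric functions. The non-symmetric operad $\operatorname{Dend}$ is generated by binary operations $x\prec y$, $x\succ y$ with relations $(x\prec y)\prec z=x\prec(y\prec z)+x\prec(y\succ z)$, $x\succ(y\prec z)=(x\succ y)\prec z$, $x\succ(y\succ z)=(x\succ y)\succ z+(x\prec y)\succ z$. It is a non-symmetric anticyclic operad with the unique structure such that $\tau_1=-\mathrm{Id}$, $\tau_2(x_1\succ x_2)=x_1\prec x_2$, $\tau_2(x_1\prec x_2)=-x_1\prec x_2-x_1\succ x_2$. In the claim, $\operatorname{Dend}$ denotes the associated (symmetric) anticyclic operad. *)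

theory Defs
  imports
    Complex_Main
    "HOL-Library.Poly_Mapping"
    "HOL-Library.Multiset"
    "HOL-Computational_Algebra.Formal_Power_Series"
    "HOL-Combinatorics.Orbits"
    "HOL-Number_Theory.Totient"
begin

section \<open>Rational vector spaces\<close>

class rat_vector = ab_group_add +
  fixes scaleQ :: "rat \<Rightarrow> 'a \<Rightarrow> 'a"  (infixr \<open>*\<^sub>Q\<close> 75)
  assumes scaleQ_add_right: "c *\<^sub>Q (x + y) = c *\<^sub>Q x + c *\<^sub>Q y"
    and scaleQ_add_left: "(c + d) *\<^sub>Q x = c *\<^sub>Q x + d *\<^sub>Q x"
    and scaleQ_scaleQ: "c *\<^sub>Q (d *\<^sub>Q x) = (c * d) *\<^sub>Q x"
    and scaleQ_one: "1 *\<^sub>Q x = x"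

global_interpretation rat_vec: vector_space "scaleQ :: rat \<Rightarrow> 'a::rat_vector \<Rightarrow> 'a"
  by unfold_locales (simp_all add: scaleQ_add_right scaleQ_add_left scaleQ_scaleQ scaleQ_one)

instantiation poly_mapping :: (type, rat_vector) rat_vector
begin

definition scaleQ_poly_mapping :: "rat \<Rightarrow> ('a \<Rightarrow>\<^sub>0 'b) \<Rightarrow> 'a \<Rightarrow>\<^sub>0 'b"
  where "scaleQ_poly_mapping c = Poly_Mapping.map (scaleQ c)"

lemma lookup_scaleQ [simp]: "Poly_Mapping.lookup (c *\<^sub>Q f) k = c *\<^sub>Q Poly_Mapping.lookup f k"
  by (simp add: scaleQ_poly_mapping_def Poly_Mapping.map.rep_eq when_def)

instance
  by standard (auto intro!: poly_mapping_eqI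
      simp: lookup_add scaleQ_add_right scaleQ_add_left scaleQ_scaleQ)

end

instantiation rat :: rat_vector
begin

definition scaleQ_rat :: "rat \<Rightarrow> rat \<Rightarrow> rat"
  where [simp]: "scaleQ_rat c x = c * x"

instance
  by standard (auto simp: algebra_simps)

end

text \<open>The trace of an endomorphism \<open>f\<close> of a finite-dimensional subspace \<open>V\<close>, computed in an
  arbitrary basis of \<open>V\<close>.\<close>

definition rat_trace :: "'a::rat_vector set \<Rightarrow> ('a \<Rightarrow> 'a) \<Rightarrow> rat" where
  "rat_trace V f =
     (let B = (SOME B. B \<subseteq> V \<and> rat_vec.independent B \<and> rat_vec.span B = V)
      in \<Sum>b\<in>B. rat_vec.representation B (f b) b)"


section \<open>The completed ring of symmetric functions over the rationals\<close>

text \<open>A multiset \<open>M\<close> of indices stands for the monomial \<open>\<Prod>i\<in>#M. x\<^sub>i\<close>, so its degree is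
  \<open>size M\<close>. Every power series in infinitely many variables that is invariant under permutations
  of the variables is an element of the completion with respect to the degree.\<close>

typedef symfun =
  "{f :: nat multiset \<Rightarrow> rat. \<forall>\<pi>. bij \<pi> \<longrightarrow> (\<forall>M. f (image_mset \<pi> M) = f M)}"
  morphisms sf_coeff Abs_symfun
  by (rule exI[of _ "\<lambda>_. 0"]) simp

setup_lifting type_definition_symfun

lemma symfun_eqI: "(\<And>M. sf_coeff f M = sf_coeff g M) \<Longrightarrow> f = g"
  by (auto simp: sf_coeff_inject[symmetric])

lemma finite_submultisets: "finite {A. A \<subseteq># (M :: 'a multiset)}"
proof (induction M)
  case (add x M)
  have "{A. A \<subseteq># add_mset x M} \<subseteq> {A. A \<subseteq># M} \<union> add_mset x ` {A. A \<subseteq># M}"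
  proof
    fix A assume A: "A \<in> {A. A \<subseteq># add_mset x M}"
    show "A \<in> {A. A \<subseteq># M} \<union> add_mset x ` {A. A \<subseteq># M}"
    proof (cases "x \<in># A")
      case True
      then obtain B where "A = add_mset x B" by (metis multi_member_split)
      then show ?thesis using A by auto
    next
      case False
      then have "A \<subseteq># M"
        using A False by (metis diff_single_trivial mem_Collect_eq subset_eq_diff_conv
            add_mset_add_single)
      then show ?thesis by simp
    qed
  qed
  then show ?case using add.IH by (meson finite_UnI finite_imageI finite_subset)
qed simp

instantiation symfun :: comm_ring_1
begin

lift_definition zero_symfun :: symfun is "\<lambda>_. 0" by simp
lift_definition one_symfun :: symfun is "\<lambda>M. if M = {#} then 1 else 0" by simp
lift_definition plus_symfun :: "symfun \<Rightarrow> symfun \<Rightarrow> symfun" is "\<lambda>f g M. f M + g M" by simp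
lift_definition minus_symfun :: "symfun \<Rightarrow> symfun \<Rightarrow> symfun" is "\<lambda>f g M. f M - g M" by simp
lift_definition uminus_symfun :: "symfun \<Rightarrow> symfun" is "\<lambda>f M. - f M" by simp
lift_definition times_symfun :: "symfun \<Rightarrow> symfun \<Rightarrow> symfun"
  is "\<lambda>f g M. \<Sum>A | A \<subseteq># M. f A * g (M - A)"
proof -
  fix f g :: "nat multiset \<Rightarrow> rat" and \<pi> :: "nat \<Rightarrow> nat" and M
  assume f: "\<And>\<pi> M. bij \<pi> \<Longrightarrow> f (image_mset \<pi> M) = f M"
    and g: "\<And>\<pi> M. bij \<pi> \<Longrightarrow> g (image_mset \<pi> M) = g M"
    and \<pi>: "bij \<pi>"
  have inv1: "image_mset (inv \<pi>) (image_mset \<pi> A) = A" for A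
    using \<pi> by (simp add: multiset.map_comp bij_is_inj)
  have inv2: "image_mset \<pi> (image_mset (inv \<pi>) A) = A" for A
    using \<pi> by (simp add: multiset.map_comp surj_iff[THEN iffD1, OF bij_is_surj])
  show "(\<Sum>A | A \<subseteq># image_mset \<pi> M. f A * g (image_mset \<pi> M - A))
      = (\<Sum>A | A \<subseteq># M. f A * g (M - A))"
  proof (rule sum.reindex_bij_witness[of _ "image_mset \<pi>" "image_mset (inv \<pi>)"])
    fix A assume A: "A \<in> {A. A \<subseteq># image_mset \<pi> M}"
    then show "image_mset (inv \<pi>) A \<in> {A. A \<subseteq># M}"
      by (metis inv1 image_mset_subseteq_mono mem_Collect_eq)
    have "image_mset \<pi> M - A = image_mset \<pi> (M - image_mset (inv \<pi>) A)"
      using \<pi> by (simp add: image_mset_diff_if_inj bij_is_inj inv2)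
    then show "f (image_mset (inv \<pi>) A) * g (M - image_mset (inv \<pi>) A)
        = f A * g (image_mset \<pi> M - A)"
      using f g \<pi> by (simp add: bij_imp_bij_inv)
  qed (auto simp: inv1 inv2 image_mset_subseteq_mono)
qed

instance
proof
  fix a b c :: symfun
  have diff_diff_submset: "M - (M - A) = A" if "A \<subseteq># M" for A M :: "nat multiset"
    using that by (simp add: multiset_eq_iff subseteq_mset_def)
  show "a * b = b * a"
  proof (rule symfun_eqI)
    fix M
    show "sf_coeff (a * b) M = sf_coeff (b * a) M"
      unfolding times_symfun.rep_eq
      by (rule sum.reindex_bij_witness[of _ "\<lambda>A. M - A" "\<lambda>A. M - A"])
        (auto simp: diff_diff_submset mult.commute)
  qed
  show "a * b * c = a * (b * c)"
  proof (rule symfun_eqI)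
    fix M
    have "sf_coeff (a * b * c) M = (\<Sum>A | A \<subseteq># M. \<Sum>B | B \<subseteq># A.
        sf_coeff a B * sf_coeff b (A - B) * sf_coeff c (M - A))"
      by (simp add: times_symfun.rep_eq sum_distrib_right)
    also have "\<dots> = (\<Sum>(A,B)\<in>Sigma {A. A \<subseteq># M} (\<lambda>A. {B. B \<subseteq># A}).
        sf_coeff a B * sf_coeff b (A - B) * sf_coeff c (M - A))"
      by (rule sum.Sigma) (auto simp: finite_submultisets)
    also have "\<dots> = (\<Sum>(B,C)\<in>Sigma {B. B \<subseteq># M} (\<lambda>B. {C. C \<subseteq># M - B}).
        sf_coeff a B * (sf_coeff b C * sf_coeff c (M - B - C)))"
    proof (rule sum.reindex_bij_witness[of _ "\<lambda>(B,C). (B + C, B)" "\<lambda>(A,B). (B, A - B)"])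
      fix x assume "x \<in> Sigma {A. A \<subseteq># M} (\<lambda>A. {B. B \<subseteq># A})"
      then obtain A B where x: "x = (A, B)" "A \<subseteq># M" "B \<subseteq># A" by auto
      from x obtain C where "A = B + C" by (auto simp: mset_subset_eq_exists_conv)
      moreover from x obtain D where "M = A + D" by (auto simp: mset_subset_eq_exists_conv)
      ultimately show "(case case x of (A, B) \<Rightarrow> (B, A - B) of (B, C) \<Rightarrow> (B + C, B)) = x"
        "(case x of (A, B) \<Rightarrow> (B, A - B)) \<in> Sigma {B. B \<subseteq># M} (\<lambda>B. {C. C \<subseteq># M - B})"
        "(case case x of (A, B) \<Rightarrow> (B, A - B) of (B, C) \<Rightarrow>
            sf_coeff a B * (sf_coeff b C * sf_coeff c (M - B - C)))
          = (case x of (A, B) \<Rightarrow> sf_coeff a B * sf_coeff b (A - B) * sf_coeff c (M - A))"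
        using x(1) by (auto simp: add.assoc)
    next
      fix y assume "y \<in> Sigma {B. B \<subseteq># M} (\<lambda>B. {C. C \<subseteq># M - B})"
      then obtain B C where y: "y = (B, C)" "B \<subseteq># M" "C \<subseteq># M - B" by auto
      then obtain D where "M - B = C + D" by (auto simp: mset_subset_eq_exists_conv)
      then have "M = B + C + D"
        using y(2) by (metis add.assoc subset_mset.add_diff_inverse)
      with y show "(case case y of (B, C) \<Rightarrow> (B + C, B) of (A, B) \<Rightarrow> (B, A - B)) = y"
        "(case y of (B, C) \<Rightarrow> (B + C, B)) \<in> Sigma {A. A \<subseteq># M} (\<lambda>A. {B. B \<subseteq># A})"
        by auto
    qed
    also have "\<dots> = (\<Sum>B | B \<subseteq># M. \<Sum>C | C \<subseteq># M - B.
        sf_coeff a B * (sf_coeff b C * sf_coeff c (M - B - C)))"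
      by (rule sum.Sigma[symmetric]) (auto simp: finite_submultisets)
    also have "\<dots> = sf_coeff (a * (b * c)) M"
      by (simp add: times_symfun.rep_eq sum_distrib_left)
    finally show "sf_coeff (a * b * c) M = sf_coeff (a * (b * c)) M" .
  qed
  show "1 * a = a"
  proof (rule symfun_eqI)
    fix M
    have "sf_coeff (1 * a) M = (\<Sum>A | A \<subseteq># M. if A = {#} then sf_coeff a M else 0)"
      unfolding times_symfun.rep_eq one_symfun.rep_eq by (rule sum.cong) auto
    also have "\<dots> = sf_coeff a M"
      by (simp add: sum.delta finite_submultisets)
    finally show "sf_coeff (1 * a) M = sf_coeff a M" .
  qed
  show "(a + b) * c = a * c + b * c"
    by (rule symfun_eqI)
      (simp add: times_symfun.rep_eq plus_symfun.rep_eq distrib_right sum.distrib)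
  show "(0::symfun) \<noteq> 1"
    by (metis one_symfun.rep_eq zero_neq_one zero_symfun.rep_eq)
  show "a + b + c = a + (b + c)" by (rule symfun_eqI) (simp add: plus_symfun.rep_eq)
  show "a + b = b + a" by (rule symfun_eqI) (simp add: plus_symfun.rep_eq)
  show "0 + a = a" by (rule symfun_eqI) (simp add: plus_symfun.rep_eq zero_symfun.rep_eq)
  show "- a + a = 0"
    by (rule symfun_eqI) (simp add: plus_symfun.rep_eq uminus_symfun.rep_eq zero_symfun.rep_eq)
  show "a - b = a + - b"
    by (rule symfun_eqI) (simp add: plus_symfun.rep_eq uminus_symfun.rep_eq minus_symfun.rep_eq)
qed

end

instantiation symfun :: rat_vector
begin

lift_definition scaleQ_symfun :: "rat \<Rightarrow> symfun \<Rightarrow> symfun" is "\<lambda>c f M. c * f M" by simp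

instance
proof
  fix c d :: rat and x y :: symfun
  show "c *\<^sub>Q (x + y) = c *\<^sub>Q x + c *\<^sub>Q y"
    by (rule symfun_eqI) (simp add: scaleQ_symfun.rep_eq plus_symfun.rep_eq distrib_left)
  show "(c + d) *\<^sub>Q x = c *\<^sub>Q x + d *\<^sub>Q x"
    by (rule symfun_eqI) (simp add: scaleQ_symfun.rep_eq plus_symfun.rep_eq distrib_right)
  show "c *\<^sub>Q d *\<^sub>Q x = (c * d) *\<^sub>Q x"
    by (rule symfun_eqI) (simp add: scaleQ_symfun.rep_eq)
  show "1 *\<^sub>Q x = x"
    by (rule symfun_eqI) (simp add: scaleQ_symfun.rep_eq)
qed

end

text \<open>The power sum \<open>p\<^sub>k = \<Sum>i. x\<^sub>i ^ k\<close>, for \<open>k \<ge> 1\<close>.\<close>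

lift_definition psum :: "nat \<Rightarrow> symfun"
  is "\<lambda>k M. if \<exists>i. M = replicate_mset k i then 1 else 0"
proof -
  fix k :: nat
  have *: "(\<exists>i. image_mset \<pi> M = replicate_mset k i) \<longleftrightarrow> (\<exists>i. M = replicate_mset k i)"
    if "bij \<pi>" for \<pi> :: "nat \<Rightarrow> nat" and M
  proof
    assume "\<exists>i. image_mset \<pi> M = replicate_mset k i"
    then obtain i where "image_mset \<pi> M = replicate_mset k i" by blast
    then have "image_mset (inv \<pi>) (image_mset \<pi> M) = replicate_mset k (inv \<pi> i)" by simp
    then show "\<exists>i. M = replicate_mset k i"
      using that by (auto simp: multiset.map_comp bij_is_inj)
  qed auto
  fix \<pi> :: "nat \<Rightarrow> nat" and M
  assume "bij \<pi>"
  from *[OF this, of M] show "(if \<exists>i. image_mset \<pi> M = replicate_mset k i then 1 else 0)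
      = (if \<exists>i. M = replicate_mset k i then 1 else (0::rat))" by simp
qed

text \<open>Infinite sums are taken coefficientwise; this is meaningful only if each coefficient
  vanishes for all but finitely many summands, e.g. if the degrees of the summands increase.\<close>

lift_definition sf_infsum :: "(nat \<Rightarrow> symfun) \<Rightarrow> nat set \<Rightarrow> symfun"
  is "\<lambda>F I M. \<Sum>n | n \<in> I \<and> F n M \<noteq> 0. F n M"
  by (simp cong: conj_cong)

text \<open>The square root with constant term 1 of a series with constant term 1.\<close>

definition sf_sqrt :: "symfun \<Rightarrow> symfun" where
  "sf_sqrt f = (THE s. s ^ 2 = f \<and> sf_coeff s {#} = 1)"

lemma symfun_mult_const_coeff: "sf_coeff (f * g) {#} = sf_coeff f {#} * sf_coeff g {#}"
  by (simp add: times_symfun.rep_eq)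

lemma symfun_mult_eq_0:
  assumes "u * v = 0" "sf_coeff v {#} \<noteq> 0"
  shows "u = 0"
proof -
  have "sf_coeff u M = 0" for M
  proof (induction "size M" arbitrary: M rule: less_induct)
    case less
    have "(\<Sum>A | A \<subseteq># M. sf_coeff u A * sf_coeff v (M - A))
        = (\<Sum>A | A \<subseteq># M. if A = M then sf_coeff u M * sf_coeff v {#} else 0)"
    proof (rule sum.cong)
      fix A assume "A \<in> {A. A \<subseteq># M}"
      then have "A = M \<or> sf_coeff u A = 0"
        using less by (metis mem_Collect_eq mset_subset_size subset_mset.less_le)
      then show "sf_coeff u A * sf_coeff v (M - A)
          = (if A = M then sf_coeff u M * sf_coeff v {#} else 0)" by auto
    qed simp
    also have "\<dots> = sf_coeff u M * sf_coeff v {#}"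
      by (simp add: sum.delta finite_submultisets)
    finally have "sf_coeff u M * sf_coeff v {#} = sf_coeff (u * v) M"
      by (simp add: times_symfun.rep_eq)
    then show ?case using assms by (simp add: zero_symfun.rep_eq)
  qed
  then show ?thesis by (intro symfun_eqI) (simp add: zero_symfun.rep_eq)
qed

lemma sf_sqrt_eqI:
  assumes "s ^ 2 = f" "sf_coeff s {#} = 1"
  shows "sf_sqrt f = s"
  unfolding sf_sqrt_def
proof (rule the_equality)
  fix t assume t: "t ^ 2 = f \<and> sf_coeff t {#} = 1"
  then have "(t - s) * (t + s) = 0"
    using assms(1) by (simp add: power2_eq_square algebra_simps)
  moreover have "sf_coeff (t + s) {#} \<noteq> 0" using t assms(2) by (simp add: plus_symfun.rep_eq)
  ultimately have "t - s = 0" by (rule symfun_mult_eq_0)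
  then show "t = s" by simp
qed (use assms in blast)

lemma psum_1_pow_coeff_size: "sf_coeff (psum 1 ^ k) M \<noteq> 0 \<Longrightarrow> size M = k"
proof (induction k arbitrary: M)
  case 0
  then show ?case by (simp add: one_symfun.rep_eq split: if_splits)
next
  case (Suc k)
  then have "(\<Sum>A | A \<subseteq># M. sf_coeff (psum 1) A * sf_coeff (psum 1 ^ k) (M - A)) \<noteq> 0"
    by (simp add: times_symfun.rep_eq)
  then obtain A where A: "A \<subseteq># M" "sf_coeff (psum 1) A * sf_coeff (psum 1 ^ k) (M - A) \<noteq> 0"
    by (metis (mono_tags, lifting) mem_Collect_eq sum.neutral)
  then have "size A = 1" by (auto simp: psum.rep_eq split: if_splits)
  moreover have "size (M - A) = k" using A(2) by (intro Suc.IH) auto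
  ultimately show ?case using A(1) by (metis Suc_eq_plus1 add.commute size_Diff_submset
        size_mset_mono le_add_diff_inverse)
qed

lift_definition subst_psum_1 :: "rat fps \<Rightarrow> symfun"
  is "\<lambda>F M. fps_nth F (size M) * sf_coeff (psum 1 ^ size M) M"
  using sf_coeff by auto

lemma subst_psum_1_mult: "subst_psum_1 (F * G) = subst_psum_1 F * subst_psum_1 G"
proof (rule symfun_eqI)
  fix M :: "nat multiset"
  let ?N = "size M"
  let ?c = "\<lambda>k M. sf_coeff (psum 1 ^ k) M"
  have "sf_coeff (subst_psum_1 F * subst_psum_1 G) M
      = (\<Sum>A | A \<subseteq># M. fps_nth F (size A) * fps_nth G (size (M - A))
           * (?c (size A) A * ?c (size (M - A)) (M - A)))"
    by (simp add: times_symfun.rep_eq subst_psum_1.rep_eq mult_ac)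
  also have "\<dots> = (\<Sum>A | A \<subseteq># M. \<Sum>k\<le>?N. fps_nth F k * fps_nth G (?N - k)
           * (?c k A * ?c (?N - k) (M - A)))"
  proof (rule sum.cong)
    fix A assume "A \<in> {A. A \<subseteq># M}"
    then have A: "size A \<le> ?N" "size (M - A) = ?N - size A"
      by (auto simp: size_mset_mono size_Diff_submset)
    have "(\<Sum>k\<le>?N. fps_nth F k * fps_nth G (?N - k) * (?c k A * ?c (?N - k) (M - A)))
        = (\<Sum>k\<le>?N. if k = size A then fps_nth F k * fps_nth G (?N - k)
             * (?c k A * ?c (?N - k) (M - A)) else 0)"
      by (rule sum.cong) (use psum_1_pow_coeff_size[of _ A] in auto)
    also have "\<dots> = fps_nth F (size A) * fps_nth G (?N - size A)
        * (?c (size A) A * ?c (?N - size A) (M - A))"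
      using A by (simp add: sum.delta')
    finally show "fps_nth F (size A) * fps_nth G (size (M - A))
           * (?c (size A) A * ?c (size (M - A)) (M - A))
        = (\<Sum>k\<le>?N. fps_nth F k * fps_nth G (?N - k) * (?c k A * ?c (?N - k) (M - A)))"
      using A by simp
  qed simp
  also have "\<dots> = (\<Sum>k\<le>?N. fps_nth F k * fps_nth G (?N - k) * sf_coeff (psum 1 ^ k * psum 1 ^ (?N - k)) M)"
    by (subst sum.swap) (simp add: times_symfun.rep_eq sum_distrib_left)
  also have "\<dots> = (\<Sum>k\<le>?N. fps_nth F k * fps_nth G (?N - k) * ?c ?N M)"
    by (rule sum.cong) (simp_all add: power_add[symmetric])
  also have "\<dots> = sf_coeff (subst_psum_1 (F * G)) M"
    by (simp add: subst_psum_1.rep_eq fps_mult_nth sum_distrib_right atMost_atLeast0)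
  finally show "sf_coeff (subst_psum_1 (F * G)) M = sf_coeff (subst_psum_1 F * subst_psum_1 G) M" ..
qed

lemma sf_sqrt_one_minus_4_psum_1:
  "sf_sqrt (1 - 4 * psum 1) ^ 2 = 1 - 4 * psum 1" "sf_coeff (sf_sqrt (1 - 4 * psum 1)) {#} = 1"
proof -
  define F :: "rat fps" where "F = fps_radical (\<lambda>_ x. x) 2 (1 - 4 * fps_X)"
  have F2: "F ^ 2 = 1 - 4 * fps_X" and F0: "fps_nth F 0 = 1"
    unfolding F_def using power_radical[of "1 - 4 * fps_X :: rat fps" "\<lambda>_ x. x" 1]
    by (simp_all add: numeral_2_eq_2)
  let ?s = "subst_psum_1 F"
  have "?s ^ 2 = subst_psum_1 (1 - fps_const 4 * fps_X)"
    using F2 by (simp add: power2_eq_square subst_psum_1_mult[symmetric] numeral_fps_const)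
  also have "\<dots> = 1 - 4 *\<^sub>Q psum 1"
  proof (rule symfun_eqI)
    fix M :: "nat multiset"
    consider "size M = 0" | "size M = 1" | "size M \<noteq> 0" "size M \<noteq> 1" by metis
    then show "sf_coeff (subst_psum_1 (1 - fps_const 4 * fps_X)) M = sf_coeff (1 - 4 *\<^sub>Q psum 1) M"
    proof cases
      case 3
      then have "sf_coeff (psum 1) M = 0" "M \<noteq> {#}"
        using psum_1_pow_coeff_size[of 1 M] by auto
      with 3 show ?thesis
        by (simp add: subst_psum_1.rep_eq minus_symfun.rep_eq one_symfun.rep_eq scaleQ_symfun.rep_eq
            fps_X_def)
    qed (auto simp: subst_psum_1.rep_eq minus_symfun.rep_eq one_symfun.rep_eq scaleQ_symfun.rep_eq
          psum.rep_eq size_1_singleton_mset)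
  qed
  also have "4 *\<^sub>Q psum 1 = 4 * psum 1"
  proof -
    have "4 *\<^sub>Q psum 1 = (1 + 1 + 1 + 1) *\<^sub>Q psum 1" by simp
    also have "\<dots> = 4 * psum 1" by (simp only: scaleQ_add_left scaleQ_one) simp
    finally show ?thesis .
  qed
  finally have s2: "?s ^ 2 = 1 - 4 * psum 1" .
  have s0: "sf_coeff ?s {#} = 1" by (simp add: subst_psum_1.rep_eq F0 one_symfun.rep_eq)
  show "sf_sqrt (1 - 4 * psum 1) ^ 2 = 1 - 4 * psum 1"
    and "sf_coeff (sf_sqrt (1 - 4 * psum 1)) {#} = 1"
    using s2 s0 sf_sqrt_eqI[OF s2 s0] by simp_all
qed


section \<open>Characteristic functions\<close>

text \<open>A permutation of \<open>{1..N}\<close> is a function that is the identity outside this set; its orbits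
  on \<open>{1..N}\<close> are the supports of its cycles, fixed points included.\<close>

definition cycle_psum :: "nat \<Rightarrow> (nat \<Rightarrow> nat) \<Rightarrow> symfun" where
  "cycle_psum N \<sigma> = (\<Prod>C\<in>orbit \<sigma> ` {1..N}. psum (card C))"

definition frobenius_char ::
    "nat \<Rightarrow> 'a::rat_vector set \<Rightarrow> ((nat \<Rightarrow> nat) \<Rightarrow> 'a \<Rightarrow> 'a) \<Rightarrow> symfun" where
  "frobenius_char N V \<rho> =
     (1 / fact N) *\<^sub>Q (\<Sum>\<sigma> | \<sigma> permutes {1..N}. rat_trace V (\<rho> \<sigma>) *\<^sub>Q cycle_psum N \<sigma>)"

text \<open>The characteristic function of an anticyclic operad depends only on its components \<open>V n\<close>
  with the actions \<open>\<rho> n\<close> of the symmetric groups of \<open>{1..n+1}\<close>.\<close>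

definition Ch :: "(nat \<Rightarrow> 'a::rat_vector set) \<Rightarrow> (nat \<Rightarrow> (nat \<Rightarrow> nat) \<Rightarrow> 'a \<Rightarrow> 'a) \<Rightarrow> symfun" where
  "Ch V \<rho> = sf_infsum (\<lambda>n. frobenius_char (n + 1) (V n) (\<rho> n)) {1..}"


section \<open>Non-symmetric anticyclic operads\<close>

text \<open>The components \<open>P n\<close>, \<open>n \<ge> 1\<close>, are subspaces of one ambient space (e.g. of their direct
  sum), so that \<open>comp i f g\<close>, i.e. \<open>f \<circ>\<^sub>i g\<close>, need not mention the arities. The values of \<open>comp\<close>
  and \<open>\<tau> n\<close> are constrained only on the components.\<close>

locale ns_operad =
  fixes P :: "nat \<Rightarrow> 'a::rat_vector set"
    and unit :: 'a
    and comp :: "nat \<Rightarrow> 'a \<Rightarrow> 'a \<Rightarrow> 'a"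
  assumes subspace: "1 \<le> n \<Longrightarrow> rat_vec.subspace (P n)"
    and unit_closed: "unit \<in> P 1"
    and comp_closed: "\<lbrakk>f \<in> P m; g \<in> P n; 1 \<le> i; i \<le> m; 1 \<le> n\<rbrakk> \<Longrightarrow> comp i f g \<in> P (m + n - 1)"
    and comp_add_left: "\<lbrakk>f \<in> P m; f' \<in> P m; g \<in> P n; 1 \<le> i; i \<le> m; 1 \<le> n\<rbrakk>
          \<Longrightarrow> comp i (f + f') g = comp i f g + comp i f' g"
    and comp_add_right: "\<lbrakk>f \<in> P m; g \<in> P n; g' \<in> P n; 1 \<le> i; i \<le> m; 1 \<le> n\<rbrakk>
          \<Longrightarrow> comp i f (g + g') = comp i f g + comp i f g'"
    and comp_scale_left: "\<lbrakk>f \<in> P m; g \<in> P n; 1 \<le> i; i \<le> m; 1 \<le> n\<rbrakk>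
          \<Longrightarrow> comp i (c *\<^sub>Q f) g = c *\<^sub>Q comp i f g"
    and comp_scale_right: "\<lbrakk>f \<in> P m; g \<in> P n; 1 \<le> i; i \<le> m; 1 \<le> n\<rbrakk>
          \<Longrightarrow> comp i f (c *\<^sub>Q g) = c *\<^sub>Q comp i f g"
    and comp_unit_left: "\<lbrakk>f \<in> P n; 1 \<le> n\<rbrakk> \<Longrightarrow> comp 1 unit f = f"
    and comp_unit_right: "\<lbrakk>f \<in> P m; 1 \<le> i; i \<le> m\<rbrakk> \<Longrightarrow> comp i f unit = f"
    and comp_assoc_nested: "\<lbrakk>f \<in> P m; g \<in> P n; h \<in> P k; 1 \<le> i; i \<le> m; 1 \<le> j; j \<le> n; 1 \<le> k\<rbrakk>
          \<Longrightarrow> comp (i + j - 1) (comp i f g) h = comp i f (comp j g h)"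
    and comp_assoc_parallel: "\<lbrakk>f \<in> P m; g \<in> P n; h \<in> P k; 1 \<le> i; i < j; j \<le> m; 1 \<le> n; 1 \<le> k\<rbrakk>
          \<Longrightarrow> comp (j + n - 1) (comp i f g) h = comp i (comp j f h) g"

locale ns_anticyclic_operad = ns_operad P unit comp
  for P :: "nat \<Rightarrow> 'a::rat_vector set" and unit :: 'a and comp :: "nat \<Rightarrow> 'a \<Rightarrow> 'a \<Rightarrow> 'a" +
  fixes \<tau> :: "nat \<Rightarrow> 'a \<Rightarrow> 'a"
  assumes tau_closed: "\<lbrakk>f \<in> P n; 1 \<le> n\<rbrakk> \<Longrightarrow> \<tau> n f \<in> P n"
    and tau_add: "\<lbrakk>f \<in> P n; g \<in> P n; 1 \<le> n\<rbrakk> \<Longrightarrow> \<tau> n (f + g) = \<tau> n f + \<tau> n g"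
    and tau_scale: "\<lbrakk>f \<in> P n; 1 \<le> n\<rbrakk> \<Longrightarrow> \<tau> n (c *\<^sub>Q f) = c *\<^sub>Q \<tau> n f"
    and tau_order: "\<lbrakk>f \<in> P n; 1 \<le> n\<rbrakk> \<Longrightarrow> (\<tau> n ^^ (n + 1)) f = f"
    and tau_unit: "\<tau> 1 unit = - unit"
    and tau_comp: "\<lbrakk>f \<in> P m; g \<in> P n; 2 \<le> i; i \<le> m; 1 \<le> n\<rbrakk>
          \<Longrightarrow> \<tau> (m + n - 1) (comp i f g) = comp (i - 1) (\<tau> m f) g"
    and tau_comp_first: "\<lbrakk>f \<in> P m; g \<in> P n; 1 \<le> m; 1 \<le> n\<rbrakk>
          \<Longrightarrow> \<tau> (m + n - 1) (comp 1 f g) = - comp n (\<tau> n g) (\<tau> m f)"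


section \<open>The associated symmetric anticyclic operad\<close>

text \<open>\<open>P n \<otimes> \<rat>\<SS>\<^sub>n\<close>: an element is a finitely supported function \<open>F\<close> from permutations of
  \<open>{1..n}\<close> to \<open>P n\<close>, standing for \<open>\<Sum>\<sigma>. F \<sigma> \<otimes> \<sigma>\<close>; \<open>Poly_Mapping.single \<sigma> E\<close> is \<open>E \<otimes> \<sigma>\<close>.\<close>

definition sym_component :: "(nat \<Rightarrow> 'a::rat_vector set) \<Rightarrow> nat \<Rightarrow> ((nat \<Rightarrow> nat) \<Rightarrow>\<^sub>0 'a) set" where
  "sym_component P n = {F. \<forall>\<sigma>\<in>Poly_Mapping.keys F. \<sigma> permutes {1..n} \<and> Poly_Mapping.lookup F \<sigma> \<in> P n}"

definition long_cycle :: "nat \<Rightarrow> nat \<Rightarrow> nat" where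
  "long_cycle n i = (if i = 1 then n + 1 else if 2 \<le> i \<and> i \<le> n + 1 then i - 1 else i)"

text \<open>Every permutation of \<open>{1..n+1}\<close> is uniquely a product \<open>\<sigma> \<circ> long_cycle n ^^ k\<close> with \<open>k \<le> n\<close>
  and \<open>\<sigma>\<close> a permutation of \<open>{1..n}\<close>. Since the permutations of \<open>{1..n}\<close> act by multiplication from
  the left and the long cycle maps \<open>E \<otimes> 1\<close> to \<open>\<tau> n E \<otimes> 1\<close>, the action of \<open>g\<close> has to map \<open>E \<otimes> \<sigma>\<close>
  to \<open>(\<tau> n ^^ k) E \<otimes> \<sigma>'\<close> where \<open>g \<circ> \<sigma> = \<sigma>' \<circ> long_cycle n ^^ k\<close>.\<close>

definition cycle_exponent :: "nat \<Rightarrow> (nat \<Rightarrow> nat) \<Rightarrow> nat" where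
  "cycle_exponent n g = (THE k. k \<le> n \<and> g \<circ> inv (long_cycle n ^^ k) permutes {1..n})"

definition sym_act ::
    "(nat \<Rightarrow> 'a \<Rightarrow> 'a) \<Rightarrow> nat \<Rightarrow> (nat \<Rightarrow> nat) \<Rightarrow> ((nat \<Rightarrow> nat) \<Rightarrow>\<^sub>0 'a::rat_vector) \<Rightarrow> (nat \<Rightarrow> nat) \<Rightarrow>\<^sub>0 'a"
  where
  "sym_act \<tau> n g F =
     (\<Sum>\<sigma>\<in>Poly_Mapping.keys F. let k = cycle_exponent n (g \<circ> \<sigma>) in
        Poly_Mapping.single (g \<circ> \<sigma> \<circ> inv (long_cycle n ^^ k)) ((\<tau> n ^^ k) (Poly_Mapping.lookup F \<sigma>)))"

lemma bij_long_cycle: "bij (long_cycle n)"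
proof (rule o_bij)
  let ?d = "\<lambda>i. if i = n + 1 then 1 else if 1 \<le> i \<and> i \<le> n then i + 1 else i"
  show "?d \<circ> long_cycle n = id" "long_cycle n \<circ> ?d = id"
    by (auto simp: long_cycle_def fun_eq_iff)
qed

lemma inv_long_cycle_pow:
  assumes "k \<le> n"
  shows "inv (long_cycle n ^^ k) (n + 1) = (if k = 0 then n + 1 else k)"
proof -
  have bij: "bij (long_cycle n ^^ k)" using bij_fn[OF bij_long_cycle] .
  have "(long_cycle n ^^ j) k = k - j" if "j < k" for j
    using that assms by (induction j) (auto simp: long_cycle_def)
  then have "(long_cycle n ^^ k) k = n + 1" if "k \<noteq> 0"
    using that by (cases k) (auto simp: long_cycle_def)
  then have "(long_cycle n ^^ k) (if k = 0 then n + 1 else k) = n + 1" by simp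
  then show ?thesis by (rule inv_f_eq[OF bij_is_inj[OF bij]])
qed

lemma cycle_exponent_eqI:
  assumes "k \<le> n" "g \<circ> inv (long_cycle n ^^ k) permutes {1..n}"
  shows "cycle_exponent n g = k"
  unfolding cycle_exponent_def
proof (rule the_equality)
  fix k' assume k': "k' \<le> n \<and> g \<circ> inv (long_cycle n ^^ k') permutes {1..n}"
  have *: "g (if j = 0 then n + 1 else j) = n + 1"
    if "j \<le> n" "g \<circ> inv (long_cycle n ^^ j) permutes {1..n}" for j
    using permutes_not_in[OF that(2), of "n + 1"] inv_long_cycle_pow[OF that(1)] by simp
  have bij: "bij (inv (long_cycle n ^^ k))"
    using bij_fn[OF bij_long_cycle] by (rule bij_imp_bij_inv)
  have "g = (g \<circ> inv (long_cycle n ^^ k)) \<circ> inv (inv (long_cycle n ^^ k))"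
    by (simp only: comp_assoc surj_iff[THEN iffD1, OF bij_is_surj[OF bij]] comp_id)
  moreover have "bij ((g \<circ> inv (long_cycle n ^^ k)) \<circ> inv (inv (long_cycle n ^^ k)))"
    by (rule bij_comp[OF bij_imp_bij_inv[OF bij] permutes_bij[OF assms(2)]])
  ultimately have "bij g" by (rule ssubst[where P = bij])
  then have "inj g" by (rule bij_is_inj)
  then have "(if k = 0 then n + 1 else k) = (if k' = 0 then n + 1 else k')"
  proof (rule injD)
    show "g (if k = 0 then n + 1 else k) = g (if k' = 0 then n + 1 else k')"
      using *[OF assms] *[of k'] k' by simp
  qed
  then show "k' = k" using assms(1) k' by (auto split: if_splits)
qed (use assms in blast)

text \<open>The two properties that determine the action:\<close>

lemma sym_act_perm:
  assumes "\<pi> permutes {1..n}" "\<sigma> permutes {1..n}"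
  shows "sym_act \<tau> n \<pi> (Poly_Mapping.single \<sigma> E) = Poly_Mapping.single (\<pi> \<circ> \<sigma>) E"
proof -
  have "cycle_exponent n (\<pi> \<circ> \<sigma>) = 0"
    by (rule cycle_exponent_eqI) (use permutes_compose[OF assms(2,1)] in simp_all)
  then show ?thesis by (simp add: sym_act_def)
qed

lemma sym_act_long_cycle:
  assumes "1 \<le> n" "\<tau> n 0 = 0"
  shows "sym_act \<tau> n (long_cycle n) (Poly_Mapping.single id E) = Poly_Mapping.single id (\<tau> n E)"
proof -
  have *: "long_cycle n \<circ> inv (long_cycle n) = id"
    using bij_long_cycle by (metis bij_is_surj surj_iff)
  have "cycle_exponent n (long_cycle n) = 1"
    by (rule cycle_exponent_eqI) (use assms * in \<open>auto simp: permutes_id\<close>)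
  then show ?thesis using assms * by (simp add: sym_act_def)
qed


section \<open>The free non-symmetric operad on binary generators\<close>

datatype 'g btree = Leaf | Node 'g "'g btree" "'g btree"

fun leaves :: "'g btree \<Rightarrow> nat" where
  "leaves Leaf = 1"
| "leaves (Node g l r) = leaves l + leaves r"

text \<open>\<open>graft i t s\<close> replaces the \<open>i\<close>th leaf of \<open>t\<close> (from the left, starting at 1) by \<open>s\<close>.\<close>

fun graft :: "nat \<Rightarrow> 'g btree \<Rightarrow> 'g btree \<Rightarrow> 'g btree" where
  "graft i Leaf s = s"
| "graft i (Node g l r) s =
     (if i \<le> leaves l then Node g (graft i l s) r else Node g l (graft (i - leaves l) r s))"

abbreviation tree_elem :: "'g btree \<Rightarrow> 'g btree \<Rightarrow>\<^sub>0 rat" where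
  "tree_elem t \<equiv> Poly_Mapping.single t 1"

definition lin_ext :: "('b \<Rightarrow> 'a::rat_vector) \<Rightarrow> ('b \<Rightarrow>\<^sub>0 rat) \<Rightarrow> 'a" where
  "lin_ext \<phi> x = (\<Sum>t\<in>Poly_Mapping.keys x. Poly_Mapping.lookup x t *\<^sub>Q \<phi> t)"

definition free_comp :: "nat \<Rightarrow> ('g btree \<Rightarrow>\<^sub>0 rat) \<Rightarrow> ('g btree \<Rightarrow>\<^sub>0 rat) \<Rightarrow> 'g btree \<Rightarrow>\<^sub>0 rat" where
  "free_comp i x y =
     lin_ext (\<lambda>t. lin_ext (\<lambda>s. if 1 \<le> i \<and> i \<le> leaves t then tree_elem (graft i t s) else 0) y) x"

lemma lin_ext_superset:
  assumes "finite A" "Poly_Mapping.keys x \<subseteq> A"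
  shows "lin_ext \<phi> x = (\<Sum>t\<in>A. Poly_Mapping.lookup x t *\<^sub>Q \<phi> t)"
  unfolding lin_ext_def
  by (rule sum.mono_neutral_left) (use assms in \<open>auto simp: in_keys_iff\<close>)

lemma lin_ext_add: "lin_ext \<phi> (x + y) = lin_ext \<phi> x + lin_ext \<phi> y"
proof -
  let ?A = "Poly_Mapping.keys x \<union> Poly_Mapping.keys y"
  have "finite ?A" by simp
  then show ?thesis
    using Poly_Mapping.keys_add[of x y]
    by (simp add: lin_ext_superset[of ?A] lookup_add scaleQ_add_left sum.distrib)
qed

lemma lin_ext_scale: "lin_ext \<phi> (c *\<^sub>Q x) = c *\<^sub>Q lin_ext \<phi> x"
proof -
  have "Poly_Mapping.keys (c *\<^sub>Q x) \<subseteq> Poly_Mapping.keys x"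
    by (auto simp: in_keys_iff)
  then show ?thesis
    by (simp add: lin_ext_superset[of "Poly_Mapping.keys x"] rat_vec.scale_sum_right)
qed

lemma lin_ext_zero: "lin_ext \<phi> 0 = 0"
  by (simp add: lin_ext_def)

lemma lin_ext_tree_elem: "lin_ext \<phi> (tree_elem t) = \<phi> t"
  by (simp add: lin_ext_def)

lemma lin_ext_fun_add: "lin_ext (\<lambda>t. \<phi> t + \<psi> t) x = lin_ext \<phi> x + lin_ext \<psi> x"
  by (simp add: lin_ext_def scaleQ_add_right sum.distrib)

lemma lin_ext_fun_scale: "lin_ext (\<lambda>t. c *\<^sub>Q \<phi> t) x = c *\<^sub>Q lin_ext \<phi> x"
  by (simp add: lin_ext_def rat_vec.scale_sum_right mult.commute)

lemma free_comp_add_left: "free_comp i (x + x') y = free_comp i x y + free_comp i x' y"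
  by (simp add: free_comp_def lin_ext_add)

lemma free_comp_add_right: "free_comp i x (y + y') = free_comp i x y + free_comp i x y'"
  by (simp add: free_comp_def lin_ext_add lin_ext_fun_add)

lemma free_comp_scale_left: "free_comp i (c *\<^sub>Q x) y = c *\<^sub>Q free_comp i x y"
  by (simp add: free_comp_def lin_ext_scale)

lemma free_comp_scale_right: "free_comp i x (c *\<^sub>Q y) = c *\<^sub>Q free_comp i x y"
  by (simp add: free_comp_def lin_ext_scale lin_ext_fun_scale)

lemma free_comp_zero [simp]: "free_comp i 0 y = 0" "free_comp i x 0 = 0"
  by (simp_all add: free_comp_def lin_ext_zero) (simp add: lin_ext_def)

lemma free_comp_diff_left: "free_comp i (x - x') y = free_comp i x y - free_comp i x' y"
  by (metis add_diff_cancel_right' diff_add_cancel free_comp_add_left)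

lemma free_comp_diff_right: "free_comp i x (y - y') = free_comp i x y - free_comp i x y'"
  by (metis add_diff_cancel_right' diff_add_cancel free_comp_add_right)

lemma free_comp_tree_elem:
  "free_comp i (tree_elem t) (tree_elem s)
     = (if 1 \<le> i \<and> i \<le> leaves t then tree_elem (graft i t s) else 0)"
  by (simp add: free_comp_def lin_ext_tree_elem)

lemma free_induct [consumes 1, case_names zero add elem]:
  assumes "Poly_Mapping.keys x \<subseteq> T" "Q 0" "\<And>x y. Q x \<Longrightarrow> Q y \<Longrightarrow> Q (x + y)"
    "\<And>c t. t \<in> T \<Longrightarrow> Q (c *\<^sub>Q tree_elem t)"
  shows "Q x"
proof -
  have x: "x = (\<Sum>t\<in>Poly_Mapping.keys x. Poly_Mapping.lookup x t *\<^sub>Q tree_elem t)"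
    by (rule poly_mapping_eqI)
      (auto simp: lookup_sum lookup_single when_def in_keys_iff if_distrib sum.delta cong: if_cong)
  have "Q (\<Sum>t\<in>A. Poly_Mapping.lookup x t *\<^sub>Q tree_elem t)" if "finite A" "A \<subseteq> T" for A
    using that by (induction rule: finite_induct) (use assms in auto)
  then show ?thesis using x assms(1) by (metis finite_keys)
qed

lemma leaves_pos [simp]: "Suc 0 \<le> leaves t"
  by (induction t) auto

lemma leaves_nonzero [simp]: "leaves t \<noteq> 0"
  using leaves_pos[of t] by linarith

lemma leaves_graft: "1 \<le> i \<Longrightarrow> i \<le> leaves t \<Longrightarrow> leaves (graft i t s) = leaves t + leaves s - 1"
proof (induction t arbitrary: i)
  case (Node g l r)
  then show ?case
    by (cases "i \<le> leaves l") (use leaves_pos[of l] leaves_pos[of r] leaves_pos[of s] in auto)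
qed simp

lemma graft_Leaf: "1 \<le> i \<Longrightarrow> i \<le> leaves t \<Longrightarrow> graft i t Leaf = t"
  by (induction t arbitrary: i) auto

lemma graft_nested:
  "\<lbrakk>1 \<le> i; i \<le> leaves t; 1 \<le> j; j \<le> leaves s\<rbrakk>
     \<Longrightarrow> graft (i + j - 1) (graft i t s) u = graft i t (graft j s u)"
proof (induction t arbitrary: i)
  case (Node g l r)
  show ?case
  proof (cases "i \<le> leaves l")
    case True
    moreover have "i + j - 1 \<le> leaves l + leaves s - 1"
      using True Node.prems by linarith
    ultimately show ?thesis using Node by (simp add: leaves_graft)
  next
    case False
    then have "i + j - 1 - leaves l = i - leaves l + j - 1" "\<not> i + j - 1 \<le> leaves l"
      using Node.prems by auto
    moreover have "graft (i - leaves l + j - 1) (graft (i - leaves l) r s) u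
        = graft (i - leaves l) r (graft j s u)"
      using Node.prems False by (intro Node.IH(2)) auto
    ultimately show ?thesis using False by simp
  qed
qed auto

lemma graft_parallel:
  "\<lbrakk>1 \<le> i; i < j; j \<le> leaves t\<rbrakk>
     \<Longrightarrow> graft (j + leaves s - 1) (graft i t s) u = graft i (graft j t u) s"
proof (induction t arbitrary: i j)
  case (Node g l r)
  note s = leaves_pos[of s] and u = leaves_pos[of u]
  consider "j \<le> leaves l" | "i \<le> leaves l" "leaves l < j" | "leaves l < i" by linarith
  then show ?case
  proof cases
    case 1
    then have "j + leaves s - 1 \<le> leaves l + leaves s - 1" "i \<le> leaves l + leaves u - 1"
      using Node.prems s u by linarith+
    with 1 show ?thesis using Node.prems Node.IH(1)[of i j] by (simp add: leaves_graft)
  next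
    case 2
    then have "j + leaves s - 1 - (leaves l + leaves s - 1) = j - leaves l"
      "\<not> j + leaves s - 1 \<le> leaves l + leaves s - 1"
      using s leaves_pos[of l] by linarith+
    with 2 show ?thesis using Node.prems by (simp add: leaves_graft)
  next
    case 3
    then have "j + leaves s - 1 - leaves l = j - leaves l + leaves s - 1"
      "\<not> j + leaves s - 1 \<le> leaves l"
      using Node.prems s by linarith+
    with 3 show ?thesis using Node.prems Node.IH(2)[of "i - leaves l" "j - leaves l"] by simp
  qed
qed auto

definition free_component :: "nat \<Rightarrow> ('g btree \<Rightarrow>\<^sub>0 rat) set" where
  "free_component n = {x. \<forall>t\<in>Poly_Mapping.keys x. leaves t = n}"

lemma free_component_subspace: "rat_vec.subspace (free_component n)"
proof (rule rat_vec.subspaceI)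
  fix x y :: "'g btree \<Rightarrow>\<^sub>0 rat"
  assume "x \<in> free_component n" "y \<in> free_component n"
  then show "x + y \<in> free_component n"
    unfolding free_component_def using Poly_Mapping.keys_add[of x y] by blast
qed (auto simp: free_component_def in_keys_iff)

lemma tree_elem_in_component: "tree_elem t \<in> free_component n \<longleftrightarrow> leaves t = n"
  by (simp add: free_component_def)

lemma free_component_induct [consumes 1, case_names zero add elem]:
  assumes "x \<in> free_component n" "Q 0" "\<And>x y. Q x \<Longrightarrow> Q y \<Longrightarrow> Q (x + y)"
    "\<And>c t. leaves t = n \<Longrightarrow> Q (c *\<^sub>Q tree_elem t)"
  shows "Q x"
  using free_induct[of x "{t. leaves t = n}" Q] assms by (auto simp: free_component_def)

lemmas free_comp_linear =
  free_comp_add_left free_comp_add_right free_comp_scale_left free_comp_scale_right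

lemma ns_operad_free:
  "ns_operad free_component (tree_elem Leaf :: 'g btree \<Rightarrow>\<^sub>0 rat) free_comp"
proof
  fix m n i and f g :: "'g btree \<Rightarrow>\<^sub>0 rat"
  assume f: "f \<in> free_component m" and g: "g \<in> free_component n"
    and i: "1 \<le> i" "i \<le> m"
  note sub = rat_vec.subspace_add[OF free_component_subspace]
    rat_vec.subspace_scale[OF free_component_subspace] rat_vec.subspace_0[OF free_component_subspace]
  show "free_comp i f g \<in> free_component (m + n - 1)"
    using f
  proof (induction rule: free_component_induct)
    case (elem c t)
    from g show ?case
      by (induction rule: free_component_induct)
        (use i elem in \<open>auto simp: free_comp_linear free_comp_tree_elem tree_elem_in_component
            leaves_graft intro!: sub\<close>)
  qed (auto simp: free_comp_linear intro: sub)
next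
  fix f :: "'g btree \<Rightarrow>\<^sub>0 rat" and n
  assume "f \<in> free_component n"
  then show "free_comp 1 (tree_elem Leaf) f = f"
    by (induction rule: free_component_induct) (auto simp: free_comp_linear free_comp_tree_elem)
next
  fix f :: "'g btree \<Rightarrow>\<^sub>0 rat" and m i
  assume "f \<in> free_component m" "1 \<le> i" "i \<le> m"
  then show "free_comp i f (tree_elem Leaf) = f"
    by (induction rule: free_component_induct)
      (auto simp: free_comp_linear free_comp_tree_elem graft_Leaf)
next
  fix m n k i j and f g h :: "'g btree \<Rightarrow>\<^sub>0 rat"
  assume f: "f \<in> free_component m" and g: "g \<in> free_component n" and h: "h \<in> free_component k"
    and i: "1 \<le> i" "i \<le> m" and j: "1 \<le> j" "j \<le> n"
  show "free_comp (i + j - 1) (free_comp i f g) h = free_comp i f (free_comp j g h)"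
    using f
  proof (induction rule: free_component_induct)
    case (elem c t)
    from g show ?case
    proof (induction rule: free_component_induct)
      case (elem d s)
      from h show ?case
      proof (induction rule: free_component_induct)
        case (elem e u)
        have "graft (i + j - 1) (graft i t s) u = graft i t (graft j s u)"
          using i j \<open>leaves t = m\<close> \<open>leaves s = n\<close> by (intro graft_nested) auto
        moreover have "i + j - 1 \<le> m + n - 1" "1 \<le> i + j - 1"
          using i j by linarith+
        ultimately show ?case
          using i j \<open>leaves t = m\<close> \<open>leaves s = n\<close>
          by (simp add: free_comp_linear free_comp_tree_elem leaves_graft mult_ac)
      qed (auto simp: free_comp_linear rat_vec.scale_right_distrib)
    qed (auto simp: free_comp_linear rat_vec.scale_right_distrib)
  qed (auto simp: free_comp_linear)
next
  fix m n k i j and f g h :: "'g btree \<Rightarrow>\<^sub>0 rat"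
  assume f: "f \<in> free_component m" and g: "g \<in> free_component n" and h: "h \<in> free_component k"
    and i: "1 \<le> i" "i < j" "j \<le> m" and n: "1 \<le> n" "1 \<le> k"
  show "free_comp (j + n - 1) (free_comp i f g) h = free_comp i (free_comp j f h) g"
    using f
  proof (induction rule: free_component_induct)
    case (elem c t)
    from g show ?case
    proof (induction rule: free_component_induct)
      case (elem d s)
      from h show ?case
      proof (induction rule: free_component_induct)
        case (elem e u)
        have "graft (j + n - 1) (graft i t s) u = graft i (graft j t u) s"
          using graft_parallel[of i j t s u] i \<open>leaves t = m\<close> \<open>leaves s = n\<close> by simp
        moreover have "j + n - 1 \<le> m + n - 1" "i \<le> m + leaves u - 1" "1 \<le> j + n - 1"
          using i n leaves_pos[of u] by linarith+
        ultimately show ?case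
          using i \<open>leaves t = m\<close> \<open>leaves s = n\<close>
          by (simp add: free_comp_linear free_comp_tree_elem leaves_graft mult_ac)
      qed (auto simp: free_comp_linear rat_vec.scale_right_distrib)
    qed (auto simp: free_comp_linear rat_vec.scale_right_distrib)
  qed (auto simp: free_comp_linear)
qed (auto simp: free_comp_linear free_component_subspace tree_elem_in_component)

inductive_set operad_ideal :: "('g btree \<Rightarrow>\<^sub>0 rat) set \<Rightarrow> ('g btree \<Rightarrow>\<^sub>0 rat) set"
  for R :: "('g btree \<Rightarrow>\<^sub>0 rat) set" where
  gen: "x \<in> R \<Longrightarrow> x \<in> operad_ideal R"
| zero: "0 \<in> operad_ideal R"
| add: "x \<in> operad_ideal R \<Longrightarrow> y \<in> operad_ideal R \<Longrightarrow> x + y \<in> operad_ideal R"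
| scale: "x \<in> operad_ideal R \<Longrightarrow> c *\<^sub>Q x \<in> operad_ideal R"
| comp_left: "x \<in> operad_ideal R \<Longrightarrow> free_comp i x y \<in> operad_ideal R"
| comp_right: "y \<in> operad_ideal R \<Longrightarrow> free_comp i x y \<in> operad_ideal R"

section \<open>The dendriform operad\<close>

text \<open>The generators \<open>x \<prec> y\<close> (\<open>Prec\<close>) and \<open>x \<succ> y\<close> (\<open>Succ\<close>).\<close>

datatype dend_gen = Prec | Succ

definition dend_rel :: "(dend_gen btree \<Rightarrow>\<^sub>0 rat) set" where
  "dend_rel =
    {tree_elem (Node Prec (Node Prec Leaf Leaf) Leaf)
       - (tree_elem (Node Prec Leaf (Node Prec Leaf Leaf))
          + tree_elem (Node Prec Leaf (Node Succ Leaf Leaf))),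
     tree_elem (Node Succ Leaf (Node Prec Leaf Leaf))
       - tree_elem (Node Prec (Node Succ Leaf Leaf) Leaf),
     tree_elem (Node Succ Leaf (Node Succ Leaf Leaf))
       - (tree_elem (Node Succ (Node Succ Leaf Leaf) Leaf)
          + tree_elem (Node Succ (Node Prec Leaf Leaf) Leaf))}"

lemma operad_ideal_uminus: "x \<in> operad_ideal R \<Longrightarrow> - x \<in> operad_ideal R"
  using operad_ideal.scale[of x R "-1"] by simp

lemma operad_ideal_diff: "x \<in> operad_ideal R \<Longrightarrow> y \<in> operad_ideal R \<Longrightarrow> x - y \<in> operad_ideal R"
  using operad_ideal.add[OF _ operad_ideal_uminus, of x R y] by simp

text \<open>The direct sum of all components of the quotient operad.\<close>

quotient_type dend = "dend_gen btree \<Rightarrow>\<^sub>0 rat" / "\<lambda>x y. x - y \<in> operad_ideal dend_rel"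
proof (rule equivpI)
  show "reflp (\<lambda>x y. x - y \<in> operad_ideal dend_rel)"
    by (auto intro!: reflpI operad_ideal.zero)
  show "symp (\<lambda>x y. x - y \<in> operad_ideal dend_rel)"
    by (rule sympI) (drule operad_ideal_uminus, simp)
  show "transp (\<lambda>x y. x - y \<in> operad_ideal dend_rel)"
    by (rule transpI) (drule (1) operad_ideal.add, simp)
qed

instantiation dend :: rat_vector
begin

lift_definition zero_dend :: dend is 0 .
lift_definition plus_dend :: "dend \<Rightarrow> dend \<Rightarrow> dend" is "(+)"
  unfolding add_diff_add by (rule operad_ideal.add)
lift_definition uminus_dend :: "dend \<Rightarrow> dend" is uminus
  unfolding minus_diff_minus by (rule operad_ideal_uminus)
lift_definition minus_dend :: "dend \<Rightarrow> dend \<Rightarrow> dend" is "(-)"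
proof -
  fix x x' y y' :: "dend_gen btree \<Rightarrow>\<^sub>0 rat"
  assume "x - x' \<in> operad_ideal dend_rel" "y - y' \<in> operad_ideal dend_rel"
  then have "(x - x') - (y - y') \<in> operad_ideal dend_rel" by (rule operad_ideal_diff)
  then show "(x - y) - (x' - y') \<in> operad_ideal dend_rel" by (simp add: algebra_simps)
qed
lift_definition scaleQ_dend :: "rat \<Rightarrow> dend \<Rightarrow> dend" is scaleQ
  unfolding rat_vec.scale_right_diff_distrib[symmetric] by (rule operad_ideal.scale)

instance
proof
  fix a b c :: dend and q r :: rat
  have eq: "x = y \<Longrightarrow> x - y \<in> operad_ideal dend_rel" for x y :: "dend_gen btree \<Rightarrow>\<^sub>0 rat"
    by (simp add: operad_ideal.zero)
  show "a + b + c = a + (b + c)" by transfer (rule eq, simp add: add.assoc)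
  show "a + b = b + a" by transfer (rule eq, simp add: add.commute)
  show "0 + a = a" by transfer (rule eq, simp)
  show "- a + a = 0" by transfer (rule eq, simp)
  show "a - b = a + - b" by transfer (rule eq, simp)
  show "q *\<^sub>Q (a + b) = q *\<^sub>Q a + q *\<^sub>Q b" by transfer (rule eq, rule scaleQ_add_right)
  show "(q + r) *\<^sub>Q a = q *\<^sub>Q a + r *\<^sub>Q a" by transfer (rule eq, rule scaleQ_add_left)
  show "q *\<^sub>Q r *\<^sub>Q a = (q * r) *\<^sub>Q a" by transfer (rule eq, rule scaleQ_scaleQ)
  show "1 *\<^sub>Q a = a" by transfer (rule eq, rule scaleQ_one)
qed

end

lift_definition dend_comp :: "nat \<Rightarrow> dend \<Rightarrow> dend \<Rightarrow> dend" is free_comp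
proof -
  fix i and x x' y y' :: "dend_gen btree \<Rightarrow>\<^sub>0 rat"
  assume "x - x' \<in> operad_ideal dend_rel" "y - y' \<in> operad_ideal dend_rel"
  then have "free_comp i (x - x') y + free_comp i x' (y - y') \<in> operad_ideal dend_rel"
    by (intro operad_ideal.add operad_ideal.comp_left operad_ideal.comp_right)
  then show "free_comp i x y - free_comp i x' y' \<in> operad_ideal dend_rel"
    by (simp add: free_comp_diff_left free_comp_diff_right)
qed

definition Dend :: "nat \<Rightarrow> dend set" where
  "Dend n = abs_dend ` free_component n"

definition dend_unit :: dend where
  "dend_unit = abs_dend (tree_elem Leaf)"

definition dend_prec :: dend where
  "dend_prec = abs_dend (tree_elem (Node Prec Leaf Leaf))"

definition dend_succ :: dend where
  "dend_succ = abs_dend (tree_elem (Node Succ Leaf Leaf))"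

lemma ns_operad_Dend: "ns_operad Dend dend_unit dend_comp"
proof -
  interpret F: ns_operad free_component "tree_elem Leaf :: dend_gen btree \<Rightarrow>\<^sub>0 rat" free_comp
    by (rule ns_operad_free)
  note abs = plus_dend.abs_eq scaleQ_dend.abs_eq dend_comp.abs_eq
  show ?thesis
  proof
    fix n :: nat
    show "rat_vec.subspace (Dend n)"
    proof (rule rat_vec.subspaceI)
      show "0 \<in> Dend n"
        unfolding Dend_def zero_dend.abs_eq
        by (rule imageI) (rule rat_vec.subspace_0[OF free_component_subspace])
    next
      fix x y assume "x \<in> Dend n" "y \<in> Dend n"
      then show "x + y \<in> Dend n"
        unfolding Dend_def
        by (auto simp: abs intro!: imageI rat_vec.subspace_add[OF free_component_subspace])
    next
      fix c x assume "x \<in> Dend n"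
      then show "c *\<^sub>Q x \<in> Dend n"
        unfolding Dend_def
        by (auto simp: abs intro!: imageI rat_vec.subspace_scale[OF free_component_subspace])
    qed
  qed (auto simp: Dend_def dend_unit_def abs F.unit_closed F.comp_closed F.comp_add_left
      F.comp_add_right F.comp_scale_left F.comp_scale_right F.comp_unit_left F.comp_unit_right
      F.comp_assoc_nested F.comp_assoc_parallel simp del: One_nat_def intro!: imageI F.comp_closed)
qed

text \<open>Existence of the anticyclic structure: on the free operad, the values on the generators and the
  two composition identities determine it recursively, and it preserves the ideal of relations.\<close>

fun tau_gen :: "dend_gen \<Rightarrow> dend_gen btree \<Rightarrow>\<^sub>0 rat" where
  "tau_gen Succ = tree_elem (Node Prec Leaf Leaf)"
| "tau_gen Prec = - tree_elem (Node Prec Leaf Leaf) - tree_elem (Node Succ Leaf Leaf)"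

fun tau_tree :: "dend_gen btree \<Rightarrow> dend_gen btree \<Rightarrow>\<^sub>0 rat" where
  "tau_tree Leaf = - tree_elem Leaf"
| "tau_tree (Node g l r) =
     - free_comp (leaves l) (tau_tree l) (free_comp 1 (tau_gen g) (tree_elem r))"

definition free_tau :: "(dend_gen btree \<Rightarrow>\<^sub>0 rat) \<Rightarrow> dend_gen btree \<Rightarrow>\<^sub>0 rat" where
  "free_tau = lin_ext tau_tree"

lemma free_tau_linear:
  "free_tau (x + y) = free_tau x + free_tau y" "free_tau (c *\<^sub>Q x) = c *\<^sub>Q free_tau x"
  "free_tau 0 = 0" "free_tau (tree_elem t) = tau_tree t"
  by (simp_all add: free_tau_def lin_ext_add lin_ext_scale lin_ext_zero lin_ext_tree_elem)

lemma free_tau_minus: "free_tau (- x) = - free_tau x" "free_tau (x - y) = free_tau x - free_tau y"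
  using free_tau_linear(2)[of "-1" x] free_tau_linear(1)[of "x - y" y] by simp_all

lemma free_comp_minus:
  "free_comp i (- x) y = - free_comp i x y" "free_comp i x (- y) = - free_comp i x y"
  using free_comp_scale_left[of i "-1" x y] free_comp_scale_right[of i x "-1" y] by simp_all

interpretation free: ns_operad free_component "tree_elem Leaf :: 'g btree \<Rightarrow>\<^sub>0 rat" free_comp
  by (rule ns_operad_free)

lemma free_component_minus: "x \<in> free_component n \<Longrightarrow> - x \<in> free_component n"
  by (rule rat_vec.subspace_neg[OF free_component_subspace])

lemma tau_gen_component: "tau_gen g \<in> free_component 2"
  by (cases g) (auto simp: tree_elem_in_component
      intro!: rat_vec.subspace_diff[OF free_component_subspace] free_component_minus)

lemma tau_gen_comp_component:
  "free_comp 1 (tau_gen g) (tree_elem r) \<in> free_component (leaves r + 1)"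
  using free.comp_closed[OF tau_gen_component[of g], of "tree_elem r" "leaves r" 1]
  by (simp add: tree_elem_in_component)

lemma tau_tree_component: "tau_tree t \<in> free_component (leaves t)"
proof (induction t)
  case (Node g l r)
  have "free_comp (leaves l) (tau_tree l) (free_comp 1 (tau_gen g) (tree_elem r))
      \<in> free_component (leaves l + (leaves r + 1) - 1)"
    by (rule free.comp_closed[OF Node.IH(1) tau_gen_comp_component]) auto
  then show ?case by (simp add: free_component_minus)
qed (simp add: free_component_minus tree_elem_in_component)

lemma tau_tree_graft_1:
  "tau_tree (graft 1 t s) = - free_comp (leaves s) (tau_tree s) (tau_tree t)"
proof (induction t)
  case Leaf
  then show ?case
    using free.comp_unit_right[OF tau_tree_component[of s], of "leaves s"]
    by (simp add: free_comp_minus)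
next
  case (Node g l r)
  let ?X = "free_comp 1 (tau_gen g) (tree_elem r)"
  have "free_comp (leaves s + leaves l - 1) (free_comp (leaves s) (tau_tree s) (tau_tree l)) ?X
      = free_comp (leaves s) (tau_tree s) (free_comp (leaves l) (tau_tree l) ?X)"
    by (rule free.comp_assoc_nested[OF tau_tree_component tau_tree_component tau_gen_comp_component]) auto
  then show ?case
    using Node leaves_pos[of l]
    by (simp add: free_comp_minus leaves_graft add.commute del: leaves_pos)
qed

lemma tau_tree_graft:
  "2 \<le> i \<Longrightarrow> i \<le> leaves t
     \<Longrightarrow> tau_tree (graft i t s) = free_comp (i - 1) (tau_tree t) (tree_elem s)"
proof (induction t arbitrary: i)
  case (Node g l r)
  let ?X = "free_comp 1 (tau_gen g) (tree_elem r)"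
  let ?a = "leaves l" and ?n = "leaves s"
  have s: "tree_elem s \<in> free_component ?n" and r: "tree_elem r \<in> free_component (leaves r)"
    by (simp_all add: tree_elem_in_component)
  show ?case
  proof (cases "i \<le> ?a")
    case True
    have "free_comp (?a + ?n - 1) (free_comp (i - 1) (tau_tree l) (tree_elem s)) ?X
        = free_comp (i - 1) (free_comp ?a (tau_tree l) ?X) (tree_elem s)"
      by (rule free.comp_assoc_parallel[OF tau_tree_component s tau_gen_comp_component])
        (use Node.prems True in auto)
    then show ?thesis using True Node by (simp add: leaves_graft free_comp_minus)
  next
    case False
    let ?k = "i - ?a"
    have k: "1 \<le> ?k" "?k \<le> leaves r" using False Node.prems by auto
    have "free_comp (1 + ?k - 1) (free_comp 1 (tau_gen g) (tree_elem r)) (tree_elem s)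
        = free_comp 1 (tau_gen g) (free_comp ?k (tree_elem r) (tree_elem s))"
      by (rule free.comp_assoc_nested[OF tau_gen_component r s]) (use k in auto)
    moreover have "free_comp (?a + ?k - 1) (free_comp ?a (tau_tree l) ?X) (tree_elem s)
        = free_comp ?a (tau_tree l) (free_comp ?k ?X (tree_elem s))"
      by (rule free.comp_assoc_nested[OF tau_tree_component tau_gen_comp_component s])
        (use k in auto)
    moreover have "?a + ?k - 1 = i - 1" using False by auto
    ultimately show ?thesis
      using False k by (simp add: free_comp_minus free_comp_tree_elem)
  qed
qed simp

lemma free_tau_component: "x \<in> free_component n \<Longrightarrow> free_tau x \<in> free_component n"
  by (induction rule: free_component_induct)
    (auto simp: free_tau_linear tau_tree_component
      intro!: rat_vec.subspace_add[OF free_component_subspace]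
        rat_vec.subspace_scale[OF free_component_subspace]
        rat_vec.subspace_0[OF free_component_subspace])

lemma free_tau_comp_1:
  assumes "x \<in> free_component m" "y \<in> free_component n"
  shows "free_tau (free_comp 1 x y) = - free_comp n (free_tau y) (free_tau x)"
  using assms(1)
proof (induction rule: free_component_induct)
  case (elem c t)
  from assms(2) show ?case
  proof (induction rule: free_component_induct)
    case (elem d s)
    then show ?case
      using tau_tree_graft_1[of t s]
      by (simp add: free_comp_linear free_comp_tree_elem free_tau_linear mult_ac)
  qed (simp_all add: free_tau_linear free_comp_linear rat_vec.scale_right_distrib
      del: rat_vec.scale_cancel_left)
qed (simp_all add: free_tau_linear free_comp_linear)

lemma free_tau_comp:
  assumes "x \<in> free_component m" "y \<in> free_component n" "2 \<le> i" "i \<le> m"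
  shows "free_tau (free_comp i x y) = free_comp (i - 1) (free_tau x) y"
  using assms(1)
proof (induction rule: free_component_induct)
  case (elem c t)
  from assms(2) show ?case
  proof (induction rule: free_component_induct)
    case (elem d s)
    then show ?case
      using tau_tree_graft[of i t s] assms \<open>leaves t = m\<close>
      by (auto simp add: free_comp_linear free_comp_tree_elem free_tau_linear mult_ac)
  qed (simp_all add: free_tau_linear free_comp_linear rat_vec.scale_right_distrib
      del: rat_vec.scale_cancel_left)
qed (simp_all add: free_tau_linear free_comp_linear)

lemma free_tau_pow_component: "x \<in> free_component n \<Longrightarrow> (free_tau ^^ k) x \<in> free_component n"
  by (induction k) (auto intro: free_tau_component)

lemma free_tau_pow_comp:
  assumes "x \<in> free_component m" "y \<in> free_component n" "k < i" "i \<le> m"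
  shows "(free_tau ^^ k) (free_comp i x y) = free_comp (i - k) ((free_tau ^^ k) x) y"
  using assms(3)
proof (induction k)
  case (Suc k)
  then have "(free_tau ^^ Suc k) (free_comp i x y)
      = free_tau (free_comp (i - k) ((free_tau ^^ k) x) y)" by simp
  also have "\<dots> = free_comp (i - k - 1) (free_tau ((free_tau ^^ k) x)) y"
    by (rule free_tau_comp[OF free_tau_pow_component[OF assms(1)] assms(2)])
      (use Suc.prems assms(4) in auto)
  finally show ?case by simp
qed simp

lemma free_tau_order_comp:
  assumes x: "x \<in> free_component m" "(free_tau ^^ (m + 1)) x = x"
    and y: "y \<in> free_component n" "(free_tau ^^ (n + 1)) y = y" and i: "1 \<le> i" "i \<le> m" "1 \<le> n"
  shows "(free_tau ^^ (m + n)) (free_comp i x y) = free_comp i x y"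
proof -
  let ?T = "\<lambda>k. free_tau ^^ k"
  have minus: "?T k (- z) = - ?T k z" for k z
    by (induction k) (simp_all add: free_tau_minus)
  have add: "?T k (?T l z) = ?T (k + l) z" for k l z by (simp add: funpow_add)
  have 1: "?T (i - 1) (free_comp i x y) = free_comp 1 (?T (i - 1) x) y"
    using free_tau_pow_comp[OF x(1) y(1), of "i - 1" i] i by simp
  have 2: "?T i (free_comp i x y) = - free_comp n (?T 1 y) (?T i x)"
  proof -
    have "?T i (free_comp i x y) = free_tau (?T (i - 1) (free_comp i x y))"
      using i by (cases i) simp_all
    also have "\<dots> = - free_comp n (free_tau y) (free_tau (?T (i - 1) x))"
      unfolding 1 by (rule free_tau_comp_1[OF free_tau_pow_component[OF x(1)] y(1)])
    finally show ?thesis using i by (cases i) simp_all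
  qed
  have 3: "?T (n - 1 + i) (free_comp i x y) = - free_comp 1 (?T n y) (?T i x)"
    using free_tau_pow_comp[OF free_tau_pow_component[OF y(1), of 1]
        free_tau_pow_component[OF x(1), of i], of "n - 1" n] i
    unfolding add[symmetric] 2 minus by (simp add: add del: funpow.simps)
  have 4: "?T (n + i) (free_comp i x y) = free_comp m (?T (i + 1) x) y"
  proof -
    have "?T (n + i) (free_comp i x y) = free_tau (?T (n - 1 + i) (free_comp i x y))"
      using i by (cases n) simp_all
    also have "\<dots> = free_comp m (free_tau (?T i x)) (free_tau (?T n y))"
      unfolding 3 free_tau_minus
      by (subst free_tau_comp_1[OF free_tau_pow_component[OF y(1)] free_tau_pow_component[OF x(1)]]) simp
    finally show ?thesis using y(2) by simp
  qed
  have "?T (m + n) (free_comp i x y) = ?T (m - i) (?T (n + i) (free_comp i x y))"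
    using i by (simp add: add)
  also have "\<dots> = free_comp (m - (m - i)) (?T (m - i) (?T (i + 1) x)) y"
    unfolding 4 by (rule free_tau_pow_comp[OF free_tau_pow_component[OF x(1)] y(1)]) (use i in auto)
  also have "\<dots> = free_comp i (?T (m + 1) x) y"
    unfolding add using i by simp
  finally show ?thesis using x(2) by simp
qed

lemma tau_tree_order: "(free_tau ^^ (leaves t + 1)) (tree_elem t) = tree_elem t"
proof (induction t)
  case Leaf
  then show ?case by (simp add: free_tau_linear free_tau_minus)
next
  case (Node g l r)
  let ?g = "tree_elem (Node g Leaf Leaf)"
  have "free_tau (free_tau (free_tau ?g)) = ?g"
    by (cases g) (simp_all add: free_tau_linear free_tau_minus free_comp_minus free_comp_diff_left
        free_comp_diff_right free_comp_tree_elem)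
  then have g: "(free_tau ^^ (2 + 1)) ?g = ?g" by (simp add: numeral_2_eq_2)
  have gr: "free_comp 2 ?g (tree_elem r) = tree_elem (Node g Leaf r)"
    and glr: "free_comp 1 (tree_elem (Node g Leaf r)) (tree_elem l) = tree_elem (Node g l r)"
    by (simp_all add: free_comp_tree_elem)
  have "(free_tau ^^ (2 + leaves r)) (tree_elem (Node g Leaf r)) = tree_elem (Node g Leaf r)"
    using free_tau_order_comp[of ?g 2 "tree_elem r" "leaves r" 2] g Node.IH(2)
    unfolding gr by (simp add: tree_elem_in_component del: funpow.simps)
  then show ?case
    using free_tau_order_comp[of "tree_elem (Node g Leaf r)" "1 + leaves r" "tree_elem l" "leaves l" 1]
      Node.IH(1) unfolding glr
    by (simp add: tree_elem_in_component ac_simps del: funpow.simps)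
qed

lemma free_tau_order:
  assumes "x \<in> free_component n"
  shows "(free_tau ^^ (n + 1)) x = x"
proof -
  have lin: "(free_tau ^^ k) (x + y) = (free_tau ^^ k) x + (free_tau ^^ k) y"
    "(free_tau ^^ k) (c *\<^sub>Q x) = c *\<^sub>Q (free_tau ^^ k) x" "(free_tau ^^ k) 0 = 0" for k c x y
    by (induction k) (simp_all add: free_tau_linear)
  from assms show ?thesis
    by (induction rule: free_component_induct)
      (use tau_tree_order in \<open>auto simp: lin simp del: funpow.simps\<close>)
qed

lemma free_tau_dend_rel: "x \<in> dend_rel \<Longrightarrow> free_tau x \<in> operad_ideal dend_rel"
proof -
  let ?I = "operad_ideal dend_rel"
  let ?n = "\<lambda>g l r. tree_elem (Node g l r)"
  let ?b = "\<lambda>g. Node g Leaf Leaf"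
  let ?r1 = "?n Prec (?b Prec) Leaf - (?n Prec Leaf (?b Prec) + ?n Prec Leaf (?b Succ))"
  let ?r2 = "?n Succ Leaf (?b Prec) - ?n Prec (?b Succ) Leaf"
  let ?r3 = "?n Succ Leaf (?b Succ) - (?n Succ (?b Succ) Leaf + ?n Succ (?b Prec) Leaf)"
  have r: "?r1 \<in> ?I" "?r2 \<in> ?I" "?r3 \<in> ?I"
    by (auto intro!: operad_ideal.gen simp: dend_rel_def)
  note simps = free_tau_linear free_tau_minus free_comp_minus free_comp_diff_left
    free_comp_diff_right free_comp_add_left free_comp_add_right free_comp_tree_elem
  have "free_tau ?r1 = ?r1 - ?r2 - ?r3" by (simp add: simps)
  then have 1: "free_tau ?r1 \<in> ?I" using r by (simp only: operad_ideal_diff)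
  have "free_tau ?r2 = ?r1" by (simp add: simps)
  then have 2: "free_tau ?r2 \<in> ?I" using r by (simp only:)
  have "free_tau ?r3 = - ?r2" by (simp add: simps)
  then have 3: "free_tau ?r3 \<in> ?I" using r by (simp only: operad_ideal_uminus)
  assume "x \<in> dend_rel"
  then have "x = ?r1 \<or> x = ?r2 \<or> x = ?r3" by (simp only: dend_rel_def insert_iff empty_iff simp_thms)
  then show ?thesis using 1 2 3 by (elim disjE) (simp_all only:)
qed

text \<open>The ideal is spanned by homogeneous elements whose image under \<open>free_tau\<close> is in the ideal.\<close>

lemma free_tau_ideal:
  assumes "x \<in> operad_ideal dend_rel"
  shows "free_tau x \<in> operad_ideal dend_rel"
proof -
  let ?I = "operad_ideal dend_rel"
  define K where "K = {h \<in> ?I. free_tau h \<in> ?I \<and> (\<exists>m. h \<in> free_component m)}"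
  note span = rat_vec.span_add rat_vec.span_scale rat_vec.span_zero
  have left: "free_comp i h (tree_elem s) \<in> K" if "h \<in> K" for i h s
  proof -
    obtain m where h: "h \<in> free_component m" "h \<in> ?I" "free_tau h \<in> ?I"
      using \<open>h \<in> K\<close> unfolding K_def by blast
    have s: "tree_elem s \<in> free_component (leaves s)" by (simp add: tree_elem_in_component)
    consider "i = 0 \<or> m < i" | "i = 1" "i \<le> m" | "2 \<le> i" "i \<le> m" by linarith
    then show ?thesis
    proof cases
      case 1
      have "free_comp i h (tree_elem s) = 0"
        using h(1) by (induction rule: free_component_induct)
          (use 1 in \<open>auto simp: free_comp_linear free_comp_tree_elem\<close>)
      then show ?thesis
        by (auto simp: K_def free_tau_linear operad_ideal.zero
            intro: rat_vec.subspace_0[OF free_component_subspace])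
    next
      case 2
      then show ?thesis
        using h s free.comp_closed[OF h(1) s] free_tau_comp_1[OF h(1) s]
        by (auto simp: K_def operad_ideal.comp_left operad_ideal.comp_right operad_ideal_uminus)
    next
      case 3
      then show ?thesis
        using h s free.comp_closed[OF h(1) s, of i] free_tau_comp[OF h(1) s, of i]
        by (auto simp: K_def operad_ideal.comp_left)
    qed
  qed
  have right: "free_comp i (tree_elem t) h \<in> K" if "h \<in> K" for i h t
  proof -
    obtain m where h: "h \<in> free_component m" "h \<in> ?I" "free_tau h \<in> ?I"
      using \<open>h \<in> K\<close> unfolding K_def by blast
    have t: "tree_elem t \<in> free_component (leaves t)" by (simp add: tree_elem_in_component)
    show ?thesis
    proof (cases "m = 0")
      case True
      have "h = 0" using h(1) by (induction rule: free_component_induct)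
          (use True in auto)
      then show ?thesis using \<open>h \<in> K\<close> by simp
    next
      case False
      consider "i = 0 \<or> leaves t < i" | "i = 1" "i \<le> leaves t" | "2 \<le> i" "i \<le> leaves t"
        by linarith
      then show ?thesis
      proof cases
        case 1
        have "free_comp i (tree_elem t) h = 0"
          using h(1) by (induction rule: free_component_induct)
            (use 1 in \<open>auto simp: free_comp_linear free_comp_tree_elem\<close>)
        then show ?thesis
          by (auto simp: K_def free_tau_linear operad_ideal.zero
              intro: rat_vec.subspace_0[OF free_component_subspace])
      next
        case 2
        then show ?thesis
          using False h t free.comp_closed[OF t h(1), of 1] free_tau_comp_1[OF t h(1)]
          by (auto simp: K_def operad_ideal.comp_left operad_ideal.comp_right operad_ideal_uminus)
      next
        case 3
        then show ?thesis
          using False h t free.comp_closed[OF t h(1), of i] free_tau_comp[OF t h(1), of i]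
          by (auto simp: K_def operad_ideal.comp_right)
      qed
    qed
  qed
  have dend_rel_component: "h \<in> free_component 3" if "h \<in> dend_rel" for h
    using that unfolding dend_rel_def
    by (auto simp: tree_elem_in_component
        intro!: rat_vec.subspace_diff[OF free_component_subspace]
          rat_vec.subspace_add[OF free_component_subspace])
  have "x \<in> rat_vec.span K"
    using assms
  proof (induction rule: operad_ideal.induct)
    case (gen x)
    then show ?case
      using free_tau_dend_rel dend_rel_component operad_ideal.gen
      by (intro rat_vec.span_base) (auto simp: K_def)
  next
    case (comp_left x i y)
    from comp_left.IH show ?case
    proof (induction rule: rat_vec.span_induct_alt)
      case (step c h x)
      have "free_comp i h y \<in> rat_vec.span K"
        using subset_UNIV[of "Poly_Mapping.keys y"]
        by (induction y rule: free_induct)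
          (use left[OF step(1)] in \<open>auto simp: free_comp_linear intro: span rat_vec.span_base\<close>)
      then show ?case using step(2) by (auto simp: free_comp_linear intro: span)
    qed (auto intro: span)
  next
    case (comp_right y i x)
    from comp_right.IH show ?case
    proof (induction rule: rat_vec.span_induct_alt)
      case (step c h y)
      have "free_comp i x h \<in> rat_vec.span K"
        using subset_UNIV[of "Poly_Mapping.keys x"]
        by (induction x rule: free_induct)
          (use right[OF step(1)] in \<open>auto simp: free_comp_linear intro: span rat_vec.span_base\<close>)
      then show ?case using step(2) by (auto simp: free_comp_linear intro: span)
    qed (auto intro: span)
  qed (auto intro: span)
  then show ?thesis
    by (induction rule: rat_vec.span_induct_alt)
      (auto simp: free_tau_linear K_def intro: operad_ideal.intros)
qed

lift_definition dend_tau :: "dend \<Rightarrow> dend" is free_tau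
  unfolding free_tau_minus(2)[symmetric] by (rule free_tau_ideal)

lemma ns_anticyclic_operad_Dend:
  "ns_anticyclic_operad Dend dend_unit dend_comp (\<lambda>_. dend_tau)"
  "\<forall>x\<in>Dend 1. dend_tau x = - x"
  "dend_tau dend_succ = dend_prec"
  "dend_tau dend_prec = - dend_prec - dend_succ"
proof -
  note abs = plus_dend.abs_eq scaleQ_dend.abs_eq dend_comp.abs_eq uminus_dend.abs_eq
    minus_dend.abs_eq dend_tau.abs_eq
  have pow: "(dend_tau ^^ k) (abs_dend x) = abs_dend ((free_tau ^^ k) x)" for k x
    by (induction k) (simp_all add: abs)
  interpret D: ns_operad Dend dend_unit dend_comp by (rule ns_operad_Dend)
  show "ns_anticyclic_operad Dend dend_unit dend_comp (\<lambda>_. dend_tau)"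
  proof
    fix f n assume "f \<in> Dend n"
    then show "(dend_tau ^^ (n + 1)) f = f"
      unfolding Dend_def using free_tau_order[of _ n] by (auto simp: pow simp del: funpow.simps)
  qed (auto simp: Dend_def dend_unit_def abs free_tau_component free_tau_linear free_tau_minus
      free_tau_comp_1[simplified] free_tau_comp[simplified])
  show "\<forall>x\<in>Dend 1. dend_tau x = - x"
  proof
    fix x assume "x \<in> Dend 1"
    then obtain y where y: "x = abs_dend y" "y \<in> free_component 1" by (auto simp: Dend_def)
    have Leaf: "t = Leaf" if "leaves t = Suc 0" for t :: "dend_gen btree"
      using that by (cases t) (auto simp: add_is_1)
    from y(2) have "free_tau y = - y"
      by (induction rule: free_component_induct) (auto simp: free_tau_linear dest!: Leaf)
    then show "dend_tau x = - x" by (simp add: y abs)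
  qed
  show "dend_tau dend_succ = dend_prec" "dend_tau dend_prec = - dend_prec - dend_succ"
    by (simp_all add: dend_succ_def dend_prec_def abs free_tau_linear free_comp_tree_elem
        free_comp_minus free_comp_diff_left free_comp_diff_right)
qed

end

theory Submission
  imports Defs
begin

text \<open>Put \<open>N = n + 1\<close>. The \<open>\<SS>\<^sub>N\<close>-module \<open>Dend n \<otimes> \<rat>\<SS>\<^sub>n\<close> is induced from the cyclic group generated by the
long cycle, so its Frobenius characteristic is
\<open>1/N \<Sum>k<N. tr (\<tau>\<^sup>k) p\<^bsub>N/g\<^esub>\<^sup>g\<close> with \<open>g = gcd k N\<close> (\<open>frobenius_char_sym_component\<close>). The theorem is
therefore the statement that \<open>tr (\<tau>\<^sup>0)\<close> is a Catalan number and that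
\<open>tr (\<tau>\<^sup>k) = - \<onehalf> (2g choose g)\<close> if \<open>N\<close> does not divide \<open>k\<close>.

The operad \<open>Dend\<close> is faithfully represented by rational functions of points \<open>v\<^sub>0, \<dots>, v\<^sub>n\<close>: the unit is
\<open>1 / (v\<^sub>1 - v\<^sub>0)\<close>, composition inserts one function into an interval of another, and \<open>\<tau>\<close> becomes the
cyclic rotation of the points (\<open>dend_mould_tau\<close>). A basis of \<open>Dend n\<close> is indexed by the
binary trees with leaves \<open>0, \<dots>, n\<close>; the tree \<open>t\<close> goes to the product \<open>frac t\<close> of the factors
\<open>1 / (v\<^sub>j - v\<^sub>i)\<close>, one for each inner node, where \<open>i\<close> and \<open>j\<close> are the first and the last leaf below it.

Sending a block of consecutive points to infinity is a residue. It maps \<open>frac t\<close> to \<open>0\<close> or to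
\<open>\<plusminus> frac b \<sqdot> frac s\<close>, where \<open>b\<close> is a subtree of \<open>t\<close> on the block and \<open>s\<close> is what remains
(\<open>frac_push_block_residue\<close>). Residues at an initial or a final block compute the coefficients of
a function in the basis, which also shows linear independence, and a residue commutes with a rotation
if the block is rotated too (\<open>residue_coeff_rotation\<close>).

Now let \<open>N = d m\<close> with \<open>d \<ge> 2\<close>. The trace of the rotation by \<open>m\<close> is a sum over the shape of the
tree at its root. The part where a fixed tree \<open>b\<close> with \<open>c < m\<close> leaves is the left (or the right)
subtree of the root is the trace of an operator \<open>residue \<circ> rotation \<circ> grafting\<close>. Moving the
residue to the right and using \<open>tr (A B) = tr (B A)\<close> removes one copy of \<open>b\<close> after another. When all \<open>d\<close>
copies are removed, one for each block in the orbit, the rotation by \<open>m - c\<close> of \<open>d (m - c)\<close> points is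
left. A right subtree with \<open>m\<close> leaves contributes \<open>- 1\<close>, and all other shapes contribute \<open>0\<close>. This
gives a recursion in \<open>m\<close> (\<open>rotation_trace_rec\<close>), and its solution is \<open>- \<onehalf> (2m choose m)\<close>.

For a rotation by an arbitrary \<open>k\<close> one uses that rotations have integer matrices. The congruence
\<open>tr (A\<^sup>p) \<equiv> tr A\<close> modulo primes \<open>p\<close> implies that the trace depends only on \<open>gcd k N\<close>
(\<open>rotation_trace_gcd\<close>). Finally, grouping the \<open>k\<close> by their greatest common divisor with \<open>N\<close> yields
Euler's function, and the Catalan numbers have the generating function \<open>(1 - sqrt (1 - 4x)) / 2\<close>.\<close>

section \<open>Binary trees and central binomial coefficients\<close>

text \<open>The labels of the nodes carry no information, so unlabelled trees are trees over the unit type.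
There are Catalan many trees with \<open>N\<close> leaves, as they have \<open>N - 1\<close> inner nodes.\<close>

definition trees :: "nat \<Rightarrow> unit btree set" where
  "trees N = {t. leaves t = N}"

lemma trees_0: "trees 0 = {}"
  by (auto simp: trees_def)

lemma trees_1: "trees (Suc 0) = {Leaf}"
proof -
  have "t = Leaf" if "leaves t = Suc 0" for t :: "unit btree"
    using that by (cases t) (auto simp: add_is_1)
  then show ?thesis by (auto simp: trees_def)
qed

lemma trees_Node:
  assumes "2 \<le> N"
  shows "trees N = (\<lambda>(c, L, R). Node () L R) ` (SIGMA c:{1..<N}. trees c \<times> trees (N - c))"
    (is "_ = ?f ` ?S")
proof (intro equalityI subsetI)
  fix t assume t: "t \<in> trees N"
  then obtain L R where t': "t = Node () L R"
    using assms by (cases t) (auto simp: trees_def)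
  have "1 \<le> leaves L" "1 \<le> leaves R" by simp_all
  with t t' have "(leaves L, L, R) \<in> ?S" by (auto simp: trees_def Suc_le_eq)
  then show "t \<in> ?f ` ?S" by (rule rev_image_eqI) (simp add: t')
qed (auto simp: trees_def)

lemma finite_trees [simp]: "finite (trees N)"
proof (induction N rule: less_induct)
  case (less N)
  consider "N = 0" | "N = Suc 0" | "2 \<le> N" by linarith
  then show ?case
  proof cases
    case 3
    show ?thesis unfolding trees_Node[OF 3]
      using less 3 by (intro finite_imageI finite_SigmaI finite_cartesian_product) auto
  qed (simp_all add: trees_0 trees_1)
qed

lemma sum_trees_Node:
  assumes "2 \<le> N"
  shows "(\<Sum>t\<in>trees N. f t)
    = (\<Sum>c\<in>{1..<N}. \<Sum>L\<in>trees c. \<Sum>R\<in>trees (N - c). f (Node () L R))"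
proof -
  have inj: "inj_on (\<lambda>(c, L, R). Node () L R) (SIGMA c:{1..<N}. trees c \<times> trees (N - c))"
    by (auto simp: inj_on_def trees_def)
  have "(\<Sum>t\<in>trees N. f t)
      = (\<Sum>(c, L, R)\<in>(SIGMA c:{1..<N}. trees c \<times> trees (N - c)). f (Node () L R))"
    unfolding trees_Node[OF assms] by (subst sum.reindex[OF inj]) (simp add: case_prod_beta)
  also have "\<dots> = (\<Sum>c\<in>{1..<N}. \<Sum>(L, R)\<in>trees c \<times> trees (N - c). f (Node () L R))"
    by (subst sum.Sigma) (auto simp: case_prod_beta)
  finally show ?thesis by (simp add: sum.cartesian_product)
qed

definition tree_series :: "rat fps" where
  "tree_series = Abs_fps (\<lambda>N. of_nat (card (trees N)))"

definition central_binomial_series :: "rat fps" where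
  "central_binomial_series = Abs_fps (\<lambda>k. of_nat ((2 * k) choose k))"

lemma fps_mult_nth_interior:
  fixes f g :: "'a::comm_ring_1 fps"
  assumes "fps_nth f 0 = 0" "fps_nth g 0 = 0"
  shows "fps_nth (f * g) N = (\<Sum>c\<in>{1..<N}. fps_nth f c * fps_nth g (N - c))"
  unfolding fps_mult_nth
  by (rule sum.mono_neutral_right) (use assms in \<open>auto simp: Suc_le_eq\<close>)

text \<open>A tree is a leaf or a pair of trees.\<close>

lemma tree_series_quadratic: "tree_series = fps_X + tree_series ^ 2"
proof (rule fps_ext)
  fix N
  consider "N = 0" | "N = Suc 0" | "2 \<le> N" by linarith
  then show "fps_nth tree_series N = fps_nth (fps_X + tree_series ^ 2) N"
  proof cases
    case 3
    have "card (trees N) = (\<Sum>c\<in>{1..<N}. card (trees c) * card (trees (N - c)))"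
      using sum_trees_Node[OF 3, of "\<lambda>_. 1::nat"] by simp
    with 3 show ?thesis
      by (simp add: power2_eq_square fps_mult_nth_interior tree_series_def trees_0)
  qed (simp_all add: power2_eq_square fps_mult_nth_interior tree_series_def trees_0 trees_1)
qed

lemma one_minus_2_tree_series_square: "(1 - 2 * tree_series) ^ 2 = 1 - 4 * fps_X"
proof -
  have "(1 - 2 * tree_series) ^ 2 = 1 - 4 * (tree_series - tree_series ^ 2)"
    by (simp add: power2_eq_square algebra_simps)
  also have "tree_series - tree_series ^ 2 = fps_X"
    using tree_series_quadratic by (simp add: algebra_simps)
  finally show ?thesis .
qed

lemma Suc_times_central_binomial:
  "Suc k * ((2 * Suc k) choose Suc k) = 2 * (2 * k + 1) * ((2 * k) choose k)"
proof -
  have 1: "Suc k * (Suc (Suc (2 * k)) choose Suc k) = Suc (Suc (2 * k)) * (Suc (2 * k) choose k)"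
    by (metis Suc_times_binomial_eq mult.commute)
  have 2: "(Suc (2 * k) choose k) = (Suc (2 * k) choose Suc k)"
    using binomial_symmetric[of k "Suc (2 * k)"] by simp
  have 3: "Suc k * (Suc (2 * k) choose Suc k) = Suc (2 * k) * (2 * k choose k)"
    by (metis Suc_times_binomial_eq mult.commute)
  have "Suc k * (Suc (Suc (2 * k)) choose Suc k) = 2 * (Suc k * (Suc (2 * k) choose Suc k))"
    unfolding 1 2 by simp
  then show ?thesis unfolding 3 by simp
qed

text \<open>Both factors square to known series: the first to \<open>1 - 4x\<close>, and the second to its inverse,
by the differential equation of \<open>(1 - 4x)\<close> to the power \<open>- \<onehalf>\<close>.\<close>

lemma central_binomial_series_inverse: "(1 - 2 * tree_series) * central_binomial_series = 1"
proof -
  let ?G = central_binomial_series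
  define b where "b k = (of_nat ((2 * k) choose k) :: rat)" for k
  have G: "fps_nth ?G k = b k" for k by (simp add: central_binomial_series_def b_def)
  have b: "of_nat (Suc k) * b (Suc k) = 2 * (2 * of_nat k + 1) * b k" for k
    using arg_cong[OF Suc_times_central_binomial[of k], of "of_nat :: nat \<Rightarrow> rat"]
    unfolding b_def by (simp only: of_nat_mult of_nat_add of_nat_1 of_nat_numeral)
  \<comment> \<open>\<open>(1 - 4x) G' = 2 G\<close> makes the derivative of \<open>(1 - 4x) G\<^sup>2\<close> vanish.\<close>
  have ode: "fps_deriv ?G * (1 - 4 * fps_X) = 2 * ?G"
  proof (rule fps_ext)
    fix k
    have "fps_nth (fps_deriv ?G * (1 - 4 * fps_X)) k
        = fps_nth (fps_deriv ?G) k - 4 * fps_nth (fps_deriv ?G * fps_X) k"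
      by (simp add: right_diff_distrib numeral_fps_const mult.left_commute[of _ "fps_const 4"])
    also have "\<dots> = of_nat (Suc k) * b (Suc k) - 4 * of_nat k * b k"
      by (cases k) (simp_all add: G)
    also have "\<dots> = 2 * b k" unfolding b by (simp add: algebra_simps)
    finally show "fps_nth (fps_deriv ?G * (1 - 4 * fps_X)) k = fps_nth (2 * ?G) k"
      by (simp add: numeral_fps_const G)
  qed
  have "fps_deriv (?G ^ 2 * (1 - 4 * fps_X))
      = 2 * ?G * (fps_deriv ?G * (1 - 4 * fps_X)) - 4 * ?G ^ 2"
    by (simp add: power2_eq_square algebra_simps numeral_fps_const)
  also have "\<dots> = 0" unfolding ode by (simp add: power2_eq_square algebra_simps)
  finally have "?G ^ 2 * (1 - 4 * fps_X) = fps_const (fps_nth (?G ^ 2 * (1 - 4 * fps_X)) 0)"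
    by (simp only: fps_deriv_eq_0_iff)
  also have "fps_nth (?G ^ 2 * (1 - 4 * fps_X)) 0 = 1"
    by (simp add: power2_eq_square G b_def numeral_fps_const)
  finally have const: "?G ^ 2 * (1 - 4 * fps_X) = 1" by simp
  define H where "H = (1 - 2 * tree_series) * ?G"
  have "(H - 1) * (H + 1) = H ^ 2 - 1" by (simp add: power2_eq_square algebra_simps)
  also have "H ^ 2 = 1"
    using const unfolding H_def power_mult_distrib one_minus_2_tree_series_square
    by (simp add: mult.commute)
  finally have "(H - 1) * (H + 1) = 0" by simp
  moreover have "fps_nth (H + 1) 0 \<noteq> 0"
    by (simp add: H_def tree_series_def central_binomial_series_def trees_0 numeral_fps_const)
  then have "H + 1 \<noteq> 0" by (metis fps_zero_nth)
  ultimately show ?thesis unfolding H_def by simp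
qed

text \<open>Differentiating \<open>(1 - 2y)\<^sup>2 = 1 - 4x\<close> gives \<open>(1 - 2y) y' = 1\<close>, so \<open>y'\<close> is the central binomial
series.\<close>

lemma card_trees: "Suc k * card (trees (Suc k)) = (2 * k) choose k"
proof -
  let ?A = "1 - 2 * tree_series" and ?G = central_binomial_series
  have "fps_deriv (?A ^ 2) = fps_deriv (1 - 4 * fps_X)"
    unfolding one_minus_2_tree_series_square ..
  then have "2 * (?A * fps_deriv ?A) + 4 = 0"
    by (simp add: power2_eq_square algebra_simps numeral_fps_const)
  then have "2 * (?A * fps_deriv ?A) + 4 * (?A * ?G) = 0"
    unfolding central_binomial_series_inverse by simp
  then have "?A * (2 * fps_deriv ?A + 4 * ?G) = 0"
    by (simp add: distrib_left mult.left_commute)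
  moreover have "?A \<noteq> 0" using central_binomial_series_inverse by auto
  ultimately have "fps_nth (2 * fps_deriv ?A + 4 * ?G) k = fps_nth 0 k" by simp
  then have "of_nat (Suc k * card (trees (Suc k))) = (of_nat ((2 * k) choose k) :: rat)"
    by (simp add: numeral_fps_const tree_series_def central_binomial_series_def algebra_simps)
  then show ?thesis by (simp only: of_nat_eq_iff)
qed

text \<open>This recursion is the one satisfied by the negated traces of rotations. For the series \<open>B\<close> of \<open>b\<close>
it reads \<open>B = y + 2 y B\<close>, that is, \<open>(1 - 2y) (1 + 2B) = 1\<close>.\<close>

lemma half_central_binomial_unique:
  fixes b :: "nat \<Rightarrow> rat"
  assumes rec: "\<And>m. 1 \<le> m \<Longrightarrow> b m = of_nat (card (trees m))
      + 2 * (\<Sum>c\<in>{1..<m}. of_nat (card (trees c)) * b (m - c))"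
    and "1 \<le> m"
  shows "b m = of_nat ((2 * m) choose m) / 2"
proof -
  define B where "B = Abs_fps (\<lambda>m. if m = 0 then 0 else b m)"
  let ?A = "1 - 2 * tree_series"
  have "B = tree_series + 2 * (tree_series * B)"
  proof (rule fps_ext)
    fix m
    show "fps_nth B m = fps_nth (tree_series + 2 * (tree_series * B)) m"
    proof (cases "m = 0")
      case False
      then show ?thesis using rec[of m]
        by (simp add: B_def fps_mult_nth_interior tree_series_def trees_0 numeral_fps_const)
    qed (simp add: B_def fps_mult_nth_interior tree_series_def trees_0 numeral_fps_const)
  qed
  then have "B - 2 * (tree_series * B) = tree_series" by (simp add: algebra_simps)
  moreover have "?A * (1 + 2 * B) = 1 - 2 * tree_series + 2 * (B - 2 * (tree_series * B))"
    by (simp add: algebra_simps)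
  ultimately have "?A * (1 + 2 * B) = 1" by simp
  then have "?A * (1 + 2 * B - central_binomial_series) = 0"
    using central_binomial_series_inverse by (simp only: right_diff_distrib diff_self)
  moreover have "?A \<noteq> 0" using central_binomial_series_inverse by auto
  ultimately have "1 + 2 * B = central_binomial_series" by simp
  then have "fps_nth (1 + 2 * B) m = fps_nth central_binomial_series m" by simp
  then show ?thesis using \<open>1 \<le> m\<close>
    by (simp add: B_def central_binomial_series_def numeral_fps_const)
qed

section \<open>Traces of powers of integer matrices\<close>

text \<open>All orbits have \<open>p\<close> elements, and \<open>w\<close> is constant on each of them.\<close>

lemma prime_order_free_sum_dvd:
  fixes w :: "'a \<Rightarrow> int"
  assumes "prime p" "finite Z"
    and "\<And>z. z \<in> Z \<Longrightarrow> s z \<in> Z" "\<And>z. z \<in> Z \<Longrightarrow> (s ^^ p) z = z"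
    and "\<And>z. z \<in> Z \<Longrightarrow> s z \<noteq> z" "\<And>z. z \<in> Z \<Longrightarrow> w (s z) = w z"
  shows "int p dvd (\<Sum>z\<in>Z. w z)"
  using assms(2-)
proof (induction "card Z" arbitrary: Z rule: less_induct)
  case less
  show ?case
  proof (cases "Z = {}")
    case False
    then obtain x where x: "x \<in> Z" by blast
    have pow: "(s ^^ i) z \<in> Z" "w ((s ^^ i) z) = w z" if "z \<in> Z" for i z
      using that by (induction i) (use less.prems in auto)
    have "p > 0" using \<open>prime p\<close> by (rule prime_gt_0_nat)
    have inj: "inj_on (\<lambda>i. (s ^^ i) x) {..<p}"
    proof -
      have neq: "(s ^^ i) x \<noteq> (s ^^ j) x" if "i < j" "j < p" for i j
      proof
        let ?y = "(s ^^ i) x"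
        define k where "k = j - i"
        assume "?y = (s ^^ j) x"
        moreover have "(s ^^ j) x = (s ^^ k) ?y"
          using that by (simp add: k_def funpow_add[symmetric, THEN fun_cong, simplified])
        ultimately have k: "(s ^^ k) ?y = ?y" by simp
        have "0 < k" "k < p" using that by (auto simp: k_def)
        then have "coprime k p"
          using \<open>prime p\<close> by (metis coprime_commute nat_dvd_not_less prime_imp_coprime)
        \<comment> \<open>A power of \<open>s\<close> that fixes a point and is prime to \<open>p\<close> makes \<open>s\<close> itself fix the point.\<close>
        then obtain a b where ab: "k * a = p * b + 1"
          using bezout_nat[of k p] \<open>0 < k\<close> by (auto simp: coprime_iff_gcd_eq_1)
        have fixed: "(s ^^ (q * c)) ?y = ?y" if "(s ^^ q) ?y = ?y" for q c
          using that by (induction c) (simp_all add: funpow_add)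
        have "s ?y = s ((s ^^ (p * b)) ?y)" using fixed[of p b] less.prems(3) pow(1)[OF x] by simp
        also have "\<dots> = (s ^^ (k * a)) ?y" unfolding ab by simp
        also have "\<dots> = ?y" using fixed[OF k] .
        finally show False using less.prems(4) pow(1)[OF x] by blast
      qed
      then show ?thesis by (metis (mono_tags, lifting) inj_onI lessThan_iff linorder_less_linear)
    qed
    define Orb where "Orb = (\<lambda>i. (s ^^ i) x) ` {..<p}"
    have Orb: "Orb \<subseteq> Z" "finite Orb" "Orb \<noteq> {}"
      using pow(1)[OF x] \<open>p > 0\<close> by (auto simp: Orb_def)
    have "(\<Sum>z\<in>Orb. w z) = int p * w x"
      unfolding Orb_def by (subst sum.reindex[OF inj]) (simp add: pow(2)[OF x])
    moreover have "int p dvd (\<Sum>z\<in>Z - Orb. w z)"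
    proof (rule less.hyps)
      show "card (Z - Orb) < card Z"
        using Orb less.prems(1) by (intro psubset_card_mono) auto
      fix z assume z: "z \<in> Z - Orb"
      have "s z \<notin> Orb"
      proof
        assume "s z \<in> Orb"
        then obtain i where "s z = (s ^^ i) x" by (auto simp: Orb_def)
        have "z = (s ^^ (p - 1)) (s z)"
          using less.prems(3)[of z] z \<open>p > 0\<close> by (metis DiffD1 Suc_diff_1 comp_apply funpow_Suc_right)
        also have "\<dots> = (s ^^ (p - 1 + i)) x" unfolding \<open>s z = _\<close> by (simp add: funpow_add)
        also have "\<dots> = (s ^^ ((p - 1 + i) mod p)) x"
          by (rule funpow_mod_eq[symmetric]) (rule less.prems(3)[OF x])
        finally have "z \<in> Orb"
          unfolding Orb_def by (rule image_eqI) (use \<open>p > 0\<close> in simp)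
        then show False using z by simp
      qed
      then show "s z \<in> Z - Orb" using z less.prems(2) by blast
    qed (use less.prems in auto)
    moreover have "(\<Sum>z\<in>Z. w z) = (\<Sum>z\<in>Z - Orb. w z) + (\<Sum>z\<in>Orb. w z)"
      by (rule sum.subset_diff[OF Orb(1) less.prems(1)])
    ultimately show ?thesis by simp
  qed simp
qed

fun mat_pow :: "'i set \<Rightarrow> ('i \<Rightarrow> 'i \<Rightarrow> int) \<Rightarrow> nat \<Rightarrow> 'i \<Rightarrow> 'i \<Rightarrow> int" where
  "mat_pow X A 0 i j = (if i = j then 1 else 0)"
| "mat_pow X A (Suc k) i j = (\<Sum>l\<in>X. A i l * mat_pow X A k l j)"

fun path_weight :: "('i \<Rightarrow> 'i \<Rightarrow> int) \<Rightarrow> 'i list \<Rightarrow> int" where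
  "path_weight A (x # y # r) = A x y * path_weight A (y # r)"
| "path_weight A _ = 1"

lemma path_weight_snoc: "path_weight A (xs @ [a, b]) = path_weight A (xs @ [a]) * A a b"
proof (induction xs)
  case (Cons x xs)
  then show ?case by (cases xs) (auto simp: mult_ac)
qed simp

lemma mat_pow_paths:
  assumes "finite X" "j \<in> X"
  shows "mat_pow X A (Suc k) i j
    = (\<Sum>ys | set ys \<subseteq> X \<and> length ys = k. path_weight A (i # ys @ [j]))"
proof (induction k arbitrary: i)
  case 0
  have "{ys. set ys \<subseteq> X \<and> ys = []} = {[]}" by auto
  then show ?case using assms by (simp add: if_distrib cong: if_cong)
next
  case (Suc k)
  let ?S = "\<lambda>k. {ys. set ys \<subseteq> X \<and> length ys = k}"
  have S: "?S (Suc k) = (\<lambda>(l, ys). l # ys) ` (X \<times> ?S k)"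
    by (auto simp: length_Suc_conv image_iff)
  have inj: "inj_on (\<lambda>(l, ys). l # ys) (X \<times> ?S k)" by (auto simp: inj_on_def)
  have "mat_pow X A (Suc (Suc k)) i j = (\<Sum>l\<in>X. A i l * mat_pow X A (Suc k) l j)" by simp
  also have "\<dots> = (\<Sum>(l, ys)\<in>X \<times> ?S k. path_weight A (i # (l # ys) @ [j]))"
    unfolding Suc by (simp add: sum_distrib_left sum.cartesian_product)
  also have "\<dots> = (\<Sum>ys\<in>?S (Suc k). path_weight A (i # ys @ [j]))"
    unfolding S by (subst sum.reindex[OF inj]) (simp add: case_prod_beta)
  finally show ?case .
qed

lemma trace_mat_pow_closed_paths:
  assumes "finite X"
  shows "(\<Sum>i\<in>X. mat_pow X A (Suc k) i i)
    = (\<Sum>xs | set xs \<subseteq> X \<and> length xs = Suc k. path_weight A (xs @ [hd xs]))"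
proof -
  let ?S = "\<lambda>k. {ys. set ys \<subseteq> X \<and> length ys = k}"
  have S: "?S (Suc k) = (\<lambda>(l, ys). l # ys) ` (X \<times> ?S k)"
    by (auto simp: length_Suc_conv image_iff)
  have inj: "inj_on (\<lambda>(l, ys). l # ys) (X \<times> ?S k)" by (auto simp: inj_on_def)
  have "(\<Sum>i\<in>X. mat_pow X A (Suc k) i i)
      = (\<Sum>(i, ys)\<in>X \<times> ?S k. path_weight A (i # ys @ [i]))"
    by (simp add: mat_pow_paths[OF assms] sum.cartesian_product del: mat_pow.simps)
  also have "\<dots> = (\<Sum>xs\<in>?S (Suc k). path_weight A (xs @ [hd xs]))"
    unfolding S by (subst sum.reindex[OF inj]) (simp add: case_prod_beta)
  finally show ?thesis .
qed

lemma fermat_cong: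
  assumes p: "prime p"
  shows "[(a::int) ^ p = a] (mod int p)"
proof -
  have p0: "p > 0" using p by (rule prime_gt_0_nat)
  have nat: "[int b ^ p = int b] (mod int p)" for b
  proof (induction b)
    case 0
    then show ?case using p0 by (simp add: zero_power)
  next
    case (Suc b)
    let ?f = "\<lambda>k. int (p choose k) * int b ^ k"
    have "int (Suc b) ^ p = (\<Sum>k\<le>p. ?f k)"
      using binomial_ring[of "int b" 1 p] by (simp add: add.commute)
    also have "\<dots> = ?f 0 + ?f p + (\<Sum>k\<in>{1..<p}. ?f k)"
    proof -
      have "{..p} = insert 0 (insert p {1..<p})" using p0 by auto
      then show ?thesis using p0 by simp
    qed
    finally have "int (Suc b) ^ p = 1 + int b ^ p + (\<Sum>k\<in>{1..<p}. ?f k)" by simp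
    moreover have "int p dvd (\<Sum>k\<in>{1..<p}. ?f k)"
      using p by (intro dvd_sum dvd_mult2) (auto intro!: dvd_choose_prime)
    then have "[1 + int b ^ p + (\<Sum>k\<in>{1..<p}. ?f k) = 1 + int b + 0] (mod int p)"
      by (intro cong_add Suc cong_refl) (simp add: cong_0_iff)
    ultimately show ?case by (simp add: add.commute)
  qed
  have "[a = int (nat (a mod int p))] (mod int p)" using p0 by (simp add: cong_def)
  then show ?thesis using nat by (meson cong_pow cong_sym cong_trans)
qed

lemma rotate1_fixed_imp_replicate: "r @ [x] = x # r \<Longrightarrow> replicate (length r) x = r"
proof (induction r)
  case (Cons y r)
  then have "y = x" "r @ [x] = x # r" by simp_all
  then show ?case using Cons.IH by simp
qed simp

text \<open>The trace of \<open>A\<^sup>p\<close> counts closed paths of length \<open>p\<close> with their weights. Rotation of a path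
preserves its weight, and only the constant paths are fixed; they contribute \<open>\<Sum>x. (A x x)\<^sup>p\<close>.\<close>

lemma trace_prime_power_cong:
  assumes "finite X" "prime p"
  shows "[(\<Sum>i\<in>X. mat_pow X A p i i) = (\<Sum>i\<in>X. A i i)] (mod int p)"
proof -
  let ?S = "{xs. set xs \<subseteq> X \<and> length xs = p}"
  let ?w = "\<lambda>xs. path_weight A (xs @ [hd xs])"
  let ?C = "(\<lambda>x. replicate p x) ` X"
  have p: "p > 0" using assms(2) by (rule prime_gt_0_nat)
  have fin: "finite ?S" using assms(1) by (rule finite_lists_length_eq)
  have sub: "?C \<subseteq> ?S" using p by auto
  have inj: "inj_on (\<lambda>x. replicate p x) X" using p by (auto simp: inj_on_def)
  have const: "?w (replicate p x) = A x x ^ p" for x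
  proof -
    have "path_weight A (replicate q x @ [x]) = A x x ^ q" for q
    proof (induction q)
      case (Suc q)
      then show ?case by (cases q) auto
    qed simp
    moreover have "hd (replicate p x) = x" using p by (cases p) auto
    ultimately show ?thesis by simp
  qed
  have "int p dvd (\<Sum>xs\<in>?S - ?C. ?w xs)"
  proof (rule prime_order_free_sum_dvd[of p _ rotate1])
    fix xs assume xs: "xs \<in> ?S - ?C"
    then obtain x r where xr: "xs = x # r" using p by (cases xs) auto
    show neq: "rotate1 xs \<noteq> xs"
    proof
      assume "rotate1 xs = xs"
      then have r: "replicate (length r) x = r"
        unfolding xr by (intro rotate1_fixed_imp_replicate) simp
      have "length xs = p" "x \<in> X" "xs \<notin> ?C" using xs xr by auto
      moreover from this(1) r have "xs = replicate p x"
        unfolding xr by (cases p) auto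
      ultimately show False by blast
    qed
    show "(rotate1 ^^ p) xs = xs" using xs by (auto simp: rotate_def[symmetric])
    show "rotate1 xs \<in> ?S - ?C"
    proof -
      have "rotate1 xs \<noteq> replicate p y" for y
      proof
        assume eq: "rotate1 xs = replicate p y"
        then have "set xs = {y}" using p by (metis set_replicate set_rotate1 less_irrefl)
        then have "xs = replicate (length xs) y" by (metis replicate_length_same singletonD)
        then show False using neq eq xs by simp
      qed
      then show ?thesis using xs by auto
    qed
    show "?w (rotate1 xs) = ?w xs"
    proof (cases r)
      case (Cons y r')
      then show ?thesis using path_weight_snoc[of A "y # r'" x y] by (simp add: xr mult.commute)
    qed (simp add: xr)
  qed (use assms fin in auto)
  then have "[(\<Sum>xs\<in>?S - ?C. ?w xs) + (\<Sum>xs\<in>?C. ?w xs) = 0 + (\<Sum>xs\<in>?C. ?w xs)] (mod int p)"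
    by (intro cong_add) (auto simp: cong_0_iff)
  moreover have "(\<Sum>i\<in>X. mat_pow X A p i i) = (\<Sum>xs\<in>?S - ?C. ?w xs) + (\<Sum>xs\<in>?C. ?w xs)"
    using trace_mat_pow_closed_paths[OF assms(1), of A "p - 1"] p sum.subset_diff[OF sub fin, of ?w]
    by simp
  moreover have "(\<Sum>xs\<in>?C. ?w xs) = (\<Sum>x\<in>X. A x x ^ p)"
    by (subst sum.reindex[OF inj]) (simp add: const)
  moreover have "[(\<Sum>x\<in>X. A x x ^ p) = (\<Sum>x\<in>X. A x x)] (mod int p)"
    by (intro cong_sum fermat_cong assms)
  ultimately show ?thesis by (simp, blast intro: cong_trans)
qed

text \<open>For large primes \<open>p\<close> the congruence is an equality because \<open>\<theta>\<close> is bounded. Hence \<open>\<theta> q = \<theta> 1\<close> for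
all \<open>q\<close> with only large prime factors, and the class of \<open>j\<close> modulo \<open>d\<close> contains such a \<open>q\<close>.\<close>

lemma frobenius_periodic_coprime:
  fixes \<theta> :: "nat \<Rightarrow> int"
  assumes "d > 0" and periodic: "\<And>k. \<theta> (k + d) = \<theta> k"
    and frob: "\<And>p k. prime p \<Longrightarrow> [\<theta> (p * k) = \<theta> k] (mod int p)"
    and "coprime j d"
  shows "\<theta> j = \<theta> 1"
proof -
  have per: "\<theta> (k + d * t) = \<theta> k" for k t
    by (induction t) (simp_all add: periodic add.assoc[symmetric] add.commute[of d])
  define B where "B = (\<Sum>k<d. \<bar>\<theta> k\<bar>)"
  have bound: "\<bar>\<theta> k\<bar> \<le> B" for k
  proof -
    have "\<theta> k = \<theta> (k mod d)" using per[of "k mod d" "k div d"] by simp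
    then show ?thesis unfolding B_def
      using member_le_sum[of "k mod d" "{..<d}" "\<lambda>k. \<bar>\<theta> k\<bar>"] \<open>d > 0\<close> by simp
  qed
  have large_prime: "\<theta> (p * k) = \<theta> k" if "prime p" "int p > 2 * B" for p k
  proof (rule ccontr)
    assume "\<theta> (p * k) \<noteq> \<theta> k"
    moreover have "int p dvd \<theta> (p * k) - \<theta> k" using frob[OF that(1)] by (simp add: cong_iff_dvd_diff)
    ultimately have "int p \<le> \<bar>\<theta> (p * k) - \<theta> k\<bar>" by (intro zdvd_imp_le) (auto simp: dvd_abs_iff)
    then show False using bound[of "p * k"] bound[of k] that(2) by linarith
  qed
  have large: "\<theta> (q * k) = \<theta> k" if "q > 0" "\<And>p. prime p \<Longrightarrow> p dvd q \<Longrightarrow> int p > 2 * B" for q k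
    using that
  proof (induction q arbitrary: k rule: less_induct)
    case (less q)
    show ?case
    proof (cases "q = 1")
      case False
      then obtain p where p: "prime p" "p dvd q" by (metis prime_factor_nat)
      then obtain r where r: "q = p * r" by blast
      have "r > 0" "r < q" using r less.prems(1) prime_gt_1_nat[OF p(1)] by auto
      have "\<theta> (q * k) = \<theta> (p * (r * k))" by (simp add: r mult.assoc)
      also have "\<dots> = \<theta> (r * k)" by (rule large_prime) (use p less.prems in auto)
      also have "\<dots> = \<theta> k"
        by (rule less.IH) (use \<open>r > 0\<close> \<open>r < q\<close> r less.prems in auto)
      finally show ?thesis .
    qed simp
  qed
  \<comment> \<open>Every prime \<open>p \<le> 2 B\<close> divides exactly one of \<open>j\<close> and \<open>d \<Prod>P\<close>, hence not their sum.\<close>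
  define P where "P = {p. prime p \<and> int p \<le> 2 * B \<and> \<not> p dvd j}"
  have "finite P" by (rule finite_subset[of _ "{..nat (2 * B)}"]) (auto simp: P_def)
  have Ppos: "prod id P > 0" by (intro prod_pos) (auto simp: P_def prime_gt_0_nat)
  let ?q = "j + d * prod id P"
  have "int p > 2 * B" if p: "prime p" "p dvd ?q" for p
  proof (rule ccontr)
    assume "\<not> int p > 2 * B"
    then have small: "int p \<le> 2 * B" by simp
    have div: "p dvd d * prod id P" if "p dvd j"
      using p(2) that by (metis dvd_add_right_iff)
    show False
    proof (cases "p dvd j")
      case True
      have "\<not> p dvd d" using True \<open>coprime j d\<close> p(1) by (meson coprime_common_divisor not_prime_unit)
      then have "p dvd prod id P" using div[OF True] p(1) by (simp add: prime_dvd_mult_iff)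
      then obtain p' where "p' \<in> P" "p dvd p'"
        using p(1) \<open>finite P\<close> by (auto simp: prime_dvd_prod_iff)
      then have "p = p'" using p(1) by (auto simp: P_def primes_dvd_imp_eq)
      then show False using \<open>p' \<in> P\<close> True by (simp add: P_def)
    next
      case False
      then have "p \<in> P" using p small by (simp add: P_def)
      then have "p dvd prod id P" using \<open>finite P\<close> by (metis dvd_prodI id_apply)
      then have "p dvd j" using p(2) by (metis dvd_add_left_iff dvd_mult)
      then show False using False by simp
    qed
  qed
  then have "\<theta> (?q * 1) = \<theta> 1" using Ppos \<open>d > 0\<close> by (intro large) auto
  then show ?thesis by (simp add: per)
qed

lemma frobenius_periodic_gcd:
  fixes \<theta> :: "nat \<Rightarrow> int"
  assumes "N > 0" and periodic: "\<And>k. \<theta> (k + N) = \<theta> k"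
    and frob: "\<And>p k. prime p \<Longrightarrow> [\<theta> (p * k) = \<theta> k] (mod int p)"
  shows "\<theta> k = \<theta> (gcd k N)"
proof -
  let ?m = "gcd k N"
  have m: "?m > 0" using \<open>N > 0\<close> by simp
  have d: "N = ?m * (N div ?m)" and j: "k = ?m * (k div ?m)" by simp_all
  have "\<theta> (?m * (k div ?m)) = \<theta> (?m * 1)"
  proof (rule frobenius_periodic_coprime[of "N div ?m" "\<lambda>i. \<theta> (?m * i)"])
    show "N div ?m > 0" using \<open>N > 0\<close> d by (metis gr0I mult_0_right)
    show "coprime (k div ?m) (N div ?m)" using \<open>N > 0\<close> by (intro div_gcd_coprime) auto
    show "\<theta> (?m * (i + N div ?m)) = \<theta> (?m * i)" for i
      using periodic[of "?m * i"] d by (metis distrib_left)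
    show "[\<theta> (?m * (p * i)) = \<theta> (?m * i)] (mod int p)" if "prime p" for p i
      using frob[OF that, of "?m * i"] by (simp add: mult.left_commute)
  qed
  then show ?thesis using j by simp
qed

section \<open>Traces in coordinates and induced representations\<close>

definition linear_on :: "'a::rat_vector set \<Rightarrow> ('a \<Rightarrow> 'b::rat_vector) \<Rightarrow> bool" where
  "linear_on V f \<longleftrightarrow> (\<forall>x\<in>V. \<forall>y\<in>V. f (x + y) = f x + f y) \<and> (\<forall>c. \<forall>x\<in>V. f (c *\<^sub>Q x) = c *\<^sub>Q f x)"

lemma linear_on_zero: "linear_on V f \<Longrightarrow> x \<in> V \<Longrightarrow> f 0 = 0"
  unfolding linear_on_def using rat_vec.scale_zero_left[of x] rat_vec.scale_zero_left[of "f x"] by metis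

lemma linear_on_sum:
  assumes "rat_vec.subspace V" "linear_on V f" "finite J" "\<And>j. j \<in> J \<Longrightarrow> x j \<in> V"
  shows "f (\<Sum>j\<in>J. c j *\<^sub>Q x j) = (\<Sum>j\<in>J. c j *\<^sub>Q f (x j))"
  using assms(3,4)
proof (induction J rule: finite_induct)
  case empty
  then show ?case using linear_on_zero[OF assms(2) rat_vec.subspace_0[OF assms(1)]] by simp
next
  case (insert j J)
  have "c j *\<^sub>Q x j \<in> V" "(\<Sum>j\<in>J. c j *\<^sub>Q x j) \<in> V"
    using insert.prems by (auto intro!: rat_vec.subspace_scale[OF assms(1)] rat_vec.subspace_sum[OF assms(1)])
  then show ?case using insert assms(2) by (simp add: linear_on_def)
qed

lemma linear_on_funpow:
  assumes "linear_on V f" "f ` V \<subseteq> V"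
  shows "linear_on V (f ^^ k)" "(f ^^ k) ` V \<subseteq> V"
proof -
  have "linear_on V (f ^^ k) \<and> (f ^^ k) ` V \<subseteq> V"
  proof (induction k)
    case (Suc k)
    then show ?case using assms by (auto simp: linear_on_def image_subset_iff)
  qed (auto simp: linear_on_def)
  then show "linear_on V (f ^^ k)" "(f ^^ k) ` V \<subseteq> V" by auto
qed

text \<open>The operators of interest are linear only on a component and arbitrary outside it; this is the
form in which a basis of a component is used to compute traces.\<close>

definition coordinates_on ::
    "'a::rat_vector set \<Rightarrow> 'i set \<Rightarrow> ('i \<Rightarrow> 'a) \<Rightarrow> ('i \<Rightarrow> 'a \<Rightarrow> rat) \<Rightarrow> bool" where
  "coordinates_on V I e \<kappa> \<longleftrightarrow> rat_vec.subspace V \<and> finite I \<and> e ` I \<subseteq> V \<and>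
     (\<forall>i\<in>I. linear_on V (\<kappa> i)) \<and> (\<forall>x\<in>V. x = (\<Sum>i\<in>I. \<kappa> i x *\<^sub>Q e i))"

text \<open>Expanding \<open>f b\<close> for the elements \<open>b\<close> of the chosen basis in terms of the \<open>f (e i)\<close>, and
contracting over \<open>b\<close> first, replaces the chosen basis by \<open>e\<close>.\<close>

lemma rat_trace_coordinates:
  assumes coord: "coordinates_on V I e \<kappa>" and f: "linear_on V f" "f ` V \<subseteq> V"
  shows "rat_trace V f = (\<Sum>i\<in>I. \<kappa> i (f (e i)))"
proof -
  have sub: "rat_vec.subspace V" and fin: "finite I" and e: "\<And>i. i \<in> I \<Longrightarrow> e i \<in> V"
    and lin: "\<And>i. i \<in> I \<Longrightarrow> linear_on V (\<kappa> i)"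
    and exp: "\<And>x. x \<in> V \<Longrightarrow> x = (\<Sum>i\<in>I. \<kappa> i x *\<^sub>Q e i)"
    using coord by (auto simp: coordinates_on_def)
  define B where "B = (SOME B. B \<subseteq> V \<and> rat_vec.independent B \<and> rat_vec.span B = V)"
  have "\<exists>B. B \<subseteq> V \<and> rat_vec.independent B \<and> rat_vec.span B = V"
    using rat_vec.basis_exists[of V] rat_vec.span_minimal[OF _ sub] by (metis subset_antisym)
  then have B: "B \<subseteq> V" "rat_vec.independent B" "rat_vec.span B = V"
    unfolding B_def by (metis (mono_tags, lifting) someI_ex)+
  have "V \<subseteq> rat_vec.span (e ` I)"
  proof
    fix x assume "x \<in> V"
    then have "x = (\<Sum>i\<in>I. \<kappa> i x *\<^sub>Q e i)" by (rule exp)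
    also have "\<dots> \<in> rat_vec.span (e ` I)"
      by (intro rat_vec.span_sum rat_vec.span_scale rat_vec.span_base) auto
    finally show "x \<in> rat_vec.span (e ` I)" .
  qed
  then have "finite B"
    using rat_vec.independent_span_bound[of "e ` I" B] fin B by auto
  let ?rep = "rat_vec.representation B"
  have rep: "x = (\<Sum>b\<in>B. ?rep x b *\<^sub>Q b)" if "x \<in> V" for x
    using rat_vec.sum_representation_eq[OF B(2) _ \<open>finite B\<close>] that B by auto
  have fV: "f x \<in> V" if "x \<in> V" for x using that f(2) by auto
  have rep_f: "?rep (f b) b = (\<Sum>i\<in>I. \<kappa> i b * ?rep (f (e i)) b)" if "b \<in> B" for b
  proof -
    have "b \<in> V" using that B by auto
    have "f b = f (\<Sum>i\<in>I. \<kappa> i b *\<^sub>Q e i)" using exp[OF \<open>b \<in> V\<close>] by simp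
    also have "\<dots> = (\<Sum>i\<in>I. \<kappa> i b *\<^sub>Q f (e i))" by (rule linear_on_sum[OF sub f(1) fin e])
    finally have "?rep (f b) b = ?rep (\<Sum>i\<in>I. \<kappa> i b *\<^sub>Q f (e i)) b" by simp
    also have "\<dots> = (\<Sum>i\<in>I. ?rep (\<kappa> i b *\<^sub>Q f (e i)) b)"
      by (subst rat_vec.representation_sum)
        (use B fV e rat_vec.subspace_scale[OF sub] in auto)
    also have "\<dots> = (\<Sum>i\<in>I. \<kappa> i b * ?rep (f (e i)) b)"
      by (intro sum.cong refl, subst rat_vec.representation_scale) (use B fV e in auto)
    finally show ?thesis .
  qed
  have "rat_trace V f = (\<Sum>b\<in>B. ?rep (f b) b)"
    unfolding rat_trace_def Let_def B_def ..
  also have "\<dots> = (\<Sum>b\<in>B. \<Sum>i\<in>I. \<kappa> i b * ?rep (f (e i)) b)"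
    by (intro sum.cong refl rep_f)
  also have "\<dots> = (\<Sum>i\<in>I. \<Sum>b\<in>B. ?rep (f (e i)) b *\<^sub>Q \<kappa> i b)"
    by (subst sum.swap) (simp add: mult.commute)
  also have "\<dots> = (\<Sum>i\<in>I. \<kappa> i (\<Sum>b\<in>B. ?rep (f (e i)) b *\<^sub>Q b))"
    by (intro sum.cong refl linear_on_sum[OF sub lin \<open>finite B\<close>, symmetric]) (use B in auto)
  also have "\<dots> = (\<Sum>i\<in>I. \<kappa> i (f (e i)))"
    by (intro sum.cong refl arg_cong[of _ _ "\<kappa> _"] rep[symmetric] fV e)
  finally show ?thesis .
qed

lemma permutes_long_cycle: "long_cycle n permutes {1..n + 1}"
  using bij_long_cycle[of n] unfolding permutes_def bij_iff by (simp add: long_cycle_def)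

lemma permutes_long_cycle_pow: "long_cycle n ^^ k permutes {1..n + 1}"
proof (induction k)
  case (Suc k)
  then show ?case using permutes_compose[OF _ permutes_long_cycle] by (simp only: funpow.simps)
qed (simp only: funpow.simps permutes_id)

text \<open>The long cycle decreases every point by one modulo \<open>n + 1\<close>.\<close>

lemma long_cycle_pow_cong:
  assumes "i \<in> {1..n + 1}"
  shows "[int ((long_cycle n ^^ k) i) = int i - int k] (mod int (n + 1))"
proof (induction k)
  case (Suc k)
  have mem: "(long_cycle n ^^ k) i \<in> {1..n + 1}"
    using assms permutes_in_image[OF permutes_long_cycle_pow] by blast
  have step: "[int (long_cycle n j) = int j - 1] (mod int (n + 1))" if "j \<in> {1..n + 1}" for j
    using that by (auto simp: long_cycle_def cong_iff_dvd_diff of_nat_diff)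
  show ?case using cong_trans[OF step[OF mem] cong_diff[OF Suc cong_refl[of 1]]]
    by (simp add: algebra_simps)
qed simp

lemma orbit_conj:
  assumes "bij s"
  shows "orbit (s \<circ> h \<circ> inv s) (s x) = s ` orbit h x"
proof (intro equalityI subsetI)
  have inv: "inv s (s y) = y" for y using assms by (simp add: bij_is_inj)
  fix y assume "y \<in> orbit (s \<circ> h \<circ> inv s) (s x)"
  then show "y \<in> s ` orbit h x"
    by induction (auto simp: inv intro: orbit.intros)
next
  have inv: "(s \<circ> h \<circ> inv s) (s y) = s (h y)" for y using assms by (simp add: bij_is_inj)
  fix y assume "y \<in> s ` orbit h x"
  then obtain z where y: "y = s z" and "z \<in> orbit h x" by blast
  from this(2) have "s z \<in> orbit (s \<circ> h \<circ> inv s) (s x)"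
  proof induction
    case base
    show ?case using orbit.base[of "s \<circ> h \<circ> inv s" "s x"] by (simp only: inv)
  next
    case (step z)
    show ?case using orbit.step[OF step.IH] by (simp only: inv)
  qed
  then show "y \<in> orbit (s \<circ> h \<circ> inv s) (s x)" by (simp add: y)
qed

lemma cycle_psum_conj:
  assumes "s permutes {1..N}"
  shows "cycle_psum N (s \<circ> h \<circ> inv s) = cycle_psum N h"
proof -
  have bij: "bij s" using assms by (rule permutes_bij)
  have "orbit (s \<circ> h \<circ> inv s) ` {1..N} = orbit (s \<circ> h \<circ> inv s) ` (s ` {1..N})"
    by (simp only: permutes_image[OF assms])
  also have "\<dots> = image s ` (orbit h ` {1..N})"
    by (simp add: image_image orbit_conj[OF bij])
  finally have orbits: "orbit (s \<circ> h \<circ> inv s) ` {1..N} = image s ` (orbit h ` {1..N})" .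
  have inj: "inj_on (image s) A" for A
    using bij by (meson bij_is_inj inj_image_eq_iff inj_onI)
  have card: "card (s ` C) = card C" for C
    using bij by (auto intro!: card_image inj_on_subset[OF bij_is_inj])
  show ?thesis unfolding cycle_psum_def orbits
    by (subst prod.reindex[OF inj]) (simp add: card)
qed

text \<open>The orbits of a translation by \<open>k\<close> modulo \<open>N\<close> are the classes modulo \<open>gcd k N\<close>, here enumerated
as subsets of \<open>{1..N}\<close>.\<close>

lemma orbit_long_cycle_pow:
  fixes n k defines "N \<equiv> n + 1" defines "g \<equiv> gcd k N"
  assumes x: "x \<in> {1..N}"
  shows "orbit (long_cycle n ^^ k) x = (\<lambda>q. q * g + (x - 1) mod g + 1) ` {..<N div g}" (is "?O = ?R")
proof -
  have g: "g > 0" "g dvd N" "g dvd k" by (auto simp: g_def N_def)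
  let ?c = "long_cycle n ^^ k"
  have perm: "?c permutes {1..N}" unfolding N_def by (rule permutes_long_cycle_pow)
  have R: "y \<in> ?R" if "y \<in> {1..N}" "[y = x] (mod g)" for y
  proof (rule image_eqI)
    have "[y - 1 = x - 1] (mod g)"
      using that x cong_diff_nat[of y x g 1 1] by auto
    then have "(x - 1) mod g = (y - 1) mod g" by (simp add: cong_def)
    then show "y = (y - 1) div g * g + (x - 1) mod g + 1"
      using that(1) by (simp only: div_mult_mod_eq) simp
    have "y - 1 < N div g * g" using that g by (auto simp: N_def)
    then show "(y - 1) div g \<in> {..<N div g}" using g by (simp add: div_less_iff_less_mult)
  qed
  have O: "y \<in> {1..N} \<and> [y = x] (mod g)" if "y \<in> ?O" for y
  proof -
    have step: "?c z \<in> {1..N} \<and> [?c z = x] (mod g)" if z: "z \<in> {1..N}" "[z = x] (mod g)" for z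
    proof
      show "?c z \<in> {1..N}" using permutes_in_image[OF perm] z by blast
      have "[int (?c z) = int z - int k] (mod int g)"
        using long_cycle_pow_cong[of z n k] z g unfolding N_def
        by (meson cong_dvd_modulus int_dvd_int_iff)
      moreover have "[int z - int k = int z - 0] (mod int g)"
        using g by (intro cong_diff cong_refl) (simp add: cong_0_iff)
      ultimately have "[int (?c z) = int z] (mod int g)" using cong_trans by fastforce
      then show "[?c z = x] (mod g)" using z by (metis cong_int_iff cong_trans)
    qed
    show ?thesis using that by induction (use step x in auto)
  qed
  show ?thesis
  proof (intro equalityI subsetI)
    fix y assume "y \<in> ?O"
    then show "y \<in> ?R" using O R by blast
  next
    fix y assume "y \<in> ?R"
    then obtain q where q: "q < N div g" and y: "y = q * g + (x - 1) mod g + 1" by blast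
    have "[y = (x - 1) + 1] (mod g)" unfolding y by (intro cong_add) (simp_all add: cong_def)
    then have yx: "[y = x] (mod g)" using x by simp
    have "y \<le> q * g + g" using g unfolding y by (simp add: Suc_le_eq)
    also have "\<dots> = (q + 1) * g" by simp
    also have "\<dots> \<le> N div g * g" using q by (intro mult_le_mono1) simp
    finally have yN: "y \<in> {1..N}" using g y by auto
    have "int g dvd int x - int y" using yx by (metis cong_iff_dvd_diff cong_int_iff cong_sym)
    moreover have "int g = gcd (int k) (int N)" by (simp add: g_def)
    ultimately obtain t where t: "[int k * t = int x - int y] (mod int N)"
      using cong_solve_dvd_int by (metis cong_solve_dvd_int)
    define s where "s = nat (t mod int N)"
    have "[int s = t] (mod int N)" by (simp add: s_def cong_def N_def)
    then have "[int k * int s = int x - int y] (mod int N)"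
      using t by (meson cong_scalar_left cong_trans)
    moreover have "[int ((?c ^^ s) x) = int x - int (k * s)] (mod int N)"
      using long_cycle_pow_cong[of x n "k * s"] x by (simp add: funpow_mult N_def)
    ultimately have "[int ((?c ^^ s) x) = int x - (int x - int y)] (mod int N)"
      by (metis cong_diff cong_refl cong_trans of_nat_mult)
    then have cong: "[(?c ^^ s) x = y] (mod N)" by (simp add: cong_int_iff)
    have perm_s: "(?c ^^ s) permutes {1..N}"
      unfolding N_def funpow_mult by (rule permutes_long_cycle_pow)
    then have "(?c ^^ s) x \<in> {1..N}" using permutes_in_image[OF perm_s] x by blast
    with cong yN have "[(?c ^^ s) x - 1 = y - 1] (mod N)" by (intro cong_diff_nat) auto
    then have "(?c ^^ s) x - 1 = y - 1"
      using \<open>(?c ^^ s) x \<in> {1..N}\<close> yN by (intro cong_less_modulus_unique_nat) auto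
    then have eq: "(?c ^^ s) x = y"
      using \<open>(?c ^^ s) x \<in> {1..N}\<close> yN unfolding atLeastAtMost_iff by linarith
    have "x \<in> ?O"
      using permutation_self_in_orbit[of ?c x] perm permutes_imp_permutation[OF _ perm] by simp
    then have "(?c ^^ i) x \<in> ?O" for i by (induction i) (auto intro: orbit.intros)
    then show "y \<in> ?O" using eq by blast
  qed
qed

lemma cycle_psum_long_cycle_pow:
  fixes n k defines "N \<equiv> n + 1" defines "g \<equiv> gcd k N"
  shows "cycle_psum N (long_cycle n ^^ k) = psum (N div g) ^ g"
proof -
  have g: "g > 0" "g dvd N" by (auto simp: g_def N_def)
  then have Ng: "N div g > 0" by (simp add: N_def div_greater_zero_iff dvd_imp_le)
  let ?A = "\<lambda>r. (\<lambda>q. q * g + r + 1) ` {..<N div g}"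
  have orbits: "orbit (long_cycle n ^^ k) ` {1..N} = ?A ` {..<g}"
  proof -
    have "orbit (long_cycle n ^^ k) ` {1..N} = (\<lambda>x. ?A ((x - 1) mod g)) ` {1..N}"
      unfolding N_def g_def by (intro image_cong refl orbit_long_cycle_pow)
    also have "\<dots> = ?A ` ((\<lambda>x. (x - 1) mod g) ` {1..N})" by (simp add: image_image)
    also have "(\<lambda>x. (x - 1) mod g) ` {1..N} = {..<g}"
    proof (intro equalityI subsetI)
      fix r assume r: "r \<in> {..<g}"
      have "g \<le> N" using g by (auto simp: N_def intro: dvd_imp_le)
      then show "r \<in> (\<lambda>x. (x - 1) mod g) ` {1..N}"
        using r by (intro image_eqI[of _ _ "r + 1"]) auto
    qed (use g in auto)
    finally show ?thesis .
  qed
  have card: "card (?A r) = N div g" for r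
    using g by (subst card_image) (auto simp: inj_on_def)
  have inj: "inj_on ?A {..<g}"
  proof (rule inj_onI)
    fix r s assume rs: "r \<in> {..<g}" "s \<in> {..<g}" "?A r = ?A s"
    then have "r + 1 \<in> ?A s" using Ng by (metis (no_types, lifting) add_0 imageI lessThan_iff mult_0)
    then obtain q where "r = q * g + s" by auto
    then have "r mod g = s mod g" by simp
    then show "r = s" using rs by simp
  qed
  show ?thesis unfolding cycle_psum_def orbits
    by (subst prod.reindex[OF inj]) (simp only: o_def card prod_constant card_lessThan)
qed

lemma cycle_exponent_permutes:
  assumes "h permutes {1..n + 1}"
  shows "cycle_exponent n h \<le> n" "h \<circ> inv (long_cycle n ^^ cycle_exponent n h) permutes {1..n}"
proof -
  define x where "x = inv h (n + 1)"
  define k where "k = (if x = n + 1 then 0 else x)"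
  have hx: "h x = n + 1" using assms by (simp add: x_def permutes_inverses)
  have "x \<in> {1..n + 1}" using permutes_in_image[OF assms, of x] hx by simp
  then have k: "k \<le> n" by (auto simp: k_def)
  have "inv (long_cycle n ^^ k) (n + 1) = x"
    using inv_long_cycle_pow[OF k] \<open>x \<in> {1..n + 1}\<close> by (auto simp: k_def)
  then have fixed: "(h \<circ> inv (long_cycle n ^^ k)) (n + 1) = n + 1" by (simp add: hx)
  have "h \<circ> inv (long_cycle n ^^ k) permutes {1..n + 1}"
    by (intro permutes_compose permutes_inv permutes_long_cycle_pow assms)
  then have "h \<circ> inv (long_cycle n ^^ k) permutes {1..n}"
  proof (rule permutes_superset)
    fix y assume "y \<in> {1..n + 1} - {1..n}"
    then have "y = n + 1" by auto
    then show "(h \<circ> inv (long_cycle n ^^ k)) y = y" using fixed by simp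
  qed
  with k cycle_exponent_eqI[OF k this] show "cycle_exponent n h \<le> n"
    "h \<circ> inv (long_cycle n ^^ cycle_exponent n h) permutes {1..n}" by simp_all
qed

lemma inv_long_cycle_pow_comp:
  "inv (long_cycle n ^^ k) \<circ> (long_cycle n ^^ k) = id" "(long_cycle n ^^ k) \<circ> inv (long_cycle n ^^ k) = id"
  using permutes_inv_o[OF permutes_long_cycle_pow] by blast+

text \<open>This is the character of an induced representation: \<open>g\<close> maps the summand \<open>P n \<otimes> s\<close> to itself if
and only if \<open>g = s \<circ> c\<^sup>k \<circ> inv s\<close> for a power of the long cycle \<open>c\<close>, and then it acts there by \<open>\<tau>\<^sup>k\<close>. All these
conjugates of \<open>c\<^sup>k\<close> have the same cycle type.\<close>

lemma frobenius_char_sym_component: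
  fixes P :: "nat \<Rightarrow> 'a::rat_vector set"
  assumes coord: "coordinates_on (P n) I e \<kappa>"
    and \<tau>: "linear_on (P n) (\<tau> n)" "\<tau> n ` P n \<subseteq> P n"
  shows "frobenius_char (n + 1) (sym_component P n) (sym_act \<tau> n)
    = (1 / of_nat (n + 1)) *\<^sub>Q (\<Sum>k\<le>n. (\<Sum>i\<in>I. \<kappa> i ((\<tau> n ^^ k) (e i)))
        *\<^sub>Q psum ((n + 1) div gcd k (n + 1)) ^ gcd k (n + 1))"
proof -
  let ?V = "sym_component P n" and ?S = "{s. s permutes {1..n}}" and ?G = "{s. s permutes {1..n + 1}}"
  define \<theta> where "\<theta> k = (\<Sum>i\<in>I. \<kappa> i ((\<tau> n ^^ k) (e i)))" for k
  have sub: "rat_vec.subspace (P n)" and fin: "finite I" and e: "\<And>i. i \<in> I \<Longrightarrow> e i \<in> P n"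
    and lin: "\<And>i. i \<in> I \<Longrightarrow> linear_on (P n) (\<kappa> i)"
    and exp: "\<And>x. x \<in> P n \<Longrightarrow> x = (\<Sum>i\<in>I. \<kappa> i x *\<^sub>Q e i)"
    using coord by (auto simp: coordinates_on_def)
  have P0: "0 \<in> P n" by (rule rat_vec.subspace_0[OF sub])
  have \<kappa>0: "\<kappa> i 0 = 0" if "i \<in> I" for i using linear_on_zero[OF lin[OF that] P0] .
  note \<tau>k = linear_on_funpow[OF \<tau>]
  have \<tau>0: "(\<tau> n ^^ k) 0 = 0" for k by (rule linear_on_zero[OF \<tau>k(1) P0])
  have finS: "finite ?S" "finite ?G" by (simp_all add: finite_permutations)
  have mem: "F \<in> ?V \<longleftrightarrow> Poly_Mapping.keys F \<subseteq> ?S \<and> (\<forall>s. Poly_Mapping.lookup F s \<in> P n)" for F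
    using P0 by (auto simp: sym_component_def in_keys_iff)
  have subV: "rat_vec.subspace ?V"
  proof (rule rat_vec.subspaceI)
    fix x y assume "x \<in> ?V" "y \<in> ?V"
    then show "x + y \<in> ?V"
      unfolding mem using Poly_Mapping.keys_add[of x y] rat_vec.subspace_add[OF sub]
      by (auto simp: lookup_add)
  next
    fix c x assume "x \<in> ?V"
    then show "c *\<^sub>Q x \<in> ?V" using rat_vec.subspace_scale[OF sub]
      unfolding mem by (auto simp: in_keys_iff)
  qed (use P0 in \<open>simp add: mem\<close>)
  have coordV: "coordinates_on ?V (?S \<times> I) (\<lambda>(s, i). Poly_Mapping.single s (e i))
      (\<lambda>(s, i) F. \<kappa> i (Poly_Mapping.lookup F s))"
    unfolding coordinates_on_def
  proof (intro conjI ballI)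
    show "(\<lambda>(s, i). Poly_Mapping.single s (e i)) ` (?S \<times> I) \<subseteq> ?V"
      using e P0 by (auto simp: mem lookup_single when_def)
  next
    fix si assume "si \<in> ?S \<times> I"
    then show "linear_on ?V ((\<lambda>(s, i) F. \<kappa> i (Poly_Mapping.lookup F s)) si)"
      using lin by (auto simp: linear_on_def mem lookup_add)
  next
    fix F assume F: "F \<in> ?V"
    show "F = (\<Sum>si\<in>?S \<times> I. (\<lambda>(s, i) F. \<kappa> i (Poly_Mapping.lookup F s)) si F
        *\<^sub>Q (\<lambda>(s, i). Poly_Mapping.single s (e i)) si)"
    proof (rule poly_mapping_eqI)
      fix s
      have "Poly_Mapping.lookup (\<Sum>si\<in>?S \<times> I. (\<lambda>(s, i) F. \<kappa> i (Poly_Mapping.lookup F s)) si F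
            *\<^sub>Q (\<lambda>(s, i). Poly_Mapping.single s (e i)) si) s
          = (\<Sum>(t, i)\<in>?S \<times> I. if t = s then \<kappa> i (Poly_Mapping.lookup F t) *\<^sub>Q e i else 0)"
        by (simp add: lookup_sum case_prod_beta lookup_single when_def if_distrib cong: if_cong)
      also have "\<dots> = (\<Sum>t\<in>?S. if t = s then \<Sum>i\<in>I. \<kappa> i (Poly_Mapping.lookup F t) *\<^sub>Q e i else 0)"
        by (subst sum.cartesian_product[symmetric]) (intro sum.cong refl, simp)
      also have "\<dots> = (\<Sum>t\<in>?S. if t = s then Poly_Mapping.lookup F t else 0)"
        using F exp by (intro sum.cong refl) (simp add: mem exp[symmetric])
      also have "\<dots> = Poly_Mapping.lookup F s"
        using F finS by (auto simp: mem in_keys_iff)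
      finally show "Poly_Mapping.lookup F s = Poly_Mapping.lookup (\<Sum>si\<in>?S \<times> I.
          (\<lambda>(s, i) F. \<kappa> i (Poly_Mapping.lookup F s)) si F
            *\<^sub>Q (\<lambda>(s, i). Poly_Mapping.single s (e i)) si) s" ..
    qed
  qed (use finS fin subV in auto)
  let ?k = "\<lambda>g s. cycle_exponent n (g \<circ> s)"
  let ?s = "\<lambda>g s. g \<circ> s \<circ> inv (long_cycle n ^^ ?k g s)"
  have act: "sym_act \<tau> n g F
      = (\<Sum>s\<in>?S. Poly_Mapping.single (?s g s) ((\<tau> n ^^ ?k g s) (Poly_Mapping.lookup F s)))"
    if "F \<in> ?V" for g F
    unfolding sym_act_def Let_def
    by (rule sum.mono_neutral_left) (use that finS in \<open>auto simp: mem in_keys_iff \<tau>0\<close>)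
  have gs: "g \<circ> s permutes {1..n + 1}" if "g \<in> ?G" "s \<in> ?S" for g s
    using permutes_compose[OF permutes_subset[of s "{1..n}" "{1..n + 1}"], of g] that by auto
  have trace: "rat_trace ?V (sym_act \<tau> n g) = (\<Sum>s\<in>?S. if ?s g s = s then \<theta> (?k g s) else 0)"
    if g: "g \<in> ?G" for g
  proof -
    have "linear_on ?V (sym_act \<tau> n g)"
      unfolding linear_on_def
    proof (intro conjI ballI allI)
      fix x y assume xy: "x \<in> ?V" "y \<in> ?V"
      then have "x + y \<in> ?V" by (rule rat_vec.subspace_add[OF subV])
      with xy show "sym_act \<tau> n g (x + y) = sym_act \<tau> n g x + sym_act \<tau> n g y"
        using \<tau>k(1) by (simp add: act mem lookup_add linear_on_def single_add sum.distrib)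
    next
      fix c x assume x: "x \<in> ?V"
      then have "c *\<^sub>Q x \<in> ?V" by (rule rat_vec.subspace_scale[OF subV])
      moreover have "Poly_Mapping.single s (c *\<^sub>Q y) = c *\<^sub>Q Poly_Mapping.single s y" for s :: "nat \<Rightarrow> nat" and y :: 'a
        by (rule poly_mapping_eqI) (simp add: lookup_single when_def)
      ultimately show "sym_act \<tau> n g (c *\<^sub>Q x) = c *\<^sub>Q sym_act \<tau> n g x"
        using x \<tau>k(1) by (simp add: act mem linear_on_def rat_vec.scale_sum_right)
    qed
    moreover have "sym_act \<tau> n g ` ?V \<subseteq> ?V"
    proof clarify
      fix F assume F: "F \<in> ?V"
      have "Poly_Mapping.single (?s g s) ((\<tau> n ^^ ?k g s) (Poly_Mapping.lookup F s)) \<in> ?V" if "s \<in> ?S" for s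
        using F \<tau>k(2) cycle_exponent_permutes(2)[OF gs[OF g that]] P0
        by (auto simp: mem lookup_single when_def image_subset_iff)
      then show "sym_act \<tau> n g F \<in> ?V"
        unfolding act[OF F] by (rule rat_vec.subspace_sum[OF subV])
    qed
    ultimately have "rat_trace ?V (sym_act \<tau> n g) = (\<Sum>si\<in>?S \<times> I. (\<lambda>(s, i) F. \<kappa> i (Poly_Mapping.lookup F s)) si
        (sym_act \<tau> n g ((\<lambda>(s, i). Poly_Mapping.single s (e i)) si)))"
      by (rule rat_trace_coordinates[OF coordV])
    also have "\<dots> = (\<Sum>(s, i)\<in>?S \<times> I. if ?s g s = s then \<kappa> i ((\<tau> n ^^ ?k g s) (e i)) else 0)"
    proof (intro sum.cong refl, clarify)
      fix s i assume "s permutes {1..n}" "i \<in> I"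
      have "sym_act \<tau> n g (Poly_Mapping.single s (e i))
          = Poly_Mapping.single (?s g s) ((\<tau> n ^^ ?k g s) (e i))"
        by (simp add: sym_act_def Let_def \<tau>0)
      then show "\<kappa> i (Poly_Mapping.lookup (sym_act \<tau> n g (Poly_Mapping.single s (e i))) s)
          = (if ?s g s = s then \<kappa> i ((\<tau> n ^^ ?k g s) (e i)) else 0)"
        using \<kappa>0[OF \<open>i \<in> I\<close>] by (simp add: lookup_single when_def)
    qed
    also have "\<dots> = (\<Sum>s\<in>?S. if ?s g s = s then \<theta> (?k g s) else 0)"
      by (subst sum.cartesian_product[symmetric]) (intro sum.cong refl, simp add: \<theta>_def)
    finally show ?thesis .
  qed
  have inner: "(\<Sum>g\<in>?G. (if ?s g s = s then \<theta> (?k g s) else 0) *\<^sub>Q cycle_psum (n + 1) g)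
      = (\<Sum>k\<le>n. \<theta> k *\<^sub>Q cycle_psum (n + 1) (long_cycle n ^^ k))" if s: "s \<in> ?S" for s
  proof -
    let ?c = "\<lambda>k. long_cycle n ^^ k"
    let ?f = "\<lambda>k. s \<circ> ?c k \<circ> inv s"
    have sN: "s permutes {1..n + 1}" using s by (auto intro: permutes_subset[of s "{1..n}"])
    have s_inv: "s \<circ> inv s = id" "inv s \<circ> s = id" using permutes_inv_o[OF sN] by blast+
    have fs: "?f k \<circ> s = s \<circ> ?c k" for k by (simp only: comp_assoc s_inv comp_id)
    have fsc: "s \<circ> ?c k \<circ> inv (?c k) = s" for k
      by (simp only: comp_assoc inv_long_cycle_pow_comp comp_id)
    have k: "?k (?f k) s = k" if "k \<le> n" for k
      unfolding fs by (rule cycle_exponent_eqI[OF that]) (use s fsc in simp)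
    have inj: "inj_on ?f {..n}" by (rule inj_on_inverseI[of _ "\<lambda>g. ?k g s"]) (use k in simp)
    have fG: "?f k \<in> ?G" for k
      using permutes_compose[OF permutes_compose[OF permutes_inv[OF sN] permutes_long_cycle_pow] sN]
      by (simp only: mem_Collect_eq comp_assoc)
    have "(\<Sum>g\<in>?G. (if ?s g s = s then \<theta> (?k g s) else 0) *\<^sub>Q cycle_psum (n + 1) g)
        = (\<Sum>g\<in>?f ` {..n}. \<theta> (?k g s) *\<^sub>Q cycle_psum (n + 1) g)"
    proof (rule sum.mono_neutral_cong_right[OF finS(2)])
      show "?f ` {..n} \<subseteq> ?G" using fG by blast
      show "\<forall>g\<in>?G - ?f ` {..n}. (if ?s g s = s then \<theta> (?k g s) else 0) *\<^sub>Q cycle_psum (n + 1) g = 0"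
      proof
        fix g assume g: "g \<in> ?G - ?f ` {..n}"
        have "?s g s \<noteq> s"
        proof
          assume eq: "?s g s = s"
          have "g = g \<circ> s \<circ> (inv (?c (?k g s)) \<circ> ?c (?k g s)) \<circ> inv s"
            by (simp only: inv_long_cycle_pow_comp comp_id comp_assoc s_inv)
          also have "\<dots> = ?s g s \<circ> ?c (?k g s) \<circ> inv s" by (simp only: comp_assoc)
          finally have "g = ?f (?k g s)" unfolding eq .
          then show False using g cycle_exponent_permutes(1)[OF gs[of g s]] s by blast
        qed
        then show "(if ?s g s = s then \<theta> (?k g s) else 0) *\<^sub>Q cycle_psum (n + 1) g = 0" by simp
      qed
      show "(if ?s g s = s then \<theta> (?k g s) else 0) *\<^sub>Q cycle_psum (n + 1) g
          = \<theta> (?k g s) *\<^sub>Q cycle_psum (n + 1) g" if g: "g \<in> ?f ` {..n}" for g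
      proof -
        obtain k where "k \<le> n" "g = ?f k" using g by blast
        then have "?s g s = s" using k[of k] fs fsc by metis
        then show ?thesis by (simp only: if_True simp_thms)
      qed
    qed
    also have "\<dots> = (\<Sum>k\<le>n. \<theta> k *\<^sub>Q cycle_psum (n + 1) (?f k))"
      by (subst sum.reindex[OF inj], rule sum.cong[OF refl], simp only: o_apply k atMost_iff)
    also have "\<dots> = (\<Sum>k\<le>n. \<theta> k *\<^sub>Q cycle_psum (n + 1) (?c k))"
      by (simp only: cycle_psum_conj[OF sN])
    finally show ?thesis .
  qed
  have "(\<Sum>g\<in>?G. rat_trace ?V (sym_act \<tau> n g) *\<^sub>Q cycle_psum (n + 1) g)
      = (\<Sum>g\<in>?G. \<Sum>s\<in>?S. (if ?s g s = s then \<theta> (?k g s) else 0) *\<^sub>Q cycle_psum (n + 1) g)"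
    by (intro sum.cong refl) (simp only: trace rat_vec.scale_sum_left)
  also have "\<dots> = (\<Sum>s\<in>?S. \<Sum>k\<le>n. \<theta> k *\<^sub>Q cycle_psum (n + 1) (long_cycle n ^^ k))"
    by (subst sum.swap) (intro sum.cong refl inner)
  also have "\<dots> = of_nat (card ?S) * (\<Sum>k\<le>n. \<theta> k *\<^sub>Q cycle_psum (n + 1) (long_cycle n ^^ k))"
    by simp
  also have "card ?S = fact n" by (simp add: card_permutations[of _ n])
  also have "of_nat (fact n) * X = (fact n :: rat) *\<^sub>Q X" for X :: symfun
  proof -
    have "of_nat m * X = (of_nat m :: rat) *\<^sub>Q X" for m
      by (induction m) (simp_all add: distrib_right scaleQ_add_left scaleQ_one)
    from this[of "fact n"] show ?thesis by simp
  qed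
  finally have "frobenius_char (n + 1) ?V (sym_act \<tau> n) = (1 / fact (n + 1)) *\<^sub>Q fact n *\<^sub>Q
      (\<Sum>k\<le>n. \<theta> k *\<^sub>Q cycle_psum (n + 1) (long_cycle n ^^ k))"
    unfolding frobenius_char_def by simp
  also have "\<dots> = (1 / of_nat (n + 1)) *\<^sub>Q
      (\<Sum>k\<le>n. \<theta> k *\<^sub>Q cycle_psum (n + 1) (long_cycle n ^^ k))"
    by (simp add: scaleQ_scaleQ)
  finally show ?thesis unfolding cycle_psum_long_cycle_pow \<theta>_def .
qed

section \<open>Fractions of binary trees and their residues\<close>

text \<open>The denominator has one factor for each inner node, the difference of the points at the last and
the first leaf below that node. The function depends only on the points \<open>v 0, \<dots>, v (leaves t - 1)\<close>.\<close>

fun frac :: "unit btree \<Rightarrow> (nat \<Rightarrow> rat) \<Rightarrow> rat" where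
  "frac Leaf v = 1"
| "frac (Node g l r) v = frac l v * frac r (\<lambda>j. v (j + leaves l))
     / (v (leaves l + leaves r - 1) - v 0)"

lemma frac_cong: "(\<And>j. j < leaves t \<Longrightarrow> v j = w j) \<Longrightarrow> frac t v = frac t w"
proof (induction t arbitrary: v w)
  case (Node g l r)
  have "frac l v = frac l w" by (rule Node.IH) (use Node.prems in auto)
  moreover have "frac r (\<lambda>j. v (j + leaves l)) = frac r (\<lambda>j. w (j + leaves l))"
    by (rule Node.IH) (use Node.prems in auto)
  moreover have "0 < leaves l + leaves r" using leaves_pos[of l] by linarith
  then have "v (leaves l + leaves r - 1) = w (leaves l + leaves r - 1)" "v 0 = w 0"
    by (simp_all add: Node.prems)
  ultimately show ?case by simp
qed simp

lemma frac_translate: "frac t (\<lambda>j. v j + c) = frac t v"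
  by (induction t arbitrary: v) auto

text \<open>Limits are taken in the reals, but all limits that occur are rational.\<close>

definition rat_limit :: "(nat \<Rightarrow> rat) \<Rightarrow> rat \<Rightarrow> bool" where
  "rat_limit f l \<longleftrightarrow> (\<lambda>k. real_of_rat (f k)) \<longlonglongrightarrow> real_of_rat l"

lemma rat_limit_const: "rat_limit (\<lambda>_. c) c"
  by (simp add: rat_limit_def)

lemma rat_limit_mult: "rat_limit f a \<Longrightarrow> rat_limit g b \<Longrightarrow> rat_limit (\<lambda>k. f k * g k) (a * b)"
  unfolding rat_limit_def by (simp add: of_rat_mult tendsto_mult)

lemma rat_limit_sum:
  "(\<And>i. i \<in> I \<Longrightarrow> rat_limit (f i) (a i)) \<Longrightarrow> rat_limit (\<lambda>k. \<Sum>i\<in>I. f i k) (\<Sum>i\<in>I. a i)"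
  unfolding rat_limit_def by (simp add: of_rat_sum tendsto_sum)

lemma rat_limit_unique: "rat_limit f a \<Longrightarrow> rat_limit f b \<Longrightarrow> a = b"
  unfolding rat_limit_def using LIMSEQ_unique of_rat_eq_iff by blast

lemma rat_limit_cong:
  "eventually (\<lambda>k. f k = g k) sequentially \<Longrightarrow> rat_limit f a \<longleftrightarrow> rat_limit g a"
  unfolding rat_limit_def by (rule tendsto_cong) (auto elim: eventually_mono)

lemma rat_limit_inverse:
  assumes "e = 1 \<or> e = -1"
  shows "rat_limit (\<lambda>k. 1 / (x + e * of_nat k)) 0"
    "rat_limit (\<lambda>k. of_nat k / (x + e * of_nat k)) e"
proof -
  have lim: "(\<lambda>k. 1 / (y + real k)) \<longlonglongrightarrow> 0" for y
  proof -
    have "filterlim (\<lambda>k. y + real k) at_top sequentially"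
      by (rule filterlim_tendsto_add_at_top[OF tendsto_const filterlim_real_sequentially])
    then show ?thesis by (rule tendsto_divide_0[OF tendsto_const filterlim_at_top_imp_at_infinity])
  qed
  have lim1: "(\<lambda>k. real k / (y + real k)) \<longlonglongrightarrow> 1" for y
  proof -
    have "(\<lambda>k. 1 - y * (1 / (y + real k))) \<longlonglongrightarrow> 1 - y * 0"
      by (intro tendsto_intros lim)
    moreover have "eventually (\<lambda>k. y + real k \<noteq> 0) sequentially"
      using eventually_gt_at_top[of "nat \<lceil>- y\<rceil>"]
      by (rule eventually_mono) (use le_of_int_ceiling[of "- y"] in linarith)
    then have "eventually (\<lambda>k. 1 - y * (1 / (y + real k)) = real k / (y + real k)) sequentially"
      by (rule eventually_mono) (simp add: field_simps)
    ultimately show ?thesis by (simp add: tendsto_cong)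
  qed
  have neg: "1 / (x - real k) = - (1 / (- x + real k))"
    "real k / (x - real k) = - (real k / (- x + real k))" for k and x :: real
    by (simp_all add: minus_divide_right)
  from assms show "rat_limit (\<lambda>k. 1 / (x + e * of_nat k)) 0"
    using lim[of "real_of_rat x"] tendsto_minus[OF lim[of "- real_of_rat x"]] neg(1)
    unfolding rat_limit_def by (auto simp: of_rat_divide of_rat_add of_rat_diff of_rat_minus)
  from assms show "rat_limit (\<lambda>k. of_nat k / (x + e * of_nat k)) e"
    using lim1[of "real_of_rat x"] tendsto_minus[OF lim1[of "- real_of_rat x"]]
    unfolding rat_limit_def by (auto simp: of_rat_divide of_rat_add of_rat_diff neg(2) of_rat_minus)
qed

text \<open>The points in \<open>X\<close> move to infinity as \<open>k\<close> grows, with fixed distances between them.\<close>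

definition push :: "nat set \<Rightarrow> nat \<Rightarrow> (nat \<Rightarrow> rat) \<Rightarrow> nat \<Rightarrow> rat" where
  "push X k v j = (if j \<in> X then v j + of_nat k else v j)"

lemma frac_push_const:
  assumes "{..<leaves t} \<subseteq> X \<or> {..<leaves t} \<inter> X = {}"
  shows "frac t (push X k v) = frac t v"
  using assms
proof
  assume "{..<leaves t} \<subseteq> X"
  then have "frac t (push X k v) = frac t (\<lambda>j. v j + of_nat k)"
    by (intro frac_cong) (auto simp: push_def)
  then show ?thesis by (simp add: frac_translate)
next
  assume "{..<leaves t} \<inter> X = {}"
  then show ?thesis by (intro frac_cong) (auto simp: push_def)
qed

lemma push_shift: "(\<lambda>j. push X k v (j + a)) = push {j. j + a \<in> X} k (\<lambda>j. v (j + a))"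
  by (auto simp: push_def)

lemma root_factor_push:
  "1 / (push X k v b - push X k v a) =
    (if (a \<in> X) = (b \<in> X) then 1 / (v b - v a)
     else if b \<in> X then 1 / (v b - v a + 1 * of_nat k) else 1 / (v b - v a + (-1) * of_nat k))"
  by (auto simp: push_def algebra_simps)

text \<open>A fraction tends to \<open>0\<close> unless all of its points move together: if \<open>X\<close> cuts neither of the two
subtrees of the root, but separates them, then the factor of the root tends to \<open>0\<close>.\<close>

lemma frac_push_limit:
  "rat_limit (\<lambda>k. frac t (push X k v))
     (if {..<leaves t} \<subseteq> X \<or> {..<leaves t} \<inter> X = {} then frac t v else 0)"
proof (cases "{..<leaves t} \<subseteq> X \<or> {..<leaves t} \<inter> X = {}")
  case True
  then show ?thesis by (simp add: frac_push_const rat_limit_const)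
next
  case False
  have "rat_limit (\<lambda>k. frac t (push X k v)) 0"
    using False
  proof (induction t arbitrary: v X)
    case Leaf
    then show ?case by auto
  next
    case (Node g l r)
    let ?mono = "\<lambda>t X. {..<leaves t} \<subseteq> X \<or> {..<leaves t} \<inter> X = {}"
    let ?X = "{j. j + leaves l \<in> X}" and ?v = "\<lambda>j. v (j + leaves l)"
    let ?b = "leaves l + leaves r - 1"
    have lim: "\<exists>y. rat_limit (\<lambda>k. frac t (push X k v)) y" if "\<not> ?mono t X \<Longrightarrow> rat_limit (\<lambda>k. frac t (push X k v)) 0"
      for t :: "unit btree" and X v
      using that frac_push_const[of t X _ v] rat_limit_const by (cases "?mono t X") auto
    obtain yl where yl: "rat_limit (\<lambda>k. frac l (push X k v)) yl" using lim Node.IH(1) by blast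
    obtain yr where yr: "rat_limit (\<lambda>k. frac r (push ?X k ?v)) yr" using lim Node.IH(2) by blast
    have "\<exists>z. rat_limit (\<lambda>k. 1 / (push X k v ?b - push X k v 0)) z \<and> ((0 \<in> X) \<noteq> (?b \<in> X) \<longrightarrow> z = 0)"
      using rat_limit_inverse(1)[of 1 "v ?b - v 0"] rat_limit_inverse(1)[of "-1" "v ?b - v 0"]
        rat_limit_const unfolding root_factor_push by (cases "0 \<in> X"; cases "?b \<in> X") auto
    then obtain z where z: "rat_limit (\<lambda>k. 1 / (push X k v ?b - push X k v 0)) z"
      "(0 \<in> X) \<noteq> (?b \<in> X) \<Longrightarrow> z = 0" by blast
    have "yl * yr * z = 0"
    proof (cases "?mono l X \<and> ?mono r ?X")
      case True
      have 0: "0 < leaves l" "0 < leaves r" by (simp_all add: Suc_le_eq[symmetric])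
      have b: "?b = leaves r - 1 + leaves l" using 0 by simp
      have "(0 \<in> X) \<noteq> (?b \<in> X)"
      proof
        assume eq: "(0 \<in> X) = (?b \<in> X)"
        have "(0 \<in> X) \<longleftrightarrow> {..<leaves l} \<subseteq> X" "(0 \<notin> X) \<longleftrightarrow> {..<leaves l} \<inter> X = {}"
          using True 0 by blast+
        moreover have "(?b \<in> X) \<longleftrightarrow> {..<leaves r} \<subseteq> ?X" "(?b \<notin> X) \<longleftrightarrow> {..<leaves r} \<inter> ?X = {}"
        proof -
          have "(?b \<in> X) \<longleftrightarrow> leaves r - 1 \<in> ?X" "leaves r - 1 \<in> {..<leaves r}"
            unfolding b using 0 by simp_all
          then show "(?b \<in> X) \<longleftrightarrow> {..<leaves r} \<subseteq> ?X" "(?b \<notin> X) \<longleftrightarrow> {..<leaves r} \<inter> ?X = {}"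
            using True by blast+
        qed
        moreover have "j \<in> {..<leaves l} \<or> j - leaves l \<in> {..<leaves r} \<and> j = j - leaves l + leaves l"
          if "j < leaves l + leaves r" for j using that by auto
        ultimately have "?mono (Node g l r) X" using eq by (simp add: subset_iff disjoint_iff) metis
        then show False using Node.prems by simp
      qed
      then show ?thesis using z(2) by simp
    next
      case False
      then consider "\<not> ?mono l X" | "\<not> ?mono r ?X" by blast
      then have "yl = 0 \<or> yr = 0"
      proof cases
        case 1
        then show ?thesis using rat_limit_unique[OF yl Node.IH(1)] by simp
      next
        case 2
        then show ?thesis using rat_limit_unique[OF yr Node.IH(2)] by simp
      qed
      then show ?thesis by auto
    qed
    then have "rat_limit (\<lambda>k. frac l (push X k v) * frac r (push ?X k ?v)
        * (1 / (push X k v ?b - push X k v 0))) 0"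
      using rat_limit_mult[OF rat_limit_mult[OF yl yr] z(1)] by (simp only:)
    then show ?case by (simp add: push_shift)
  qed
  with False show ?thesis by simp
qed

text \<open>The tree \<open>t\<close> is cut at the block of \<open>c\<close> leaves that starts at \<open>a\<close>. If this block is the set of leaves
of a subtree \<open>b\<close> then the result consists of the sign of the residue, \<open>b\<close>, and the tree that arises from
\<open>t\<close> by replacing the parent of \<open>b\<close> by the sibling of \<open>b\<close>. A block at the beginning or the end of \<open>t\<close> must
in addition be a child of the root, since otherwise two factors of the denominator grow.\<close>

fun split_block :: "nat \<Rightarrow> nat \<Rightarrow> unit btree \<Rightarrow> (rat \<times> unit btree \<times> unit btree) option" where
  "split_block a c Leaf = None"
| "split_block a c (Node g l r) =
    (if a = 0 then if c = leaves l then Some (-1, l, r) else None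
     else if a + c = leaves l + leaves r then if c = leaves r then Some (1, r, l) else None
     else if a + c \<le> leaves l then map_option (\<lambda>(e, b, s). (e, b, Node g s r)) (split_block a c l)
     else if leaves l \<le> a
       then map_option (\<lambda>(e, b, s). (e, b, Node g l s)) (split_block (a - leaves l) c r)
     else None)"

lemma split_block_leaves:
  "split_block a c t = Some (e, b, s) \<Longrightarrow> leaves b = c \<and> leaves s + c = leaves t"
  by (induction t arbitrary: a s) (auto split: if_splits)

definition delete_block :: "nat \<Rightarrow> nat \<Rightarrow> (nat \<Rightarrow> rat) \<Rightarrow> nat \<Rightarrow> rat" where
  "delete_block a c v j = (if j < a then v j else v (j + c))"

text \<open>With \<open>v (j + a)\<close> and \<open>delete_block a c v\<close>, the points of the block and the remaining points are
numbered from \<open>0\<close> again.\<close>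

definition block_residue :: "nat \<Rightarrow> nat \<Rightarrow> unit btree \<Rightarrow> (nat \<Rightarrow> rat) \<Rightarrow> rat" where
  "block_residue a c t v = (case split_block a c t of None \<Rightarrow> 0
     | Some (e, b, s) \<Rightarrow> e * frac b (\<lambda>j. v (j + a)) * frac s (delete_block a c v))"

text \<open>A fraction whose points do not move together is of order at most \<open>1 / k\<close>. So the limit is nonzero
only if exactly one factor of the denominator grows, namely the one at the parent of the block.\<close>

lemma frac_push_block_residue:
  assumes "0 < c" "c < leaves t" "a + c \<le> leaves t"
  shows "rat_limit (\<lambda>k. of_nat k * frac t (push {a..<a + c} k v)) (block_residue a c t v)"
  using assms
proof (induction t arbitrary: a c v)
  case Leaf
  then show ?case by simp
next
  case (Node g l r)
  let ?l = "leaves l" and ?r = "leaves r" and ?X = "{a..<a + c}"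
  let ?b = "?l + ?r - 1" and ?v = "\<lambda>j. v (j + leaves l)"
  let ?Y = "{j. j + ?l \<in> ?X}"
  let ?root = "\<lambda>k. 1 / (push ?X k v ?b - push ?X k v 0)"
  have pos: "0 < ?l" "0 < ?r" by (simp_all add: Suc_le_eq[symmetric])
  have eq: "frac (Node g l r) (push ?X k v) = frac l (push ?X k v) * frac r (push ?Y k ?v) * ?root k" for k
    by (simp add: push_shift)
  have Y: "?Y = {a - ?l..<a - ?l + c}" if "?l \<le> a" using that by auto
  consider "a = 0" | "a \<noteq> 0" "a + c = ?l + ?r"
    | "a \<noteq> 0" "a + c \<noteq> ?l + ?r" "a + c \<le> ?l" | "a \<noteq> 0" "a + c \<noteq> ?l + ?r" "?l \<le> a"
    | "a \<noteq> 0" "a + c \<noteq> ?l + ?r" "a < ?l" "?l < a + c" by linarith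
  then show ?case
  proof cases
    case 1
    \<comment> \<open>The first point moves and the last one does not: the root factor is of order \<open>- 1 / k\<close>.\<close>
    have "?root k = 1 / (v ?b - v 0 + (-1) * of_nat k)" for k
      using 1 Node.prems pos unfolding root_factor_push by auto
    then have root: "rat_limit (\<lambda>k. of_nat k * ?root k) (-1)"
      using rat_limit_inverse(2)[of "-1" "v ?b - v 0"] by simp
    have "rat_limit (\<lambda>k. frac l (push ?X k v) * frac r (push ?Y k ?v) * (of_nat k * ?root k))
        ((if {..<?l} \<subseteq> ?X \<or> {..<?l} \<inter> ?X = {} then frac l v else 0)
          * (if {..<?r} \<subseteq> ?Y \<or> {..<?r} \<inter> ?Y = {} then frac r ?v else 0) * -1)"
      by (intro rat_limit_mult root frac_push_limit)
    also have "(\<lambda>k. frac l (push ?X k v) * frac r (push ?Y k ?v) * (of_nat k * ?root k))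
        = (\<lambda>k. of_nat k * frac (Node g l r) (push ?X k v))"
      unfolding eq by (simp only: mult_ac)
    also have "(if {..<?l} \<subseteq> ?X \<or> {..<?l} \<inter> ?X = {} then frac l v else 0)
          * (if {..<?r} \<subseteq> ?Y \<or> {..<?r} \<inter> ?Y = {} then frac r ?v else 0) * -1
        = block_residue a c (Node g l r) v"
    proof (cases "c = ?l")
      case True
      then have "{..<?l} \<subseteq> ?X" "{..<?r} \<inter> ?Y = {}" using 1 by auto
      moreover have "frac r ?v = frac r (delete_block a c v)"
        by (rule frac_cong) (use True 1 in \<open>auto simp: delete_block_def\<close>)
      ultimately show ?thesis using 1 True by (simp add: block_residue_def)
    next
      case False
      consider "c < ?l" | "?l < c" using False by linarith
      then have "\<not> ({..<?l} \<subseteq> ?X \<or> {..<?l} \<inter> ?X = {}) \<or> \<not> ({..<?r} \<subseteq> ?Y \<or> {..<?r} \<inter> ?Y = {})"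
      proof cases
        case a: 1
        have "0 \<in> {..<?l} \<inter> ?X" "?l - 1 \<in> {..<?l} - ?X" using 1 a Node.prems pos by auto
        then show ?thesis by blast
      next
        case a: 2
        have "0 \<in> {..<?r} \<inter> ?Y" "?r - 1 \<in> {..<?r} - ?Y" using 1 a Node.prems pos by auto
        then show ?thesis by blast
      qed
      then show ?thesis using 1 False by (auto simp: block_residue_def)
    qed
    finally show ?thesis .
  next
    case 2
    \<comment> \<open>The last point moves and the first one does not: the root factor is of order \<open>1 / k\<close>.\<close>
    have "?root k = 1 / (v ?b - v 0 + 1 * of_nat k)" for k
      using 2 Node.prems pos unfolding root_factor_push by auto
    then have root: "rat_limit (\<lambda>k. of_nat k * ?root k) 1"
      using rat_limit_inverse(2)[of 1 "v ?b - v 0"] by simp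
    have "rat_limit (\<lambda>k. frac l (push ?X k v) * frac r (push ?Y k ?v) * (of_nat k * ?root k))
        ((if {..<?l} \<subseteq> ?X \<or> {..<?l} \<inter> ?X = {} then frac l v else 0)
          * (if {..<?r} \<subseteq> ?Y \<or> {..<?r} \<inter> ?Y = {} then frac r ?v else 0) * 1)"
      by (intro rat_limit_mult root frac_push_limit)
    also have "(\<lambda>k. frac l (push ?X k v) * frac r (push ?Y k ?v) * (of_nat k * ?root k))
        = (\<lambda>k. of_nat k * frac (Node g l r) (push ?X k v))"
      unfolding eq by (simp only: mult_ac)
    also have "(if {..<?l} \<subseteq> ?X \<or> {..<?l} \<inter> ?X = {} then frac l v else 0)
          * (if {..<?r} \<subseteq> ?Y \<or> {..<?r} \<inter> ?Y = {} then frac r ?v else 0) * 1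
        = block_residue a c (Node g l r) v"
    proof (cases "c = ?r")
      case True
      then have a: "a = ?l" using 2 by simp
      then have "{..<?l} \<inter> ?X = {}" "{..<?r} \<subseteq> ?Y" using True by auto
      moreover have "frac l v = frac l (delete_block a c v)"
        by (rule frac_cong) (use a in \<open>auto simp: delete_block_def\<close>)
      ultimately show ?thesis using 2 True a by (simp add: block_residue_def mult.commute)
    next
      case False
      consider "c < ?r" | "?r < c" using False by linarith
      then have "\<not> ({..<?l} \<subseteq> ?X \<or> {..<?l} \<inter> ?X = {}) \<or> \<not> ({..<?r} \<subseteq> ?Y \<or> {..<?r} \<inter> ?Y = {})"
      proof cases
        case a: 1
        have "0 \<in> {..<?r} - ?Y" "?r - 1 \<in> {..<?r} \<inter> ?Y" using 2 a Node.prems pos by auto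
        then show ?thesis by blast
      next
        case a: 2
        have "0 \<in> {..<?l} - ?X" "?l - 1 \<in> {..<?l} \<inter> ?X" using 2 a Node.prems pos by auto
        then show ?thesis by blast
      qed
      then show ?thesis using 2 False by (auto simp: block_residue_def)
    qed
    finally show ?thesis .
  next
    case 3
    have root: "?root k = 1 / (v ?b - v 0)" for k
      using 3 Node.prems pos unfolding root_factor_push by auto
    have r: "frac r (push ?Y k ?v) = frac r ?v" for k
      by (rule frac_push_const) (use 3 in auto)
    have "rat_limit (\<lambda>k. of_nat k * frac l (push ?X k v) * frac r ?v * (1 / (v ?b - v 0)))
        (block_residue a c l v * frac r ?v * (1 / (v ?b - v 0)))"
      by (intro rat_limit_mult rat_limit_const Node.IH) (use 3 Node.prems in auto)
    also have "(\<lambda>k. of_nat k * frac l (push ?X k v) * frac r ?v * (1 / (v ?b - v 0)))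
        = (\<lambda>k. of_nat k * frac (Node g l r) (push ?X k v))"
      unfolding eq root r by (simp only: mult_ac)
    also have "block_residue a c l v * frac r ?v * (1 / (v ?b - v 0)) = block_residue a c (Node g l r) v"
    proof (cases "split_block a c l")
      case None
      then show ?thesis using 3 by (simp add: block_residue_def)
    next
      case (Some x)
      then obtain e b s where s: "split_block a c l = Some (e, b, s)" by (cases x) auto
      note lv = split_block_leaves[OF s]
      have "frac r (\<lambda>j. delete_block a c v (j + leaves s)) = frac r ?v"
        by (rule frac_cong) (use lv 3 in \<open>auto simp: delete_block_def algebra_simps\<close>)
      moreover have "leaves s + ?r - 1 + c = ?b" "\<not> leaves s + ?r - 1 < a" "0 < a"
        using lv 3 pos by auto
      then have "delete_block a c v (leaves s + ?r - 1) = v ?b" "delete_block a c v 0 = v 0"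
        by (simp_all only: delete_block_def if_True if_False)
      ultimately show ?thesis using 3 s by (simp add: block_residue_def)
    qed
    finally show ?thesis .
  next
    case 4
    have root: "?root k = 1 / (v ?b - v 0)" for k
      using 4 Node.prems pos unfolding root_factor_push by auto
    have l: "frac l (push ?X k v) = frac l v" for k
      by (rule frac_push_const) (use 4 in auto)
    have "rat_limit (\<lambda>k. of_nat k * frac r (push ?Y k ?v) * frac l v * (1 / (v ?b - v 0)))
        (block_residue (a - ?l) c r ?v * frac l v * (1 / (v ?b - v 0)))"
      unfolding Y[OF 4(3)]
      by (intro rat_limit_mult rat_limit_const Node.IH) (use 4 Node.prems in auto)
    also have "(\<lambda>k. of_nat k * frac r (push ?Y k ?v) * frac l v * (1 / (v ?b - v 0)))
        = (\<lambda>k. of_nat k * frac (Node g l r) (push ?X k v))"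
      unfolding eq root l by (simp only: mult_ac)
    also have "block_residue (a - ?l) c r ?v * frac l v * (1 / (v ?b - v 0))
        = block_residue a c (Node g l r) v"
    proof (cases "split_block (a - ?l) c r")
      case None
      then show ?thesis using 4 Node.prems by (simp add: block_residue_def)
    next
      case (Some x)
      then obtain e b s where s: "split_block (a - ?l) c r = Some (e, b, s)" by (cases x) auto
      note lv = split_block_leaves[OF s]
      have "delete_block (a - ?l) c ?v = (\<lambda>j. delete_block a c v (j + ?l))"
        using 4 by (auto simp: delete_block_def fun_eq_iff add_ac less_diff_conv)
      moreover have "frac l (delete_block a c v) = frac l v"
        by (rule frac_cong) (use 4 in \<open>auto simp: delete_block_def\<close>)
      moreover have "frac b (\<lambda>j. ?v (j + (a - ?l))) = frac b (\<lambda>j. v (j + a))"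
        using 4 by (simp add: algebra_simps)
      moreover have "?l + leaves s - 1 + c = ?b" "\<not> ?l + leaves s - 1 < a" "0 < a"
        using lv 4 pos Node.prems by auto
      then have "delete_block a c v (?l + leaves s - 1) = v ?b" "delete_block a c v 0 = v 0"
        by (simp_all only: delete_block_def if_True if_False)
      ultimately show ?thesis using 4 s Node.prems by (simp add: block_residue_def)
    qed
    finally show ?thesis .
  next
    case 5
    have root: "?root k = 1 / (v ?b - v 0)" for k
      using 5 Node.prems pos unfolding root_factor_push by auto
    \<comment> \<open>Both subtrees are cut. The left one is of order at most \<open>1 / k\<close>, and the right one tends to \<open>0\<close>.\<close>
    have l: "frac l (push ?X k v) = frac l (push {a..<a + (?l - a)} k v)" for k
      by (rule frac_cong) (use 5 in \<open>auto simp: push_def\<close>)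
    have "0 \<in> {..<?r} \<inter> ?Y" "?r - 1 \<in> {..<?r} - ?Y" using 5 Node.prems pos by auto
    then have "\<not> ({..<?r} \<subseteq> ?Y \<or> {..<?r} \<inter> ?Y = {})" by blast
    then have r: "rat_limit (\<lambda>k. frac r (push ?Y k ?v)) 0"
      using frac_push_limit[of r ?Y ?v] by simp
    have "rat_limit (\<lambda>k. of_nat k * frac l (push {a..<a + (?l - a)} k v) * frac r (push ?Y k ?v)
          * (1 / (v ?b - v 0))) (block_residue a (?l - a) l v * 0 * (1 / (v ?b - v 0)))"
      by (intro rat_limit_mult rat_limit_const Node.IH r) (use 5 Node.prems in auto)
    also have "(\<lambda>k. of_nat k * frac l (push {a..<a + (?l - a)} k v) * frac r (push ?Y k ?v)
          * (1 / (v ?b - v 0))) = (\<lambda>k. of_nat k * frac (Node g l r) (push ?X k v))"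
      unfolding eq root l by (simp only: mult_ac)
    finally show ?thesis using 5 by (simp add: block_residue_def)
  qed
qed

lemma eventually_inj_on_push:
  assumes "inj_on v X" "inj_on v Y" "finite X" "finite Y"
  shows "eventually (\<lambda>k. inj_on (push X k v) (X \<union> Y)) sequentially"
proof -
  have ev: "eventually (\<lambda>k. v x + of_nat k \<noteq> v y) sequentially" for x y
  proof -
    obtain K :: nat where K: "v y - v x < of_nat K" using reals_Archimedean2 by blast
    have "v x + of_nat k \<noteq> v y" if "K \<le> k" for k
    proof -
      have "(of_nat K :: rat) \<le> of_nat k" using that by simp
      then show ?thesis using K by linarith
    qed
    then show ?thesis by (auto simp: eventually_sequentially)
  qed
  have "eventually (\<lambda>k. \<forall>x\<in>X. \<forall>y\<in>Y. v x + of_nat k \<noteq> v y) sequentially"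
    using assms(3,4) ev by (simp add: eventually_ball_finite)
  then show ?thesis
  proof (rule eventually_mono)
    fix k assume ne: "\<forall>x\<in>X. \<forall>y\<in>Y. v x + of_nat k \<noteq> v y"
    show "inj_on (push X k v) (X \<union> Y)"
    proof (rule inj_onI)
      fix x y assume "x \<in> X \<union> Y" "y \<in> X \<union> Y" "push X k v x = push X k v y"
      then show "x = y" using ne assms(1,2)
        by (auto simp: push_def inj_on_def split: if_splits) metis+
    qed
  qed
qed

text \<open>Linear relations between fractions hold only at distinct points. Points that are distinct inside the
block and distinct outside of it may still coincide, but only for finitely many \<open>k\<close>.\<close>

lemma eventually_inj_on_push_block:
  assumes "inj_on (\<lambda>j. v (j + a)) {..<c}" "inj_on (delete_block a c v) {..<N - c}" "a + c \<le> N"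
  shows "eventually (\<lambda>k. inj_on (push {a..<a + c} k v) {..<N}) sequentially"
proof -
  have "inj_on v {a..<a + c}"
  proof (rule inj_onI)
    fix x y assume xy: "x \<in> {a..<a + c}" "y \<in> {a..<a + c}" "v x = v y"
    then have "x - a = y - a" by (intro inj_onD[OF assms(1)]) auto
    then show "x = y" using xy by auto
  qed
  moreover have "inj_on v ({..<N} - {a..<a + c})"
  proof (rule inj_onI)
    fix x y assume xy: "x \<in> {..<N} - {a..<a + c}" "y \<in> {..<N} - {a..<a + c}" "v x = v y"
    let ?p = "\<lambda>x. if x < a then x else x - c"
    have "?p x = ?p y"
      using xy assms(3) by (intro inj_onD[OF assms(2)]) (auto simp: delete_block_def)
    then show "x = y" using xy by (auto split: if_splits)
  qed
  ultimately have "eventually (\<lambda>k. inj_on (push {a..<a + c} k v)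
      ({a..<a + c} \<union> ({..<N} - {a..<a + c}))) sequentially"
    by (rule eventually_inj_on_push) auto
  moreover have "{a..<a + c} \<union> ({..<N} - {a..<a + c}) = {..<N}" using assms(3) by auto
  ultimately show ?thesis by simp
qed

text \<open>The coefficient of \<open>frac b \<sqdot> frac s\<close> in the residue of \<open>frac t\<close> at the block of \<open>leaves b\<close> points that
starts at \<open>a\<close>. For fixed \<open>b\<close> this is the matrix of a linear map from functions of \<open>leaves t\<close> points to
functions of \<open>leaves t - leaves b\<close> points.\<close>

definition residue_coeff :: "nat \<Rightarrow> unit btree \<Rightarrow> unit btree \<Rightarrow> unit btree \<Rightarrow> rat" where
  "residue_coeff a b s t = (case split_block a (leaves b) t of None \<Rightarrow> 0
     | Some (e, b', s') \<Rightarrow> if b' = b \<and> s' = s then e else 0)"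

lemma block_residue_expansion:
  assumes "t \<in> trees N" "0 < c" "c < N"
  shows "block_residue a c t v = (\<Sum>b\<in>trees c. \<Sum>s\<in>trees (N - c).
    residue_coeff a b s t * frac b (\<lambda>j. v (j + a)) * frac s (delete_block a c v))"
proof (cases "split_block a c t")
  case None
  then have "residue_coeff a b s t = 0" if "b \<in> trees c" for b s
    using that by (simp add: residue_coeff_def trees_def)
  then show ?thesis using None by (simp add: block_residue_def)
next
  case (Some x)
  then obtain e b' s' where x: "split_block a c t = Some (e, b', s')" by (cases x) auto
  have mem: "b' \<in> trees c" "s' \<in> trees (N - c)"
    using split_block_leaves[OF x] assms(1) by (auto simp: trees_def)
  have "(\<Sum>b\<in>trees c. \<Sum>s\<in>trees (N - c).
      residue_coeff a b s t * frac b (\<lambda>j. v (j + a)) * frac s (delete_block a c v))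
    = (\<Sum>b\<in>trees c. \<Sum>s\<in>trees (N - c). if s' = s then if b' = b then
      e * frac b (\<lambda>j. v (j + a)) * frac s (delete_block a c v) else 0 else 0)"
    by (intro sum.cong refl) (use x in \<open>simp add: residue_coeff_def trees_def\<close>)
  also have "\<dots> = e * frac b' (\<lambda>j. v (j + a)) * frac s' (delete_block a c v)"
    using mem by (simp add: sum.delta)
  finally show ?thesis using x by (simp add: block_residue_def)
qed

text \<open>Residues at a final block are coordinates: they read off the coefficients of the trees with
right subtree \<open>b\<close> at the root.\<close>

lemma residue_coeff_right_end:
  assumes "s \<in> trees (N - c)" "b \<in> trees c" "0 < c" "c < N" "t \<in> trees N"
  shows "residue_coeff (N - c) b s t = (if t = Node () s b then 1 else 0)"
proof (cases t)
  case Leaf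
  then show ?thesis by (simp add: residue_coeff_def)
next
  case (Node g l r)
  then show ?thesis using assms by (auto simp: residue_coeff_def trees_def)
qed

lemma residue_coeff_left_end:
  assumes "s \<in> trees (N - c)" "b \<in> trees c" "0 < c" "c < N"
  shows "residue_coeff 0 b s t = (if t = Node () b s then -1 else 0)"
  using assms by (cases t) (auto simp: residue_coeff_def trees_def)

text \<open>If the right subtree of \<open>t\<close> has \<open>c\<close> leaves, then the residue at the last \<open>c\<close> points keeps exactly the
trees that branch at the root in the same way, and the relation splits into relations between
smaller trees.\<close>

lemma frac_independent:
  assumes "\<And>v. inj_on v {..<N} \<Longrightarrow> (\<Sum>t\<in>trees N. \<alpha> t * frac t v) = 0" "t \<in> trees N"
  shows "\<alpha> t = 0"
  using assms
proof (induction N arbitrary: \<alpha> t rule: less_induct)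
  case (less N)
  show ?case
  proof (cases t)
    case Leaf
    then have "N = Suc 0" using less.prems(2) by (simp add: trees_def)
    then show ?thesis using less.prems(1)[of of_nat] Leaf by (simp add: trees_1 inj_on_def)
  next
    case (Node g l0 r0)
    define c where "c = leaves r0"
    have c: "0 < c" "c < N" "l0 \<in> trees (N - c)" "r0 \<in> trees c"
      using Node less.prems(2) leaves_pos[of l0] leaves_pos[of r0]
      by (auto simp: c_def trees_def Suc_le_eq simp del: leaves_pos)
    let ?a = "N - c"
    have zero: "(\<Sum>b\<in>trees c. (\<Sum>s\<in>trees (N - c). \<alpha> (Node () s b) * frac s q) * frac b p) = 0"
      if p: "inj_on p {..<c}" and q: "inj_on q {..<N - c}" for p q
    proof -
      define v where "v j = (if j < ?a then q j else p (j - ?a))" for j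
      have v: "(\<lambda>j. v (j + ?a)) = p" "\<And>j. j < N - c \<Longrightarrow> delete_block ?a c v j = q j"
        by (auto simp: v_def delete_block_def)
      have "eventually (\<lambda>k. inj_on (push {?a..<?a + c} k v) {..<N}) sequentially"
      proof (rule eventually_inj_on_push_block)
        show "inj_on (delete_block ?a c v) {..<N - c}" using q v(2) by (simp add: inj_on_def)
      qed (use p v(1) c in auto)
      then have "eventually (\<lambda>k. (\<Sum>t\<in>trees N. \<alpha> t * (of_nat k * frac t (push {?a..<?a + c} k v))) = 0) sequentially"
      proof (rule eventually_mono)
        fix k assume "inj_on (push {?a..<?a + c} k v) {..<N}"
        then have "of_nat k * (\<Sum>t\<in>trees N. \<alpha> t * frac t (push {?a..<?a + c} k v)) = 0"
          using less.prems(1) by simp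
        then show "(\<Sum>t\<in>trees N. \<alpha> t * (of_nat k * frac t (push {?a..<?a + c} k v))) = 0"
          by (simp only: sum_distrib_left mult.left_commute)
      qed
      then have "rat_limit (\<lambda>k. \<Sum>t\<in>trees N. \<alpha> t * (of_nat k * frac t (push {?a..<?a + c} k v))) 0"
        by (rule rat_limit_cong[THEN iffD2, OF _ rat_limit_const])
      moreover have "rat_limit (\<lambda>k. \<Sum>t\<in>trees N. \<alpha> t * (of_nat k * frac t (push {?a..<?a + c} k v)))
          (\<Sum>t\<in>trees N. \<alpha> t * block_residue ?a c t v)"
        by (intro rat_limit_sum rat_limit_mult[OF rat_limit_const] frac_push_block_residue)
          (use c in \<open>auto simp: trees_def\<close>)
      ultimately have "0 = (\<Sum>t\<in>trees N. \<alpha> t * block_residue ?a c t v)"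
        by (rule rat_limit_unique)
      also have "\<dots> = (\<Sum>t\<in>trees N. \<Sum>b\<in>trees c. \<Sum>s\<in>trees (N - c).
          if t = Node () s b then \<alpha> t * (frac b p * frac s q) else 0)"
      proof (intro sum.cong refl)
        fix t assume t: "t \<in> trees N"
        have "\<alpha> t * block_residue ?a c t v = (\<Sum>b\<in>trees c. \<Sum>s\<in>trees (N - c).
          \<alpha> t * (residue_coeff ?a b s t * frac b p * frac s (delete_block ?a c v)))"
          unfolding block_residue_expansion[OF t c(1,2)] v(1) by (simp add: sum_distrib_left)
        also have "\<dots> = (\<Sum>b\<in>trees c. \<Sum>s\<in>trees (N - c).
          if t = Node () s b then \<alpha> t * (frac b p * frac s q) else 0)"
        proof (intro sum.cong refl)
          fix b s assume "b \<in> trees c" "s \<in> trees (N - c)"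
          moreover from this(2) have "frac s (delete_block ?a c v) = frac s q"
            by (intro frac_cong v(2)) (simp add: trees_def)
          ultimately show "\<alpha> t * (residue_coeff ?a b s t * frac b p * frac s (delete_block ?a c v))
            = (if t = Node () s b then \<alpha> t * (frac b p * frac s q) else 0)"
            using residue_coeff_right_end[of s N c b t] c t by simp
        qed
        finally show "\<alpha> t * block_residue ?a c t v = (\<Sum>b\<in>trees c. \<Sum>s\<in>trees (N - c).
          if t = Node () s b then \<alpha> t * (frac b p * frac s q) else 0)" .
      qed
      also have "\<dots> = (\<Sum>b\<in>trees c. \<Sum>s\<in>trees (N - c). \<Sum>t\<in>trees N.
          if t = Node () s b then \<alpha> t * (frac b p * frac s q) else 0)"
        by (rule trans[OF sum.swap], rule sum.cong[OF refl], rule sum.swap)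
      also have "\<dots> = (\<Sum>b\<in>trees c. \<Sum>s\<in>trees (N - c). \<alpha> (Node () s b) * (frac b p * frac s q))"
      proof (intro sum.cong refl)
        fix b s assume "b \<in> trees c" "s \<in> trees (N - c)"
        then have "Node () s b \<in> trees N" using c by (simp add: trees_def)
        then show "(\<Sum>t\<in>trees N. if t = Node () s b then \<alpha> t * (frac b p * frac s q) else 0)
            = \<alpha> (Node () s b) * (frac b p * frac s q)" by simp
      qed
      finally show ?thesis by (simp add: sum_distrib_left sum_distrib_right mult_ac)
    qed
    have "(\<Sum>s\<in>trees (N - c). \<alpha> (Node () s r0) * frac s q) = 0" if q: "inj_on q {..<N - c}" for q
      by (rule less.IH[of c "\<lambda>b. \<Sum>s\<in>trees (N - c). \<alpha> (Node () s b) * frac s q"])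
        (use c zero q in auto)
    then have "\<alpha> (Node () l0 r0) = 0"
      by (intro less.IH[of "N - c" "\<lambda>s. \<alpha> (Node () s r0)"]) (use c in auto)
    then show ?thesis using Node by simp
  qed
qed

lemma frac_coefficients_unique:
  assumes "\<And>v. inj_on v {..<N} \<Longrightarrow> (\<Sum>t\<in>trees N. \<alpha> t * frac t v) = (\<Sum>t\<in>trees N. \<beta> t * frac t v)"
    and "t \<in> trees N"
  shows "\<alpha> t = \<beta> t"
  using frac_independent[of N "\<lambda>t. \<alpha> t - \<beta> t" t] assms
  by (simp add: left_diff_distrib sum_subtractf)

section \<open>The dendriform operad as an operad of rational functions\<close>

text \<open>The image of a tree of generators in the operad of rational functions: \<open>x \<prec> y\<close> and \<open>x \<succ> y\<close> are the
product of the functions \<open>x\<close> of \<open>v\<^sub>0, \<dots>, v\<^sub>a\<close> and \<open>y\<close> of \<open>v\<^sub>a, \<dots>, v\<^sub>n\<close>, weighted by \<open>(v\<^sub>a - v\<^sub>0) / (v\<^sub>n - v\<^sub>0)\<close>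
and \<open>(v\<^sub>n - v\<^sub>a) / (v\<^sub>n - v\<^sub>0)\<close>. The sum of the two weights is \<open>1\<close>, which is why the dendriform
relations hold.\<close>

fun mould :: "dend_gen btree \<Rightarrow> (nat \<Rightarrow> rat) \<Rightarrow> rat" where
  "mould Leaf v = 1 / (v 1 - v 0)"
| "mould (Node g l r) v = mould l v * mould r (\<lambda>j. v (j + leaves l))
     * (case g of Prec \<Rightarrow> v (leaves l) - v 0 | Succ \<Rightarrow> v (leaves l + leaves r) - v (leaves l))
     / (v (leaves l + leaves r) - v 0)"

lemma mould_cong: "(\<And>j. j \<le> leaves t \<Longrightarrow> v j = w j) \<Longrightarrow> mould t v = mould t w"
proof (induction t arbitrary: v w)
  case (Node g l r)
  have "mould l v = mould l w" by (rule Node.IH) (use Node.prems in auto)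
  moreover have "mould r (\<lambda>j. v (j + leaves l)) = mould r (\<lambda>j. w (j + leaves l))"
    by (rule Node.IH) (use Node.prems in auto)
  ultimately show ?case using Node.prems[of 0] Node.prems[of "leaves l"]
      Node.prems[of "leaves l + leaves r"] by (simp split: dend_gen.split)
qed simp

text \<open>Composition at the input \<open>i\<close> inserts a function into the interval between the points \<open>i - 1\<close> and \<open>i\<close>; the
length of the interval compensates for the factor \<open>1 / (v\<^sub>1 - v\<^sub>0)\<close> of the unit.\<close>

lemma mould_graft:
  assumes "1 \<le> i" "i \<le> leaves t" "inj_on v {..leaves t + leaves s - 1}"
  shows "mould (graft i t s) v = mould t (delete_block i (leaves s - 1) v)
    * (v (i + leaves s - 1) - v (i - 1)) * mould s (\<lambda>j. v (j + (i - 1)))"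
  using assms
proof (induction t arbitrary: i v)
  case Leaf
  have "0 < leaves s" by (simp add: Suc_le_eq[symmetric])
  moreover have "i = 1" using Leaf.prems by simp
  moreover have "v (leaves s) \<noteq> v 0"
    using inj_onD[OF Leaf.prems(3), of "leaves s" 0] \<open>0 < leaves s\<close> by auto
  ultimately show ?case by (simp add: delete_block_def)
next
  case (Node g l r)
  let ?n = "leaves s" and ?l = "leaves l" and ?r = "leaves r"
  have n: "0 < ?n" "0 < ?l" "0 < ?r" by (simp_all add: Suc_le_eq[symmetric])
  let ?w = "delete_block i (?n - 1) v"
  have w0: "?w 0 = v 0" "?w (?l + ?r) = v (?l + ?r + ?n - 1)"
    using Node.prems n by (auto simp: delete_block_def)
  show ?case
  proof (cases "i \<le> ?l")
    case True
    have "mould (graft i l s) v = mould l ?w * (v (i + ?n - 1) - v (i - 1)) * mould s (\<lambda>j. v (j + (i - 1)))"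
      by (rule Node.IH(1)[OF Node.prems(1) True], rule inj_on_subset[OF Node.prems(3)]) auto
    moreover have "leaves (graft i l s) = ?l + ?n - 1" using True Node.prems by (simp add: leaves_graft)
    moreover have "(\<lambda>j. v (j + (?l + ?n - 1))) = (\<lambda>j. ?w (j + ?l))"
      using True n by (auto simp: delete_block_def fun_eq_iff algebra_simps)
    moreover have "?w ?l = v (?l + ?n - 1)" using True n by (simp add: delete_block_def)
    moreover have "?l + ?n - 1 + ?r = ?l + ?r + ?n - 1" using n by simp
    ultimately show ?thesis using True w0 by (simp split: dend_gen.split)
  next
    case False
    let ?k = "i - ?l" and ?v = "\<lambda>j. v (j + ?l)"
    have k: "1 \<le> ?k" "?k \<le> ?r" using False Node.prems by auto
    have inj: "inj_on ?v {..?r + ?n - 1}"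
    proof (rule inj_onI)
      fix x y assume "x \<in> {..?r + ?n - 1}" "y \<in> {..?r + ?n - 1}" "?v x = ?v y"
      then have "x + ?l = y + ?l" using n by (intro inj_onD[OF Node.prems(3)]) auto
      then show "x = y" by simp
    qed
    have "mould (graft ?k r s) ?v = mould r (delete_block ?k (?n - 1) ?v)
        * (?v (?k + ?n - 1) - ?v (?k - 1)) * mould s (\<lambda>j. ?v (j + (?k - 1)))"
      by (rule Node.IH(2)[OF k inj])
    moreover have "delete_block ?k (?n - 1) ?v = (\<lambda>j. ?w (j + ?l))"
      using False n
      by (intro ext) (auto simp: delete_block_def add_ac less_diff_conv intro!: arg_cong[of _ _ v])
    moreover have "?k + ?n - 1 + ?l = i + ?n - 1" "?k - 1 + ?l = i - 1" using False n by auto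
    moreover from this(2) have "(\<lambda>j. ?v (j + (?k - 1))) = (\<lambda>j. v (j + (i - 1)))"
      by (simp add: add.assoc)
    moreover have "mould l ?w = mould l v"
      by (rule mould_cong) (use False in \<open>auto simp: delete_block_def\<close>)
    moreover have "leaves (graft ?k r s) = ?r + ?n - 1" using k by (simp add: leaves_graft)
    moreover have "?w ?l = v ?l" using False by (simp add: delete_block_def)
    moreover have "?l + (?r + ?n - 1) = ?l + ?r + ?n - 1" using n by simp
    ultimately show ?thesis using False w0 by (simp split: dend_gen.split)
  qed
qed

text \<open>An element of the free operad may have components of several arities; only the component of
arity \<open>n\<close> is evaluated, on the points \<open>v 0, \<dots>, v n\<close>.\<close>

definition mould_eval :: "nat \<Rightarrow> (nat \<Rightarrow> rat) \<Rightarrow> (dend_gen btree \<Rightarrow>\<^sub>0 rat) \<Rightarrow> rat" where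
  "mould_eval n v = lin_ext (\<lambda>t. if leaves t = n then mould t v else 0)"

lemma mould_eval_linear:
  "mould_eval n v (x + y) = mould_eval n v x + mould_eval n v y"
  "mould_eval n v (c *\<^sub>Q x) = c * mould_eval n v x"
  "mould_eval n v 0 = 0"
  "mould_eval n v (tree_elem t) = (if leaves t = n then mould t v else 0)"
  by (simp_all add: mould_eval_def lin_ext_add lin_ext_scale lin_ext_zero lin_ext_tree_elem)

lemma mould_eval_diff: "mould_eval n v (x - y) = mould_eval n v x - mould_eval n v y"
  using mould_eval_linear(1)[of n v "x - y" y] by simp

lemma mould_eval_comp_tree_right:
  assumes "1 \<le> i" "leaves s + i \<le> N + 1" "inj_on v {..N}"
  shows "mould_eval N v (free_comp i x (tree_elem s)) =
    mould_eval (N + 1 - leaves s) (delete_block i (leaves s - 1) v) x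
      * (v (i + leaves s - 1) - v (i - 1)) * mould s (\<lambda>j. v (j + (i - 1)))"
  using subset_UNIV[of "Poly_Mapping.keys x"]
proof (induction x rule: free_induct)
  case (elem c t)
  have s: "0 < leaves s" by (simp add: Suc_le_eq[symmetric])
  show ?case
  proof (cases "leaves t = N + 1 - leaves s")
    case True
    then have "i \<le> leaves t" "leaves t + leaves s - 1 = N" using assms s by auto
    then show ?thesis using mould_graft[of i t v s] assms True
      by (simp add: free_comp_scale_left free_comp_tree_elem mould_eval_linear leaves_graft)
  next
    case False
    then have "leaves t + leaves s - 1 \<noteq> N" using s by auto
    with False assms(1) show ?thesis
      by (simp add: free_comp_scale_left free_comp_tree_elem mould_eval_linear leaves_graft)
  qed
qed (simp_all add: free_comp_add_left mould_eval_linear distrib_right)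

lemma mould_eval_comp_tree_left:
  assumes "1 \<le> i" "i \<le> leaves t" "inj_on v {..N}"
  shows "mould_eval N v (free_comp i (tree_elem t) y) =
    mould t (delete_block i (N - leaves t) v) * (v (i + (N - leaves t)) - v (i - 1))
      * mould_eval (N + 1 - leaves t) (\<lambda>j. v (j + (i - 1))) y"
  using subset_UNIV[of "Poly_Mapping.keys y"]
proof (induction y rule: free_induct)
  case (elem c s)
  have s: "0 < leaves s" by (simp add: Suc_le_eq[symmetric])
  show ?case
  proof (cases "leaves s = N + 1 - leaves t")
    case True
    then have "leaves t + leaves s - 1 = N" "leaves s - 1 = N - leaves t"
      "i + leaves s - 1 = i + (N - leaves t)" using assms s by auto
    then show ?thesis using mould_graft[of i t v s] assms True
      by (simp add: free_comp_scale_right free_comp_tree_elem mould_eval_linear leaves_graft)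
  next
    case False
    then have "leaves t + leaves s - 1 \<noteq> N" using s by auto
    with False assms show ?thesis
      by (simp add: free_comp_scale_right free_comp_tree_elem mould_eval_linear leaves_graft)
  qed
qed (simp_all add: free_comp_add_right mould_eval_linear distrib_left)

lemma inj_on_delete_block: "inj_on v {..m + c} \<Longrightarrow> inj_on (delete_block a c v) {..m}"
proof (rule inj_onI)
  fix x y assume inj: "inj_on v {..m + c}" and xy: "x \<in> {..m}" "y \<in> {..m}"
    "delete_block a c v x = delete_block a c v y"
  let ?p = "\<lambda>x. if x < a then x else x + c"
  have "?p x = ?p y" using xy by (intro inj_onD[OF inj]) (auto simp: delete_block_def)
  then show "x = y" by (auto split: if_splits)
qed

lemma inj_on_shift: "inj_on v {..m + c} \<Longrightarrow> inj_on (\<lambda>j. v (j + c)) {..(m::nat)}"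
proof (rule inj_onI)
  fix x y assume inj: "inj_on v {..m + c}" and xy: "x \<in> {..m}" "y \<in> {..m}" "v (x + c) = v (y + c)"
  have "x + c = y + c" using xy by (intro inj_onD[OF inj]) auto
  then show "x = y" by simp
qed

lemma mould_eval_dend_rel:
  assumes "x \<in> dend_rel" "inj_on v {..n}"
  shows "mould_eval n v x = 0"
proof (cases "n = 3")
  case True
  have "v i \<noteq> v j" if "i \<noteq> j" "i \<le> 3" "j \<le> 3" for i j
    using inj_onD[OF assms(2), of i j] that True by auto
  from this[of 0 1] this[of 0 2] this[of 0 3] this[of 1 2] this[of 1 3] this[of 2 3]
  have ne: "v 1 - v 0 \<noteq> 0" "v 2 - v 0 \<noteq> 0" "v 3 - v 0 \<noteq> 0" "v 2 - v 1 \<noteq> 0"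
    "v 3 - v 1 \<noteq> 0" "v 3 - v 2 \<noteq> 0" by auto
  note [simp] = numeral_2_eq_2[symmetric] numeral_3_eq_3[symmetric]
  from assms(1) consider
    "x = tree_elem (Node Prec (Node Prec Leaf Leaf) Leaf)
       - (tree_elem (Node Prec Leaf (Node Prec Leaf Leaf)) + tree_elem (Node Prec Leaf (Node Succ Leaf Leaf)))"
    | "x = tree_elem (Node Succ Leaf (Node Prec Leaf Leaf)) - tree_elem (Node Prec (Node Succ Leaf Leaf) Leaf)"
    | "x = tree_elem (Node Succ Leaf (Node Succ Leaf Leaf))
       - (tree_elem (Node Succ (Node Succ Leaf Leaf) Leaf) + tree_elem (Node Succ (Node Prec Leaf Leaf) Leaf))"
    unfolding dend_rel_def by blast
  then show ?thesis
  proof cases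
    case 1
    show ?thesis unfolding 1 mould_eval_linear mould_eval_diff using True ne
      by (simp add: divide_simps)
  next
    case 2
    show ?thesis unfolding 2 mould_eval_linear mould_eval_diff using True ne
      by (simp add: divide_simps)
  next
    case 3
    show ?thesis unfolding 3 mould_eval_linear mould_eval_diff using True ne
      by (simp add: divide_simps)
  qed
next
  case False
  then show ?thesis using assms(1)
    by (auto simp: dend_rel_def mould_eval_linear mould_eval_diff)
qed

lemma mould_eval_comp_out_of_range:
  assumes "\<not> (1 \<le> i \<and> leaves s + i \<le> N + 1)"
  shows "mould_eval N v (free_comp i x (tree_elem s)) = 0"
  using subset_UNIV[of "Poly_Mapping.keys x"]
proof (induction x rule: free_induct)
  case (elem c t)
  then show ?case using assms
    by (auto simp: free_comp_scale_left free_comp_tree_elem mould_eval_linear leaves_graft)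
qed (simp_all add: free_comp_add_left mould_eval_linear)

text \<open>By the preceding formulas, composition with a tree only multiplies the value and changes the points.
They remain distinct, so the vanishing of the relations is inherited by the whole ideal.\<close>

lemma mould_eval_ideal:
  assumes "x \<in> operad_ideal dend_rel" "inj_on v {..n}"
  shows "mould_eval n v x = 0"
  using assms
proof (induction arbitrary: n v rule: operad_ideal.induct)
  case (gen x)
  then show ?case by (rule mould_eval_dend_rel)
next
  case (comp_left x i y)
  show ?case using subset_UNIV[of "Poly_Mapping.keys y"]
  proof (induction y rule: free_induct)
    case (elem c s)
    have "mould_eval n v (free_comp i x (tree_elem s)) = 0"
    proof (cases "1 \<le> i \<and> leaves s + i \<le> n + 1")
      case True
      have "inj_on (delete_block i (leaves s - 1) v) {..n + 1 - leaves s}"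
      proof (rule inj_on_delete_block)
        have "n + 1 - leaves s + (leaves s - 1) = n" using True leaves_pos[of s] by linarith
        then show "inj_on v {..n + 1 - leaves s + (leaves s - 1)}" using comp_left.prems by simp
      qed
      then show ?thesis using True mould_eval_comp_tree_right[of i s n v x] comp_left by simp
    qed (rule mould_eval_comp_out_of_range)
    then show ?case by (simp add: free_comp_scale_right mould_eval_linear)
  qed (simp_all add: free_comp_add_right mould_eval_linear)
next
  case (comp_right y i x)
  show ?case using subset_UNIV[of "Poly_Mapping.keys x"]
  proof (induction x rule: free_induct)
    case (elem c t)
    have "mould_eval n v (free_comp i (tree_elem t) y) = 0"
    proof (cases "1 \<le> i \<and> i \<le> leaves t")
      case True
      have "mould_eval (n + 1 - leaves t) (\<lambda>j. v (j + (i - 1))) y = 0"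
      proof (cases "leaves t \<le> n")
        case le: True
        then show ?thesis using comp_right.prems True
          by (intro comp_right.IH inj_on_shift) (auto intro: inj_on_subset)
      next
        case False
        then have "n + 1 - leaves t = 0" by simp
        moreover have "mould_eval 0 w y = 0" for w using subset_UNIV[of "Poly_Mapping.keys y"]
          by (induction y rule: free_induct) (simp_all add: mould_eval_linear)
        ultimately show ?thesis by simp
      qed
      then show ?thesis using True mould_eval_comp_tree_left[of i t v n y] comp_right.prems by simp
    next
      case False
      have "free_comp i (tree_elem t) y = 0" using subset_UNIV[of "Poly_Mapping.keys y"]
        by (induction y rule: free_induct)
          (use False in \<open>auto simp: free_comp_linear free_comp_tree_elem\<close>)
      then show ?thesis by (simp add: mould_eval_linear)
    qed
    then show ?case by (simp add: free_comp_scale_left mould_eval_linear)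
  qed (simp_all add: free_comp_add_left mould_eval_linear)
qed (simp_all add: mould_eval_linear)

definition dend_mould :: "nat \<Rightarrow> (nat \<Rightarrow> rat) \<Rightarrow> dend \<Rightarrow> rat" where
  "dend_mould n v x = mould_eval n v (rep_dend x)"

lemma abs_rep_dend: "abs_dend (rep_dend x) = x"
  by (rule Quotient_abs_rep[OF Quotient_dend])

lemma dend_mould_abs: "inj_on v {..n} \<Longrightarrow> dend_mould n v (abs_dend x) = mould_eval n v x"
proof -
  assume v: "inj_on v {..n}"
  have "rep_dend (abs_dend x) - x \<in> operad_ideal dend_rel"
    using abs_rep_dend[of "abs_dend x"] by (simp add: dend.abs_eq_iff)
  from mould_eval_ideal[OF this v] show ?thesis by (simp add: dend_mould_def mould_eval_diff)
qed

lemma dend_mould_linear: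
  assumes "inj_on v {..n}"
  shows "dend_mould n v (x + y) = dend_mould n v x + dend_mould n v y"
    "dend_mould n v (c *\<^sub>Q x) = c * dend_mould n v x" "dend_mould n v (- x) = - dend_mould n v x"
    "dend_mould n v 0 = 0"
proof -
  have add: "dend_mould n v (x + y) = dend_mould n v x + dend_mould n v y" for x y
    using dend_mould_abs[OF assms, of "rep_dend x + rep_dend y"]
    by (simp add: plus_dend.abs_eq[symmetric] abs_rep_dend mould_eval_linear dend_mould_def)
  then show "dend_mould n v (x + y) = dend_mould n v x + dend_mould n v y" .
  show scale: "dend_mould n v (c *\<^sub>Q x) = c * dend_mould n v x"
    using dend_mould_abs[OF assms, of "c *\<^sub>Q rep_dend x"]
    by (simp add: scaleQ_dend.abs_eq[symmetric] abs_rep_dend mould_eval_linear dend_mould_def)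
  show zero: "dend_mould n v 0 = 0" using add[of 0 0] by simp
  show "dend_mould n v (- x) = - dend_mould n v x" using add[of x "- x"] zero by simp
qed

lemma dend_mould_sum:
  assumes "inj_on v {..n}"
  shows "dend_mould n v (\<Sum>i\<in>I. c i *\<^sub>Q x i) = (\<Sum>i\<in>I. c i * dend_mould n v (x i))"
  by (induction I rule: infinite_finite_induct) (simp_all add: dend_mould_linear[OF assms])

lemma dend_mould_comp:
  assumes f: "f \<in> Dend m" and g: "g \<in> Dend n" and i: "1 \<le> i" "i \<le> m" "1 \<le> n"
    and N: "N = m + n - 1" and v: "inj_on v {..N}"
  shows "dend_mould N v (dend_comp i f g) = dend_mould m (delete_block i (n - 1) v) f
    * (v (i + n - 1) - v (i - 1)) * dend_mould n (\<lambda>j. v (j + (i - 1))) g"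
proof -
  obtain x y where x: "f = abs_dend x" "x \<in> free_component m" and y: "g = abs_dend y" "y \<in> free_component n"
    using f g by (auto simp: Dend_def)
  have vm: "inj_on (delete_block i (n - 1) v) {..m}"
    using v i N by (intro inj_on_delete_block) simp
  have vn: "inj_on (\<lambda>j. v (j + (i - 1))) {..n}"
    using i N by (intro inj_on_shift inj_on_subset[OF v]) auto
  have "mould_eval N v (free_comp i x y) = mould_eval m (delete_block i (n - 1) v) x
    * (v (i + n - 1) - v (i - 1)) * mould_eval n (\<lambda>j. v (j + (i - 1))) y"
    using y(2)
  proof (induction rule: free_component_induct)
    case (elem c s)
    then show ?case using mould_eval_comp_tree_right[OF i(1) _ v, of s x] i N
      by (simp add: free_comp_scale_right mould_eval_linear)
  qed (simp_all add: free_comp_add_right mould_eval_linear distrib_left)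
  then show ?thesis unfolding x(1) y(1) dend_comp.abs_eq
    by (simp only: dend_mould_abs[OF v] dend_mould_abs[OF vm] dend_mould_abs[OF vn])
qed

abbreviation dend_tree :: "dend_gen btree \<Rightarrow> dend" where
  "dend_tree t \<equiv> abs_dend (tree_elem t)"

text \<open>The product of \<open>x\<close> and \<open>y\<close> by the generator \<open>g\<close>, namely \<open>x \<prec> y\<close> or \<open>x \<succ> y\<close>.\<close>

definition dend_op :: "dend_gen \<Rightarrow> dend \<Rightarrow> dend \<Rightarrow> dend" where
  "dend_op g x y = dend_comp 1 (dend_comp 2 (dend_tree (Node g Leaf Leaf)) y) x"

lemma dend_op_tree: "dend_op g (dend_tree l) (dend_tree r) = dend_tree (Node g l r)"
  by (simp add: dend_op_def dend_comp.abs_eq free_comp_tree_elem)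

lemma dend_comp_linear:
  "dend_comp i (x + x') y = dend_comp i x y + dend_comp i x' y"
  "dend_comp i x (y + y') = dend_comp i x y + dend_comp i x y'"
  "dend_comp i (c *\<^sub>Q x) y = c *\<^sub>Q dend_comp i x y"
  "dend_comp i x (c *\<^sub>Q y) = c *\<^sub>Q dend_comp i x y"
  using abs_rep_dend[of x] abs_rep_dend[of x'] abs_rep_dend[of y] abs_rep_dend[of y']
  by (metis dend_comp.abs_eq plus_dend.abs_eq scaleQ_dend.abs_eq free_comp_linear)+

lemma dend_op_linear:
  "dend_op g (x + x') y = dend_op g x y + dend_op g x' y"
  "dend_op g x (y + y') = dend_op g x y + dend_op g x y'"
  "dend_op g (c *\<^sub>Q x) y = c *\<^sub>Q dend_op g x y"
  "dend_op g x (c *\<^sub>Q y) = c *\<^sub>Q dend_op g x y"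
  by (simp_all add: dend_op_def dend_comp_linear)

lemma dendriform_relations:
  "dend_tree (Node Prec (Node Prec a b) c)
    = dend_tree (Node Prec a (Node Prec b c)) + dend_tree (Node Prec a (Node Succ b c))"
  "dend_tree (Node Prec (Node Succ a b) c) = dend_tree (Node Succ a (Node Prec b c))"
  "dend_tree (Node Succ a (Node Succ b c))
    = dend_tree (Node Succ (Node Succ a b) c) + dend_tree (Node Succ (Node Prec a b) c)"
proof -
  \<comment> \<open>The inputs are filled from the right, so that their numbers do not change.\<close>
  let ?subst = "\<lambda>x. free_comp 1 (free_comp 2 (free_comp 3 x (tree_elem c)) (tree_elem b)) (tree_elem a)"
  have ideal: "?subst x \<in> operad_ideal dend_rel" if "x \<in> dend_rel" for x
    using that by (intro operad_ideal.comp_left operad_ideal.gen)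
  note simps = free_comp_diff_left free_comp_add_left free_comp_tree_elem
  have "?subst (tree_elem (Node Prec (Node Prec Leaf Leaf) Leaf)
       - (tree_elem (Node Prec Leaf (Node Prec Leaf Leaf))
          + tree_elem (Node Prec Leaf (Node Succ Leaf Leaf)))) \<in> operad_ideal dend_rel"
    by (rule ideal) (simp add: dend_rel_def)
  then show "dend_tree (Node Prec (Node Prec a b) c)
    = dend_tree (Node Prec a (Node Prec b c)) + dend_tree (Node Prec a (Node Succ b c))"
    by (simp add: simps plus_dend.abs_eq dend.abs_eq_iff)
  have "?subst (tree_elem (Node Succ Leaf (Node Prec Leaf Leaf))
       - tree_elem (Node Prec (Node Succ Leaf Leaf) Leaf)) \<in> operad_ideal dend_rel"
    by (rule ideal) (simp add: dend_rel_def)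
  then have "dend_tree (Node Succ a (Node Prec b c)) = dend_tree (Node Prec (Node Succ a b) c)"
    by (simp add: simps dend.abs_eq_iff)
  then show "dend_tree (Node Prec (Node Succ a b) c) = dend_tree (Node Succ a (Node Prec b c))" ..
  have "?subst (tree_elem (Node Succ Leaf (Node Succ Leaf Leaf))
       - (tree_elem (Node Succ (Node Succ Leaf Leaf) Leaf)
          + tree_elem (Node Succ (Node Prec Leaf Leaf) Leaf))) \<in> operad_ideal dend_rel"
    by (rule ideal) (simp add: dend_rel_def)
  then show "dend_tree (Node Succ a (Node Succ b c))
    = dend_tree (Node Succ (Node Succ a b) c) + dend_tree (Node Succ (Node Prec a b) c)"
    by (simp add: simps plus_dend.abs_eq dend.abs_eq_iff)
qed

text \<open>The unlabelled tree with subtrees \<open>l\<close> and \<open>r\<close> stands for \<open>l \<succ> (x \<prec> r)\<close>, where \<open>x\<close> is the unit and where a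
factor is omitted if it is a leaf. So a tree with \<open>n + 1\<close> leaves yields an element of arity \<open>n\<close>. The value at
a leaf is only a dummy.\<close>

fun normal_tree :: "unit btree \<Rightarrow> dend_gen btree" where
  "normal_tree Leaf = Leaf"
| "normal_tree (Node g l r) =
    (let m = (if r = Leaf then Leaf else Node Prec Leaf (normal_tree r))
     in if l = Leaf then m else Node Succ (normal_tree l) m)"

lemma leaves_eq_1: "leaves t = Suc 0 \<longleftrightarrow> t = Leaf"
  by (cases t) (auto simp: add_is_1)

lemma leaves_normal_tree: "t \<noteq> Leaf \<Longrightarrow> leaves (normal_tree t) = leaves t - 1"
proof (induction t)
  case (Node g l r)
  then show ?case using leaves_pos[of l] leaves_pos[of r]
    by (auto simp: Let_def simp del: leaves_pos)
qed simp

text \<open>The weights of the two products cancel all factors but the one of the root.\<close>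

lemma mould_normal_tree:
  assumes "t \<noteq> Leaf" "inj_on v {..<leaves t}"
  shows "mould (normal_tree t) v = frac t v"
  using assms
proof (induction t arbitrary: v)
  case (Node g l r)
  let ?a = "leaves l" and ?b = "leaves r" and ?v = "\<lambda>j. v (j + leaves l)"
  have pos: "0 < ?a" "0 < ?b" by (simp_all add: Suc_le_eq[symmetric])
  have ne: "v i \<noteq> v j" if "i \<noteq> j" "i < ?a + ?b" "j < ?a + ?b" for i j
    using inj_onD[OF Node.prems(2), of i j] that by auto
  have l: "mould (normal_tree l) v = frac l v" if "l \<noteq> Leaf"
    by (rule Node.IH(1)[OF that], rule inj_on_subset[OF Node.prems(2)]) auto
  have r: "mould (normal_tree r) ?v = frac r ?v" if "r \<noteq> Leaf"
  proof (rule Node.IH(2)[OF that], rule inj_onI)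
    fix x y assume "x \<in> {..<?b}" "y \<in> {..<?b}" "?v x = ?v y"
    then have "x + ?a = y + ?a" by (intro inj_onD[OF Node.prems(2)]) auto
    then show "x = y" by simp
  qed
  let ?m = "if r = Leaf then Leaf else Node Prec Leaf (normal_tree r)"
  have m_leaves: "leaves ?m = ?b" using leaves_normal_tree[of r] pos by auto
  have m: "mould ?m w = frac r (\<lambda>j. w (j + 1)) / (w ?b - w 0)"
    if "\<And>j. 0 < j \<Longrightarrow> w j = v (j - 1 + ?a)" "w 1 \<noteq> w 0" for w
  proof (cases "r = Leaf")
    case False
    have "(\<lambda>j. w (j + 1)) = ?v" using that(1) by auto
    moreover have "1 + (?b - 1) = ?b" using pos by simp
    ultimately show ?thesis
      using False r that(2) leaves_normal_tree[OF False] by (simp add: divide_simps)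
  qed simp
  show ?case
  proof (cases "l = Leaf")
    case True
    then show ?thesis using m[of v] ne[of 1 0] pos by (simp add: Let_def)
  next
    case False
    define w where "w j = v (j + (?a - 1))" for j
    have a: "leaves (normal_tree l) = ?a - 1" using leaves_normal_tree[OF False] .
    have a1: "?a - 1 + ?b = ?a + ?b - 1" using pos by simp
    have w: "w 0 = v (?a - 1)" "w 1 = v ?a" "w ?b = v (?a + ?b - 1)" "(\<lambda>j. w (j + 1)) = ?v"
      using pos a1 by (auto simp: w_def fun_eq_iff add.commute)
    have "mould ?m w = frac r ?v / (v (?a + ?b - 1) - v (?a - 1))"
      using m[of w] w ne[of ?a "?a - 1"] pos by (auto simp: w_def)
    moreover have "v (?a + ?b - 1) \<noteq> v (?a - 1)" using pos by (intro ne) auto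
    moreover have "mould (normal_tree (Node g l r)) v = mould (normal_tree l) v * mould ?m w
        * (v (?a - 1 + ?b) - v (?a - 1)) / (v (?a - 1 + ?b) - v 0)"
      using False a m_leaves by (simp add: Let_def w_def[abs_def])
    ultimately show ?thesis using l[OF False] unfolding a1 by (simp add: divide_simps)
  qed
qed simp

abbreviation dend_basis :: "unit btree \<Rightarrow> dend" where
  "dend_basis t \<equiv> dend_tree (normal_tree t)"

lemma span_closed_linear:
  assumes "x \<in> rat_vec.span (b ` I)" "\<And>i. i \<in> I \<Longrightarrow> f (b i) \<in> rat_vec.span J"
    and "\<And>x y. f (x + y) = f x + f y" "\<And>c x. f (c *\<^sub>Q x) = c *\<^sub>Q f x"
  shows "f x \<in> rat_vec.span J"
  using assms(1)
proof (induction rule: rat_vec.span_induct_alt)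
  case base
  then show ?case using assms(4)[of 0 0] by (simp add: rat_vec.span_zero)
next
  case (step c x y)
  then show ?case using assms(2) by (auto simp: assms(3,4) intro: rat_vec.span_add rat_vec.span_scale)
qed

abbreviation dend_span :: "nat \<Rightarrow> dend set" where
  "dend_span n \<equiv> rat_vec.span (dend_basis ` trees (n + 1))"

lemma dend_op_span:
  assumes "x \<in> dend_span p" "y \<in> dend_span q"
    and "\<And>s t. s \<in> trees (p + 1) \<Longrightarrow> t \<in> trees (q + 1) \<Longrightarrow> dend_op g (dend_basis s) (dend_basis t) \<in> rat_vec.span J"
  shows "dend_op g x y \<in> rat_vec.span J"
proof (rule span_closed_linear[OF assms(1)])
  fix s assume s: "s \<in> trees (p + 1)"
  show "dend_op g (dend_basis s) y \<in> rat_vec.span J"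
    by (rule span_closed_linear[OF assms(2)]) (use assms(3) s in \<open>auto simp: dend_op_linear\<close>)
qed (simp_all add: dend_op_linear)

text \<open>The dendriform relations rewrite products into normal form: \<open>(l \<succ> w) \<prec> t = l \<succ> (w \<prec> t)\<close> and
\<open>(x \<prec> r) \<prec> t = x \<prec> (r \<prec> t + r \<succ> t)\<close> for a product by \<open>\<prec>\<close>, and
\<open>s \<succ> (l \<succ> w) = (s \<succ> l + s \<prec> l) \<succ> w\<close> for a product by \<open>\<succ>\<close>. The products on the right hand sides that
are not yet in normal form have smaller total arity.\<close>

lemma dend_op_basis_in_span:
  assumes "1 \<le> p" "1 \<le> q" "s \<in> trees (p + 1)" "t \<in> trees (q + 1)"
  shows "dend_op g (dend_basis s) (dend_basis t) \<in> dend_span (p + q)"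
  using assms
proof (induction "p + q" arbitrary: p q s t g rule: less_induct)
  case less
  have IH: "dend_op g x y \<in> dend_span (p' + q')"
    if "p' + q' < p + q" "1 \<le> p'" "1 \<le> q'" "x \<in> dend_span p'" "y \<in> dend_span q'" for g p' q' x y
    by (rule dend_op_span[OF that(4,5)]) (rule less.hyps[OF that(1,2,3)])
  have in_span: "dend_basis u \<in> dend_span n" if "u \<in> trees (n + 1)" for u n
    using that by (intro rat_vec.span_base) auto
  have node: "Node () u w \<in> trees (a + b)" if "u \<in> trees a" "w \<in> trees b" for u w a b
    using that by (simp add: trees_def)
  show ?case
  proof (cases g)
    case Prec
    obtain l r where s: "s = Node () l r" using less.prems by (cases s) (auto simp: trees_def)
    define a where "a = leaves l"
    define b where "b = leaves r"
    have ab: "l \<in> trees a" "r \<in> trees b" "a + b = p + 1" "1 \<le> a" "1 \<le> b"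
      using less.prems s by (auto simp: a_def b_def trees_def)
    let ?A = "(\<lambda>u. dend_basis (Node () Leaf u)) ` trees (b + q)"
    let ?m = "dend_basis (Node () Leaf r)"
    \<comment> \<open>Products of \<open>x \<prec> r\<close> by \<open>\<prec>\<close> again have the form \<open>x \<prec> u\<close>; \<open>?A\<close> keeps track of this.\<close>
    have m: "dend_op Prec ?m (dend_basis t) \<in> rat_vec.span ?A"
    proof (cases "r = Leaf")
      case True
      have "t \<noteq> Leaf" using less.prems by (auto simp: trees_def)
      then have "dend_op Prec ?m (dend_basis t) = dend_basis (Node () Leaf t)"
        using True by (simp add: dend_op_tree Let_def)
      moreover have "t \<in> trees (b + q)" using True less.prems by (simp add: b_def trees_def)
      ultimately show ?thesis by (intro rat_vec.span_base) auto
    next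
      case False
      then have "b \<noteq> Suc 0" by (simp add: b_def leaves_eq_1)
      then have b2: "b \<ge> 2" using ab(5) by linarith
      have rb: "dend_basis r \<in> dend_span (b - 1)" using ab b2 by (intro in_span) simp
      have tb: "dend_basis t \<in> dend_span q" using less.prems by (intro in_span)
      have "dend_op h (dend_basis r) (dend_basis t) \<in> dend_span (b - 1 + q)" for h
        by (rule IH[OF _ _ _ rb tb]) (use ab b2 less.prems in auto)
      then have sum: "dend_op Prec (dend_basis r) (dend_basis t) + dend_op Succ (dend_basis r) (dend_basis t)
          \<in> dend_span (b - 1 + q)" by (blast intro: rat_vec.span_add)
      have "dend_op Prec (dend_tree Leaf)
          (dend_op Prec (dend_basis r) (dend_basis t) + dend_op Succ (dend_basis r) (dend_basis t))
          \<in> rat_vec.span ?A"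
      proof (rule span_closed_linear[OF sum])
        fix u assume u: "u \<in> trees (b - 1 + q + 1)"
        then have "u \<noteq> Leaf" using b2 by (auto simp: trees_def)
        then have "dend_op Prec (dend_tree Leaf) (dend_basis u) = dend_basis (Node () Leaf u)"
          by (simp add: dend_op_tree Let_def)
        moreover have "u \<in> trees (b + q)" using u b2 by simp
        ultimately show "dend_op Prec (dend_tree Leaf) (dend_basis u) \<in> rat_vec.span ?A"
          by (intro rat_vec.span_base) auto
      qed (simp_all add: dend_op_linear)
      also have "dend_op Prec (dend_tree Leaf)
          (dend_op Prec (dend_basis r) (dend_basis t) + dend_op Succ (dend_basis r) (dend_basis t))
        = dend_op Prec ?m (dend_basis t)"
        using False by (simp add: dend_op_linear dend_op_tree Let_def dendriform_relations)
      finally show ?thesis .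
    qed
    show ?thesis
    proof (cases "l = Leaf")
      case True
      have "?A \<subseteq> dend_basis ` trees (p + q + 1)"
      proof (rule image_subsetI)
        fix u assume "u \<in> trees (b + q)"
        then have "Node () Leaf u \<in> trees (p + q + 1)" using True ab by (simp add: trees_def a_def)
        then show "dend_basis (Node () Leaf u) \<in> dend_basis ` trees (p + q + 1)" by (rule imageI)
      qed
      then show ?thesis using m rat_vec.span_mono unfolding s True Prec by blast
    next
      case False
      have "dend_op Prec (dend_basis s) (dend_basis t)
          = dend_op Succ (dend_basis l) (dend_op Prec ?m (dend_basis t))"
        using False unfolding s by (simp add: dend_op_tree Let_def dendriform_relations)
      also have "\<dots> \<in> dend_span (p + q)"
      proof (rule span_closed_linear[OF m])
        fix u assume u: "u \<in> trees (b + q)"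
        have "dend_op Succ (dend_basis l) (dend_basis (Node () Leaf u)) = dend_basis (Node () l u)"
          using False by (simp add: dend_op_tree Let_def)
        moreover have "Node () l u \<in> trees (p + q + 1)" using u ab by (simp add: trees_def)
        ultimately show "dend_op Succ (dend_basis l) (dend_basis (Node () Leaf u)) \<in> dend_span (p + q)"
          by (metis in_span)
      qed (simp_all add: dend_op_linear)
      finally show ?thesis unfolding Prec .
    qed
  next
    case Succ
    obtain l r where t: "t = Node () l r" using less.prems by (cases t) (auto simp: trees_def)
    define a where "a = leaves l"
    define b where "b = leaves r"
    have ab: "l \<in> trees a" "r \<in> trees b" "a + b = q + 1" "1 \<le> a" "1 \<le> b"
      using less.prems t by (auto simp: a_def b_def trees_def)
    let ?m = "dend_basis (Node () Leaf r)"
    have sL: "s \<noteq> Leaf" using less.prems by (auto simp: trees_def)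
    show ?thesis
    proof (cases "l = Leaf")
      case True
      have "dend_op Succ (dend_basis s) (dend_basis t) = dend_basis (Node () s r)"
        using sL unfolding t True by (simp add: dend_op_tree Let_def)
      moreover have "Node () s r \<in> trees (p + q + 1)"
        using node[OF less.prems(3) ab(2)] ab(3) True by (simp add: a_def)
      ultimately show ?thesis unfolding Succ by (metis in_span)
    next
      case False
      then have "a \<noteq> Suc 0" by (simp add: a_def leaves_eq_1)
      then have a2: "a \<ge> 2" using ab(4) by linarith
      have lb: "dend_basis l \<in> dend_span (a - 1)" using ab a2 by (intro in_span) simp
      have sb: "dend_basis s \<in> dend_span p" using less.prems by (intro in_span)
      have "dend_op h (dend_basis s) (dend_basis l) \<in> dend_span (p + (a - 1))" for h
        by (rule IH[OF _ _ _ sb lb]) (use ab a2 less.prems in auto)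
      then have sum: "dend_op Succ (dend_basis s) (dend_basis l) + dend_op Prec (dend_basis s) (dend_basis l)
          \<in> dend_span (p + (a - 1))" by (blast intro: rat_vec.span_add)
      have "dend_op Succ (dend_basis s) (dend_basis t)
          = dend_op Succ (dend_op Succ (dend_basis s) (dend_basis l) + dend_op Prec (dend_basis s) (dend_basis l)) ?m"
        using False unfolding t by (simp add: dend_op_linear dend_op_tree Let_def dendriform_relations)
      also have "\<dots> \<in> dend_span (p + q)"
      proof (rule span_closed_linear[OF sum])
        fix u assume u: "u \<in> trees (p + (a - 1) + 1)"
        then have "u \<noteq> Leaf" using a2 by (auto simp: trees_def)
        then have "dend_op Succ (dend_basis u) ?m = dend_basis (Node () u r)"
          by (simp add: dend_op_tree Let_def)
        moreover have "Node () u r \<in> trees (p + q + 1)"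
          using node[OF u ab(2)] ab(3) a2 by (simp add: trees_def)
        ultimately show "dend_op Succ (dend_basis u) ?m \<in> dend_span (p + q)"
          by (metis in_span)
      qed (simp_all add: dend_op_linear)
      finally show ?thesis unfolding Succ .
    qed
  qed
qed

lemma dend_tree_in_span: "dend_tree t \<in> dend_span (leaves t)"
proof (induction t)
  case Leaf
  have "Node () Leaf Leaf \<in> trees (leaves Leaf + 1)" by (simp add: trees_def)
  then have "dend_basis (Node () Leaf Leaf) \<in> dend_span (leaves Leaf)"
    by (intro rat_vec.span_base imageI)
  then show ?case by simp
next
  case (Node g l r)
  have "dend_op g (dend_tree l) (dend_tree r) \<in> dend_span (leaves l + leaves r)"
    by (rule dend_op_span[OF Node.IH dend_op_basis_in_span]) auto
  then show ?case by (simp add: dend_op_tree)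
qed

lemma Dend_subset_span: "Dend n \<subseteq> dend_span n"
proof
  fix x assume "x \<in> Dend n"
  then obtain y where y: "x = abs_dend y" "y \<in> free_component n" by (auto simp: Dend_def)
  from y(2) have "abs_dend y \<in> dend_span n"
  proof (induction rule: free_component_induct)
    case (elem c t)
    then show ?case using dend_tree_in_span[of t]
      by (auto simp: scaleQ_dend.abs_eq[symmetric] intro: rat_vec.span_scale)
  qed (auto simp: plus_dend.abs_eq[symmetric] zero_dend_def[symmetric] intro: rat_vec.span_add rat_vec.span_zero)
  then show "x \<in> dend_span n" by (simp add: y)
qed

lemma dend_basis_in_Dend: "t \<in> trees (n + 1) \<Longrightarrow> 1 \<le> n \<Longrightarrow> dend_basis t \<in> Dend n"
  using leaves_normal_tree[of t]
  by (auto simp: Dend_def trees_def tree_elem_in_component leaves_eq_1[symmetric])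

lemma dend_mould_basis:
  assumes "t \<in> trees (n + 1)" "1 \<le> n" "inj_on v {..n}"
  shows "dend_mould n v (dend_basis t) = frac t v"
proof -
  have t: "leaves t = n + 1" "t \<noteq> Leaf" using assms(1,2) by (auto simp: trees_def)
  then have "leaves (normal_tree t) = n" by (simp add: leaves_normal_tree)
  moreover have "mould (normal_tree t) v = frac t v"
    using assms(3) t by (intro mould_normal_tree) (simp_all add: lessThan_Suc_atMost)
  ultimately show ?thesis by (simp add: dend_mould_abs[OF assms(3)] mould_eval_linear)
qed

lemma dend_expansion:
  assumes "x \<in> Dend n"
  shows "\<exists>\<alpha>. x = (\<Sum>t\<in>trees (n + 1). \<alpha> t *\<^sub>Q dend_basis t)"
proof -
  let ?R = "{x. \<exists>\<alpha>. x = (\<Sum>t\<in>trees (n + 1). \<alpha> t *\<^sub>Q dend_basis t)}"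
  have "rat_vec.subspace ?R"
  proof (rule rat_vec.subspaceI)
    show "0 \<in> ?R" by (auto intro!: exI[of _ "\<lambda>_. 0"])
  next
    fix x y assume "x \<in> ?R" "y \<in> ?R"
    then obtain \<alpha> \<beta> where "x = (\<Sum>t\<in>trees (n + 1). \<alpha> t *\<^sub>Q dend_basis t)"
      "y = (\<Sum>t\<in>trees (n + 1). \<beta> t *\<^sub>Q dend_basis t)" by blast
    then have "x + y = (\<Sum>t\<in>trees (n + 1). (\<alpha> t + \<beta> t) *\<^sub>Q dend_basis t)"
      by (simp add: scaleQ_add_left sum.distrib)
    then show "x + y \<in> ?R" by (auto intro: exI[of _ "\<lambda>t. \<alpha> t + \<beta> t"])
  next
    fix c x assume "x \<in> ?R"
    then obtain \<alpha> where "x = (\<Sum>t\<in>trees (n + 1). \<alpha> t *\<^sub>Q dend_basis t)" by blast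
    then have "c *\<^sub>Q x = (\<Sum>t\<in>trees (n + 1). (c * \<alpha> t) *\<^sub>Q dend_basis t)"
      by (simp add: rat_vec.scale_sum_right scaleQ_scaleQ)
    then show "c *\<^sub>Q x \<in> ?R" by (auto intro: exI[of _ "\<lambda>t. c * \<alpha> t"])
  qed
  moreover have "dend_basis ` trees (n + 1) \<subseteq> ?R"
  proof (rule image_subsetI)
    fix t assume t: "t \<in> trees (n + 1)"
    have "dend_basis t = (\<Sum>u\<in>trees (n + 1). (if u = t then 1 else 0) *\<^sub>Q dend_basis u)"
      using t by (simp add: if_distrib[of "\<lambda>c. c *\<^sub>Q _"] scaleQ_one cong: if_cong)
    then show "dend_basis t \<in> ?R" by (auto intro: exI[of _ "\<lambda>u. if u = t then 1 else 0"])
  qed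
  ultimately have "dend_span n \<subseteq> ?R" by (intro rat_vec.span_minimal)
  then show ?thesis using assms Dend_subset_span[of n] by blast
qed

definition dend_coord :: "nat \<Rightarrow> unit btree \<Rightarrow> dend \<Rightarrow> rat" where
  "dend_coord n t x = (SOME \<alpha>. x = (\<Sum>t\<in>trees (n + 1). \<alpha> t *\<^sub>Q dend_basis t)) t"

lemma dend_coord_expansion:
  "x \<in> Dend n \<Longrightarrow> x = (\<Sum>t\<in>trees (n + 1). dend_coord n t x *\<^sub>Q dend_basis t)"
  unfolding dend_coord_def by (rule someI_ex[OF dend_expansion])

lemma dend_mould_coord:
  assumes "x \<in> Dend n" "1 \<le> n" "inj_on v {..n}"
  shows "dend_mould n v x = (\<Sum>t\<in>trees (n + 1). dend_coord n t x * frac t v)"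
proof -
  have "dend_mould n v x = dend_mould n v (\<Sum>t\<in>trees (n + 1). dend_coord n t x *\<^sub>Q dend_basis t)"
    using dend_coord_expansion[OF assms(1)] by simp
  also have "\<dots> = (\<Sum>t\<in>trees (n + 1). dend_coord n t x * frac t v)"
    unfolding dend_mould_sum[OF assms(3)]
    by (intro sum.cong refl) (simp only: dend_mould_basis[OF _ assms(2,3)])
  finally show ?thesis .
qed

text \<open>An element of a component is determined by its function, so its coordinates can be read off from
any expansion of the function into fractions.\<close>

lemma dend_coord_unique:
  assumes "x \<in> Dend n" "1 \<le> n" "t \<in> trees (n + 1)"
    and "\<And>v. inj_on v {..n} \<Longrightarrow> dend_mould n v x = (\<Sum>t\<in>trees (n + 1). \<alpha> t * frac t v)"
  shows "dend_coord n t x = \<alpha> t"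
  by (rule frac_coefficients_unique[OF _ assms(3)])
    (use assms(4) dend_mould_coord[OF assms(1,2)] in \<open>simp add: lessThan_Suc_atMost\<close>)

lemma coordinates_on_Dend:
  assumes "1 \<le> n"
  shows "coordinates_on (Dend n) (trees (n + 1)) dend_basis (dend_coord n)"
proof -
  interpret ns_operad Dend dend_unit dend_comp by (rule ns_operad_Dend)
  note sub = subspace[OF assms]
  have "linear_on (Dend n) (dend_coord n t)" if t: "t \<in> trees (n + 1)" for t
    unfolding linear_on_def
  proof (intro conjI ballI allI)
    fix x y assume xy: "x \<in> Dend n" "y \<in> Dend n"
    show "dend_coord n t (x + y) = dend_coord n t x + dend_coord n t y"
      by (rule dend_coord_unique[OF rat_vec.subspace_add[OF sub xy] assms t])
        (simp add: dend_mould_linear dend_mould_coord[OF _ assms] xy distrib_right sum.distrib)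
  next
    fix c x assume x: "x \<in> Dend n"
    have "dend_coord n t (c *\<^sub>Q x) = c * dend_coord n t x"
      by (rule dend_coord_unique[OF rat_vec.subspace_scale[OF sub x] assms t])
        (simp add: dend_mould_linear dend_mould_coord[OF _ assms] x sum_distrib_left mult.assoc)
    then show "dend_coord n t (c *\<^sub>Q x) = c *\<^sub>Q dend_coord n t x" by simp
  qed
  then show ?thesis
    unfolding coordinates_on_def
    using sub dend_coord_expansion dend_basis_in_Dend[OF _ assms] by auto
qed

section \<open>The anticyclic structure as a rotation of points\<close>

text \<open>The point \<open>m\<close> becomes the first one. Only the values at \<open>j < N\<close> are used.\<close>

definition rotate_points :: "nat \<Rightarrow> nat \<Rightarrow> (nat \<Rightarrow> rat) \<Rightarrow> nat \<Rightarrow> rat" where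
  "rotate_points N m v j = v ((j + m) mod N)"

lemma rotate_points_if:
  "j < N \<Longrightarrow> m \<le> N \<Longrightarrow> rotate_points N m v j = (if j + m < N then v (j + m) else v (j + m - N))"
  by (auto simp: rotate_points_def le_mod_geq)

lemma inj_on_rotate_points:
  assumes "inj_on v {..<N}"
  shows "inj_on (rotate_points N m v) {..<N}"
proof (rule inj_onI)
  fix x y assume xy: "x \<in> {..<N}" "y \<in> {..<N}" "rotate_points N m v x = rotate_points N m v y"
  then have "(x + m) mod N = (y + m) mod N"
    by (intro inj_onD[OF assms]) (auto simp: rotate_points_def)
  then have "[x + m = y + m] (mod N)" by (simp add: cong_def)
  then have "[x = y] (mod N)" by (simp add: cong_add_rcancel_nat)
  then show "x = y" using xy by (simp add: cong_less_modulus_unique_nat)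
qed

locale dend_anticyclic = ns_anticyclic_operad Dend dend_unit dend_comp \<tau> for \<tau> +
  assumes tau_succ: "\<tau> 2 dend_succ = dend_prec"
    and tau_prec: "\<tau> 2 dend_prec = - dend_prec - dend_succ"
begin

lemma dend_tree_in_Dend: "dend_tree t \<in> Dend (leaves t)"
  by (simp add: Dend_def tree_elem_in_component)

lemma dend_mould_tau_generator:
  assumes "inj_on v {..2}"
  shows "dend_mould 2 v (\<tau> 2 (dend_tree (Node g Leaf Leaf)))
    = mould (Node g Leaf Leaf) (rotate_points 3 2 v)"
proof -
  have "v i \<noteq> v j" if "i \<noteq> j" "i \<le> 2" "j \<le> 2" for i j
    using inj_onD[OF assms, of i j] that by auto
  from this[of 0 1] this[of 0 2] this[of 1 2]
  have ne: "v 1 - v 0 \<noteq> 0" "v 2 - v 0 \<noteq> 0" "v 2 - v 1 \<noteq> 0" "v 0 - v 1 \<noteq> 0" "v 0 - v 2 \<noteq> 0" "v 1 - v 2 \<noteq> 0"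
    by auto
  have rot: "rotate_points 3 2 v 0 = v 2" "rotate_points 3 2 v 1 = v 0" "rotate_points 3 2 v 2 = v 1"
    by (simp_all add: rotate_points_def numeral_2_eq_2[symmetric])
  note [simp] = numeral_2_eq_2[symmetric] rot rot[unfolded One_nat_def]
  have prec: "dend_mould 2 v dend_prec = mould (Node Prec Leaf Leaf) v"
    and succ: "dend_mould 2 v dend_succ = mould (Node Succ Leaf Leaf) v"
    unfolding dend_prec_def dend_succ_def by (simp_all add: dend_mould_abs[OF assms] mould_eval_linear)
  have diff: "dend_mould 2 v (- x - y) = - dend_mould 2 v x - dend_mould 2 v y" for x y
    using dend_mould_linear(1)[OF assms, of "- x" "- y"] by (simp add: dend_mould_linear(3)[OF assms])
  show ?thesis
  proof (cases g)
    case Prec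
    then have "dend_mould 2 v (\<tau> 2 (dend_tree (Node g Leaf Leaf))) = dend_mould 2 v (- dend_prec - dend_succ)"
      using tau_prec by (simp add: dend_prec_def)
    also have "\<dots> = mould (Node Prec Leaf Leaf) (rotate_points 3 2 v)"
      using ne unfolding diff prec succ by (simp add: divide_simps, (simp add: algebra_simps)?)
    finally show ?thesis using Prec by simp
  next
    case Succ
    then have "dend_mould 2 v (\<tau> 2 (dend_tree (Node g Leaf Leaf))) = dend_mould 2 v dend_prec"
      using tau_succ by (simp add: dend_succ_def)
    also have "\<dots> = mould (Node Succ Leaf Leaf) (rotate_points 3 2 v)"
      using ne unfolding prec by (simp add: divide_simps, (simp add: algebra_simps)?)
    finally show ?thesis using Succ by simp
  qed
qed

text \<open>Both sides satisfy the same recursion over trees: the axioms of an anticyclic operad express \<open>\<tau>\<close> of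
\<open>(\<gamma> \<circ>\<^sub>2 r) \<circ>\<^sub>1 l\<close> by \<open>\<tau> l\<close> and \<open>\<tau> \<gamma>\<close>, and rotation of the points treats a composition of functions in the same
way. The minus sign for \<open>\<circ>\<^sub>1\<close> comes from the orientation of the interval in which \<open>l\<close> is inserted.\<close>

lemma dend_mould_tau_tree:
  assumes "inj_on v {..leaves t}"
  shows "dend_mould (leaves t) v (\<tau> (leaves t) (dend_tree t))
    = mould t (rotate_points (leaves t + 1) (leaves t) v)"
  using assms
proof (induction t arbitrary: v)
  case Leaf
  have "\<tau> 1 (dend_tree Leaf) = - dend_tree Leaf" using tau_unit by (simp add: dend_unit_def)
  then show ?case using dend_mould_linear(3)[of v 1] dend_mould_abs[of v 1] Leaf.prems
    by (simp add: mould_eval_linear rotate_points_def divide_simps)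
next
  case (Node g l r)
  define a where "a = leaves l"
  define b where "b = leaves r"
  have ab: "1 \<le> a" "1 \<le> b" by (simp_all add: a_def b_def)
  let ?n = "a + b" and ?gen = "dend_tree (Node g Leaf Leaf)"
  let ?f = "dend_comp 2 ?gen (dend_tree r)"
  have inj: "inj_on v {..?n}" using Node.prems by (simp add: a_def b_def)
  have ne: "v i \<noteq> v j" if "i \<noteq> j" "i \<le> ?n" "j \<le> ?n" for i j
    using inj_onD[OF inj, of i j] that by auto
  have l: "dend_tree l \<in> Dend a" and r: "dend_tree r \<in> Dend b"
    using dend_tree_in_Dend by (simp_all add: a_def b_def)
  have gen: "?gen \<in> Dend 2" using dend_tree_in_Dend[of "Node g Leaf Leaf"] by (simp add: numeral_2_eq_2)
  have f: "?f \<in> Dend (b + 1)" using comp_closed[OF gen r, of 2] ab by simp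
  have tf: "\<tau> (b + 1) ?f = dend_comp 1 (\<tau> 2 ?gen) (dend_tree r)"
    using tau_comp[OF gen r, of 2] ab by simp
  have tgen: "\<tau> 2 ?gen \<in> Dend 2" using tau_closed[OF gen] by simp
  have tfD: "\<tau> (b + 1) ?f \<in> Dend (b + 1)" using tau_closed[OF f] by simp
  have tlD: "\<tau> a (dend_tree l) \<in> Dend a" using tau_closed[OF l] ab by simp
  have "dend_tree (Node g l r) = dend_comp 1 ?f (dend_tree l)"
    using dend_op_tree[of g l r] by (simp add: dend_op_def)
  then have "\<tau> ?n (dend_tree (Node g l r)) = - dend_comp a (\<tau> a (dend_tree l)) (\<tau> (b + 1) ?f)"
    using tau_comp_first[OF f l] ab by (simp add: add.commute)
  then have 1: "dend_mould ?n v (\<tau> ?n (dend_tree (Node g l r)))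
      = - dend_mould ?n v (dend_comp a (\<tau> a (dend_tree l)) (\<tau> (b + 1) ?f))"
    by (simp add: dend_mould_linear(3)[OF inj])
  let ?w = "\<lambda>j. v (j + (a - 1))"
  have 2: "dend_mould ?n v (dend_comp a (\<tau> a (dend_tree l)) (\<tau> (b + 1) ?f))
      = dend_mould a (delete_block a b v) (\<tau> a (dend_tree l)) * (v ?n - v (a - 1))
        * dend_mould (b + 1) ?w (\<tau> (b + 1) ?f)"
    using dend_mould_comp[OF tlD tfD, of a ?n v] ab inj by simp
  have injw: "inj_on ?w {..b + 1}"
    using ab by (intro inj_on_shift inj_on_subset[OF inj]) auto
  have 3: "dend_mould (b + 1) ?w (\<tau> (b + 1) ?f)
      = dend_mould 2 (delete_block 1 (b - 1) ?w) (\<tau> 2 ?gen) * (?w b - ?w 0) * mould r ?w"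
  proof -
    have injb: "inj_on ?w {..b}" by (rule inj_on_subset[OF injw]) auto
    have "dend_mould b ?w (dend_tree r) = mould r ?w"
      unfolding dend_mould_abs[OF injb] by (simp add: mould_eval_linear b_def)
    then show ?thesis unfolding tf using dend_mould_comp[OF tgen r, of 1 "b + 1" ?w] ab injw by simp
  qed
  let ?R = "rotate_points (?n + 1) ?n v"
  have R: "?R 0 = v ?n" "\<And>j. 0 < j \<Longrightarrow> j \<le> ?n \<Longrightarrow> ?R j = v (j - 1)"
    by (simp_all add: rotate_points_if)
  have 4: "dend_mould a (delete_block a b v) (\<tau> a (dend_tree l)) = mould l ?R"
  proof -
    have "dend_mould a (delete_block a b v) (\<tau> a (dend_tree l))
        = mould l (rotate_points (a + 1) a (delete_block a b v))"
      using Node.IH(1)[of "delete_block a b v"] inj by (simp add: a_def b_def inj_on_delete_block)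
    also have "\<dots> = mould l ?R"
      by (rule mould_cong) (use R ab in \<open>auto simp: a_def[symmetric] rotate_points_if delete_block_def\<close>)
    finally show ?thesis .
  qed
  have 5: "mould r ?w = mould r (\<lambda>j. ?R (j + a))"
    by (rule mould_cong) (use R(2) ab in \<open>simp add: b_def\<close>)
  have inj2: "inj_on (delete_block 1 (b - 1) ?w) {..2}"
    using ab injw by (intro inj_on_delete_block) simp
  have 6: "dend_mould 2 (delete_block 1 (b - 1) ?w) (\<tau> 2 ?gen)
      = mould (Node g Leaf Leaf) (rotate_points 3 2 (delete_block 1 (b - 1) ?w))"
    by (rule dend_mould_tau_generator[OF inj2])
  have 7: "rotate_points 3 2 (delete_block 1 (b - 1) ?w) 0 = v ?n"
    "rotate_points 3 2 (delete_block 1 (b - 1) ?w) 1 = v (a - 1)"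
    "rotate_points 3 2 (delete_block 1 (b - 1) ?w) 2 = v (?n - 1)"
    using ab by (simp_all add: rotate_points_def delete_block_def add.commute[of b a])
  have 8: "?w b = v (?n - 1)" "?w 0 = v (a - 1)" using ab by (simp_all add: add.commute[of b a])
  have 9: "?R a = v (a - 1)" "?R ?n = v (?n - 1)" using R(2) ab by auto
  have ne': "v ?n \<noteq> v (a - 1)" "v (?n - 1) \<noteq> v (a - 1)" "v (?n - 1) \<noteq> v ?n"
    using ab ne[of ?n "a - 1"] ne[of "?n - 1" "a - 1"] ne[of "?n - 1" ?n] by auto
  have "dend_mould ?n v (\<tau> ?n (dend_tree (Node g l r))) = mould (Node g l r) ?R"
    unfolding 1 2 3 4 5 6 mould.simps leaves.simps a_def[symmetric] b_def[symmetric] 8 9 R(1)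
    using 7 ne' by (cases g, simp_all add: numeral_2_eq_2[symmetric] divide_simps, simp_all add: algebra_simps)
  then show ?case by (simp add: a_def b_def)
qed

text \<open>The anticyclic structure is a rotation of the points by \<open>n\<close>, that is, by \<open>- 1\<close> modulo \<open>n + 1\<close>.\<close>

lemma dend_mould_tau:
  assumes "x \<in> Dend n" "1 \<le> n" "inj_on v {..n}"
  shows "dend_mould n v (\<tau> n x) = dend_mould n (rotate_points (n + 1) n v) x"
proof -
  obtain y where y: "x = abs_dend y" "y \<in> free_component n" using assms(1) by (auto simp: Dend_def)
  let ?R = "rotate_points (n + 1) n v"
  have R: "inj_on ?R {..n}"
    using inj_on_rotate_points[of v "n + 1" n] assms(3) by (simp add: lessThan_Suc_atMost)
  have mem: "abs_dend z \<in> Dend n" if "z \<in> free_component n" for z using that by (auto simp: Dend_def)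
  note fsub = free_component_subspace[of n]
  have "y \<in> free_component n \<and> dend_mould n v (\<tau> n (abs_dend y)) = dend_mould n ?R (abs_dend y)"
    using y(2)
  proof (induction rule: free_component_induct)
    case zero
    have "0 \<in> free_component n" by (rule rat_vec.subspace_0[OF fsub])
    moreover have "\<tau> n 0 = 0"
      using tau_scale[of 0 n 0] assms(2) rat_vec.subspace_0[OF subspace] by simp
    ultimately show ?case by (simp add: zero_dend_def[symmetric] dend_mould_linear assms(3) R[simplified])
  next
    case (add x y)
    then have "x + y \<in> free_component n" by (blast intro: rat_vec.subspace_add[OF fsub])
    with add show ?case using tau_add[OF mem mem assms(2), of x y]
      by (simp add: plus_dend.abs_eq[symmetric] dend_mould_linear assms(3) R[simplified])
  next
    case (elem c t)
    have t: "tree_elem t \<in> free_component n" using elem by (simp add: tree_elem_in_component)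
    then have "c *\<^sub>Q tree_elem t \<in> free_component n" by (rule rat_vec.subspace_scale[OF fsub])
    moreover have "\<tau> n (c *\<^sub>Q dend_tree t) = c *\<^sub>Q \<tau> n (dend_tree t)"
      by (rule tau_scale[OF mem[OF t] assms(2)])
    moreover have "dend_mould n v (\<tau> n (dend_tree t)) = mould t ?R"
      using dend_mould_tau_tree[of v t] elem assms(3) by simp
    ultimately show ?case using elem
      by (simp add: scaleQ_dend.abs_eq[symmetric] dend_mould_linear assms(3) R[simplified] dend_mould_abs[OF R, simplified] mould_eval_linear)
  qed
  then show ?thesis by (simp add: y)
qed

end

section \<open>Rotations in the basis of trees\<close>

lemma rotate_points_rotate_points:
  "rotate_points N a (rotate_points N b v) = rotate_points N (a + b) v"
  by (simp add: rotate_points_def fun_eq_iff mod_simps add.assoc)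

lemma rotate_points_cong: "a mod N = b mod N \<Longrightarrow> rotate_points N a v = rotate_points N b v"
  unfolding rotate_points_def by (metis mod_add_right_eq)

text \<open>The space spanned by the fractions is stable under rotation because it is the image of \<open>Dend\<close> and
because the rotation is the image of \<open>\<tau>\<close>.\<close>

lemma rotation_expansion_predecessor:
  assumes "t \<in> trees N"
  shows "\<exists>\<alpha>. \<forall>v. inj_on v {..<N} \<longrightarrow>
    frac t (rotate_points N (N - 1) v) = (\<Sum>s\<in>trees N. \<alpha> s * frac s v)"
proof (cases "N = 1")
  case True
  then have "t = Leaf" using assms by (simp add: trees_1)
  then show ?thesis using True by (intro exI[of _ "\<lambda>_. 1"]) (simp add: trees_1)
next
  case False
  define n where "n = N - 1"
  have "N \<noteq> 0" using assms by (cases N) (auto simp: trees_0)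
  with False have n: "1 \<le> n" "N = n + 1" by (auto simp: n_def)
  interpret dend_anticyclic "\<lambda>_. dend_tau"
    by (intro dend_anticyclic.intro dend_anticyclic_axioms.intro ns_anticyclic_operad_Dend)
  have t: "t \<in> trees (n + 1)" using assms n by simp
  have mem: "dend_basis t \<in> Dend n" by (rule dend_basis_in_Dend[OF t n(1)])
  have mem': "dend_tau (dend_basis t) \<in> Dend n" using tau_closed[OF mem n(1)] .
  have expansion: "frac t (rotate_points N (N - 1) v)
      = (\<Sum>s\<in>trees N. dend_coord n s (dend_tau (dend_basis t)) * frac s v)"
    if "inj_on v {..<N}" for v
  proof -
    have v: "inj_on v {..n}" using that by (simp add: n(2) lessThan_Suc_atMost)
    have R: "inj_on (rotate_points (n + 1) n v) {..n}"
      using inj_on_rotate_points[of v "n + 1" n] v by (simp add: lessThan_Suc_atMost)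
    have "frac t (rotate_points N (N - 1) v) = dend_mould n v (dend_tau (dend_basis t))"
      using dend_mould_tau[OF mem n(1) v] dend_mould_basis[OF t n(1) R] n(2) by simp
    then show ?thesis using dend_mould_coord[OF mem' n(1) v] n(2) by simp
  qed
  show ?thesis
    by (rule exI[of _ "\<lambda>s. dend_coord n s (dend_tau (dend_basis t))"], intro allI impI, rule expansion)
qed

lemma rotation_expansion:
  assumes "t \<in> trees N"
  shows "\<exists>\<alpha>. \<forall>v. inj_on v {..<N} \<longrightarrow>
    frac t (rotate_points N m v) = (\<Sum>s\<in>trees N. \<alpha> s * frac s v)"
proof -
  have iter: "\<exists>\<alpha>. \<forall>v. inj_on v {..<N} \<longrightarrow>
      frac t (rotate_points N (k * (N - 1)) v) = (\<Sum>s\<in>trees N. \<alpha> s * frac s v)"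
    if "t \<in> trees N" for t k
    using that
  proof (induction k arbitrary: t)
    case 0
    have id: "frac t (rotate_points N (0 * (N - 1)) v)
        = (\<Sum>s\<in>trees N. (if s = t then 1 else 0) * frac s v)" for v
    proof -
      have "frac t (rotate_points N (0 * (N - 1)) v) = frac t v"
        using 0 by (intro frac_cong) (simp add: rotate_points_def trees_def)
      then show ?thesis using 0 by (simp add: if_distrib[of "\<lambda>c. c * _"] cong: if_cong)
    qed
    show ?case by (rule exI[of _ "\<lambda>s. if s = t then 1 else 0"], intro allI impI, rule id)
  next
    case (Suc k)
    obtain \<beta> where \<beta>: "\<And>s v. s \<in> trees N \<Longrightarrow> inj_on v {..<N} \<Longrightarrow>
        frac s (rotate_points N (k * (N - 1)) v) = (\<Sum>u\<in>trees N. \<beta> s u * frac u v)"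
      using Suc.IH by metis
    obtain \<alpha> where \<alpha>: "\<And>v. inj_on v {..<N} \<Longrightarrow>
        frac t (rotate_points N (N - 1) v) = (\<Sum>s\<in>trees N. \<alpha> s * frac s v)"
      using rotation_expansion_predecessor[OF Suc.prems] by metis
    have step: "frac t (rotate_points N (Suc k * (N - 1)) v)
        = (\<Sum>u\<in>trees N. (\<Sum>s\<in>trees N. \<alpha> s * \<beta> s u) * frac u v)" if v: "inj_on v {..<N}" for v
    proof -
      have "frac t (rotate_points N (Suc k * (N - 1)) v)
          = frac t (rotate_points N (N - 1) (rotate_points N (k * (N - 1)) v))"
        by (simp add: rotate_points_rotate_points)
      also have "\<dots> = (\<Sum>s\<in>trees N. \<alpha> s * (\<Sum>u\<in>trees N. \<beta> s u * frac u v))"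
        unfolding \<alpha>[OF inj_on_rotate_points[OF v]] by (rule sum.cong[OF refl], simp only: \<beta>[OF _ v])
      also have "\<dots> = (\<Sum>s\<in>trees N. \<Sum>u\<in>trees N. \<alpha> s * \<beta> s u * frac u v)"
        by (simp add: sum_distrib_left mult.assoc)
      also have "\<dots> = (\<Sum>u\<in>trees N. (\<Sum>s\<in>trees N. \<alpha> s * \<beta> s u) * frac u v)"
        by (subst sum.swap) (simp add: sum_distrib_right)
      finally show ?thesis .
    qed
    show ?case
      by (rule exI[of _ "\<lambda>u. \<Sum>s\<in>trees N. \<alpha> s * \<beta> s u"], intro allI impI, rule step)
  qed
  \<comment> \<open>\<open>N - 1\<close> is its own inverse modulo \<open>N\<close>, so its multiples reach every rotation.\<close>
  have "(m * (N - 1) * (N - 1)) mod N = m mod N"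
  proof (cases "N \<le> 1")
    case True
    then have "N = 1" using assms by (cases N) (auto simp: trees_0)
    then show ?thesis by simp
  next
    case False
    then obtain M where "N = Suc (Suc M)" by (metis add_2_eq_Suc le_Suc_ex not_less_eq_eq numeral_1_eq_Suc_0 One_nat_def numeral_2_eq_2)
    then have "m * (N - 1) * (N - 1) = m + N * (m * M)" by (simp add: algebra_simps)
    then show ?thesis by simp
  qed
  from rotate_points_cong[OF this] show ?thesis using iter[OF assms, of "m * (N - 1)"] by simp
qed

text \<open>The entry of the matrix of the rotation by \<open>m\<close> in row \<open>s\<close> and column \<open>t\<close>.\<close>

definition rotation_coeff :: "nat \<Rightarrow> nat \<Rightarrow> unit btree \<Rightarrow> unit btree \<Rightarrow> rat" where
  "rotation_coeff N m s t = (SOME \<alpha>. \<forall>v. inj_on v {..<N} \<longrightarrow>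
    frac t (rotate_points N m v) = (\<Sum>s\<in>trees N. \<alpha> s * frac s v)) s"

lemma frac_rotate_points:
  assumes "t \<in> trees N" "inj_on v {..<N}"
  shows "frac t (rotate_points N m v) = (\<Sum>s\<in>trees N. rotation_coeff N m s t * frac s v)"
  using someI_ex[OF rotation_expansion[OF assms(1), of m]] assms(2)
  unfolding rotation_coeff_def by blast

lemma rotation_coeff_unique:
  assumes "t \<in> trees N" "s \<in> trees N"
    and "\<And>v. inj_on v {..<N} \<Longrightarrow> frac t (rotate_points N m v) = (\<Sum>s\<in>trees N. \<alpha> s * frac s v)"
  shows "rotation_coeff N m s t = \<alpha> s"
  by (rule frac_coefficients_unique[OF _ assms(2)])
    (use frac_rotate_points[OF assms(1)] assms(3) in simp)

lemma rotation_coeff_mod: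
  assumes "a mod N = b mod N"
  shows "rotation_coeff N a s t = rotation_coeff N b s t"
  unfolding rotation_coeff_def using rotate_points_cong[OF assms] by simp

lemma rotation_coeff_0:
  assumes "s \<in> trees N" "t \<in> trees N"
  shows "rotation_coeff N 0 s t = (if s = t then 1 else 0)"
proof (rule rotation_coeff_unique[OF assms(2,1)])
  fix v
  have "frac t (rotate_points N 0 v) = frac t v"
    using assms by (intro frac_cong) (simp add: rotate_points_def trees_def)
  then show "frac t (rotate_points N 0 v) = (\<Sum>s\<in>trees N. (if s = t then 1 else 0) * frac s v)"
    using assms by (simp add: if_distrib[of "\<lambda>c. c * _"] cong: if_cong)
qed

lemma rotation_coeff_self:
  assumes "s \<in> trees N" "t \<in> trees N"
  shows "rotation_coeff N N s t = (if s = t then 1 else 0)"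
  using rotation_coeff_0[OF assms] rotation_coeff_mod[of N N 0 s t] by simp

lemma rotation_coeff_add:
  assumes "s \<in> trees N" "t \<in> trees N"
  shows "rotation_coeff N (a + b) s t
    = (\<Sum>u\<in>trees N. rotation_coeff N b s u * rotation_coeff N a u t)"
proof (rule rotation_coeff_unique[OF assms(2,1)])
  fix v :: "nat \<Rightarrow> rat" assume v: "inj_on v {..<N}"
  have "frac t (rotate_points N (a + b) v) = frac t (rotate_points N a (rotate_points N b v))"
    by (simp add: rotate_points_rotate_points)
  also have "\<dots> = (\<Sum>u\<in>trees N. rotation_coeff N a u t * (\<Sum>s\<in>trees N. rotation_coeff N b s u * frac s v))"
    unfolding frac_rotate_points[OF assms(2) inj_on_rotate_points[OF v]]
    by (intro sum.cong refl) (simp add: frac_rotate_points[OF _ v])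
  also have "\<dots> = (\<Sum>u\<in>trees N. \<Sum>s\<in>trees N. rotation_coeff N b s u * rotation_coeff N a u t * frac s v)"
    by (simp add: sum_distrib_left mult_ac)
  also have "\<dots> = (\<Sum>s\<in>trees N. (\<Sum>u\<in>trees N. rotation_coeff N b s u * rotation_coeff N a u t) * frac s v)"
    by (subst sum.swap) (simp add: sum_distrib_right)
  finally show "frac t (rotate_points N (a + b) v)
    = (\<Sum>s\<in>trees N. (\<Sum>u\<in>trees N. rotation_coeff N b s u * rotation_coeff N a u t) * frac s v)" .
qed

lemma frac_bilinear_coefficients_unique:
  assumes eq: "\<And>p q. inj_on p {..<c} \<Longrightarrow> inj_on q {..<d} \<Longrightarrow>
      (\<Sum>b\<in>trees c. \<Sum>s\<in>trees d. \<alpha> b s * frac b p * frac s q)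
    = (\<Sum>b\<in>trees c. \<Sum>s\<in>trees d. \<beta> b s * frac b p * frac s q)"
    and "b \<in> trees c" "s \<in> trees d"
  shows "\<alpha> b s = \<beta> b s"
proof (rule frac_coefficients_unique[OF _ assms(3)])
  fix q :: "nat \<Rightarrow> rat" assume q: "inj_on q {..<d}"
  show "(\<Sum>s\<in>trees d. \<alpha> b s * frac s q) = (\<Sum>s\<in>trees d. \<beta> b s * frac s q)"
    by (rule frac_coefficients_unique[OF _ assms(2), of "\<lambda>b. \<Sum>s\<in>trees d. \<alpha> b s * frac s q"
          "\<lambda>b. \<Sum>s\<in>trees d. \<beta> b s * frac s q"])
      (use eq[OF _ q] in \<open>simp add: sum_distrib_left sum_distrib_right mult_ac\<close>)
qed

lemma rotate_points_push:
  assumes "a + c \<le> N" "j < N" "m \<le> a \<and> a' = a - m \<or> a + c \<le> m \<and> m \<le> N \<and> a' = a + N - m"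
  shows "rotate_points N m (push {a..<a + c} k v) j = push {a'..<a' + c} k (rotate_points N m v) j"
proof -
  have "m \<le> N" using assms by auto
  then show ?thesis using assms by (auto simp: rotate_points_if push_def)
qed

lemma delete_block_rotate_points:
  assumes "a + c \<le> N" "0 < c" "j < N - c"
    and "m \<le> a \<and> a' = a - m \<and> m' = m \<or> a + c \<le> m \<and> m \<le> N \<and> a' = a + N - m \<and> m' = m - c"
  shows "delete_block a' c (rotate_points N m v) j = rotate_points (N - c) m' (delete_block a c v) j"
proof -
  have m: "m \<le> N" "m' \<le> N - c" "j < N" "\<not> j < a' \<Longrightarrow> j + c < N" using assms by auto
  show ?thesis
  proof (cases "j < a'")
    case True
    then show ?thesis using assms m by (auto simp: rotate_points_if delete_block_def add_ac intro!: arg_cong[of _ _ v])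
  next
    case False
    then show ?thesis using assms m by (auto simp: rotate_points_if delete_block_def add_ac intro!: arg_cong[of _ _ v])
  qed
qed

text \<open>Rotating the points and then sending a block to infinity is the same as sending the rotated block
to infinity and then rotating the remaining points. In the second alternative the block is among the first \<open>m\<close> points,
which the rotation moves to the end, so the remaining points rotate by \<open>m - c\<close> only. Both sides compute the same limit.\<close>

lemma residue_coeff_rotation:
  assumes t: "t \<in> trees N" and b: "b \<in> trees c" and s: "s \<in> trees (N - c)"
    and c: "0 < c" "c < N" "a + c \<le> N"
    and rot: "m \<le> a \<and> a' = a - m \<and> m' = m \<or> a + c \<le> m \<and> m \<le> N \<and> a' = a + N - m \<and> m' = m - c"
  shows "(\<Sum>u\<in>trees N. residue_coeff a b s u * rotation_coeff N m u t)
    = (\<Sum>u\<in>trees (N - c). rotation_coeff (N - c) m' s u * residue_coeff a' b u t)"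
proof (rule frac_bilinear_coefficients_unique[OF _ b s,
    of "\<lambda>b s. \<Sum>u\<in>trees N. residue_coeff a b s u * rotation_coeff N m u t"
       "\<lambda>b s. \<Sum>u\<in>trees (N - c). rotation_coeff (N - c) m' s u * residue_coeff a' b u t"])
  fix p q :: "nat \<Rightarrow> rat" assume p: "inj_on p {..<c}" and q: "inj_on q {..<N - c}"
  define v where "v j = (if j < a then q j else if j < a + c then p (j - a) else q (j - c))" for j
  have vp: "v (j + a) = p j" if "j < c" for j using that by (simp add: v_def)
  have vq: "delete_block a c v = q" by (auto simp: v_def delete_block_def)
  let ?v = "\<lambda>k. push {a..<a + c} k v" and ?w = "rotate_points N m v"
  have ac: "a' + c \<le> N" using rot c by auto
  have "eventually (\<lambda>k. inj_on (?v k) {..<N}) sequentially"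
    using p q vq vp c by (intro eventually_inj_on_push_block) (auto simp: inj_on_def)
  then have "eventually (\<lambda>k. of_nat k * frac t (push {a'..<a' + c} k ?w)
      = (\<Sum>u\<in>trees N. rotation_coeff N m u t * (of_nat k * frac u (?v k)))) sequentially"
  proof (rule eventually_mono)
    fix k assume inj: "inj_on (?v k) {..<N}"
    have "frac t (push {a'..<a' + c} k ?w) = frac t (rotate_points N m (?v k))"
      using t rot c by (intro frac_cong rotate_points_push[symmetric]) (auto simp: trees_def)
    then show "of_nat k * frac t (push {a'..<a' + c} k ?w)
      = (\<Sum>u\<in>trees N. rotation_coeff N m u t * (of_nat k * frac u (?v k)))"
      unfolding frac_rotate_points[OF t inj] by (simp add: sum_distrib_left mult_ac)
  qed
  moreover have "rat_limit (\<lambda>k. of_nat k * frac t (push {a'..<a' + c} k ?w)) (block_residue a' c t ?w)"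
    using t c ac by (intro frac_push_block_residue) (auto simp: trees_def)
  ultimately have "rat_limit (\<lambda>k. \<Sum>u\<in>trees N. rotation_coeff N m u t * (of_nat k * frac u (?v k)))
      (block_residue a' c t ?w)"
    by (rule rat_limit_cong[THEN iffD1])
  moreover have "rat_limit (\<lambda>k. \<Sum>u\<in>trees N. rotation_coeff N m u t * (of_nat k * frac u (?v k)))
      (\<Sum>u\<in>trees N. rotation_coeff N m u t * block_residue a c u v)"
    by (intro rat_limit_sum rat_limit_mult[OF rat_limit_const] frac_push_block_residue)
      (use c in \<open>auto simp: trees_def\<close>)
  ultimately have eq: "(\<Sum>u\<in>trees N. rotation_coeff N m u t * block_residue a c u v) = block_residue a' c t ?w"
    by (rule rat_limit_unique[symmetric])
  have fp: "frac b (\<lambda>j. v (j + a)) = frac b p" if "b \<in> trees c" for b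
    using that vp by (intro frac_cong) (simp add: trees_def)
  have fw: "frac b (\<lambda>j. ?w (j + a')) = frac b p" if "b \<in> trees c" for b
  proof (rule frac_cong)
    fix j assume "j < leaves b"
    then have j: "j < c" using that by (simp add: trees_def)
    then have "j + a' < N" "m \<le> N" using ac rot c by auto
    then have "?w (j + a') = v (j + a)"
      using j rot c by (auto simp: rotate_points_if intro!: arg_cong[of _ _ v])
    then show "?w (j + a') = p j" using vp[OF j] by simp
  qed
  have fq: "frac u (delete_block a' c ?w) = (\<Sum>s\<in>trees (N - c). rotation_coeff (N - c) m' s u * frac s q)"
    if "u \<in> trees (N - c)" for u
  proof -
    have "frac u (delete_block a' c ?w) = frac u (rotate_points (N - c) m' q)"
      unfolding vq[symmetric]
      using that c rot by (intro frac_cong delete_block_rotate_points) (auto simp: trees_def)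
    then show ?thesis using frac_rotate_points[OF that q] by simp
  qed
  have "(\<Sum>b\<in>trees c. \<Sum>s\<in>trees (N - c).
      (\<Sum>u\<in>trees N. residue_coeff a b s u * rotation_coeff N m u t) * frac b p * frac s q)
    = (\<Sum>b\<in>trees c. \<Sum>s\<in>trees (N - c). \<Sum>u\<in>trees N.
        rotation_coeff N m u t * (residue_coeff a b s u * frac b p * frac s q))"
    by (simp add: sum_distrib_left sum_distrib_right mult_ac)
  also have "\<dots> = (\<Sum>u\<in>trees N. \<Sum>b\<in>trees c. \<Sum>s\<in>trees (N - c).
        rotation_coeff N m u t * (residue_coeff a b s u * frac b p * frac s q))"
    by (rule trans[OF sum.cong[OF refl sum.swap] sum.swap])
  also have "\<dots> = (\<Sum>u\<in>trees N. rotation_coeff N m u t * block_residue a c u v)"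
    by (intro sum.cong refl)
      (simp add: block_residue_expansion[OF _ c(1,2)] vq fp sum_distrib_left)
  also have "\<dots> = (\<Sum>b\<in>trees c. \<Sum>u\<in>trees (N - c). \<Sum>s\<in>trees (N - c).
      residue_coeff a' b u t * frac b p * (rotation_coeff (N - c) m' s u * frac s q))"
    unfolding eq block_residue_expansion[OF t c(1,2)]
    by (intro sum.cong refl) (simp add: fw fq sum_distrib_left)
  also have "\<dots> = (\<Sum>b\<in>trees c. \<Sum>s\<in>trees (N - c). \<Sum>u\<in>trees (N - c).
      residue_coeff a' b u t * frac b p * (rotation_coeff (N - c) m' s u * frac s q))"
    by (rule sum.cong[OF refl sum.swap])
  also have "\<dots> = (\<Sum>b\<in>trees c. \<Sum>s\<in>trees (N - c).
      (\<Sum>u\<in>trees (N - c). rotation_coeff (N - c) m' s u * residue_coeff a' b u t) * frac b p * frac s q)"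
    by (simp add: sum_distrib_left sum_distrib_right mult_ac)
  finally show "(\<Sum>b\<in>trees c. \<Sum>s\<in>trees (N - c).
      (\<Sum>u\<in>trees N. residue_coeff a b s u * rotation_coeff N m u t) * frac b p * frac s q)
    = (\<Sum>b\<in>trees c. \<Sum>s\<in>trees (N - c).
      (\<Sum>u\<in>trees (N - c). rotation_coeff (N - c) m' s u * residue_coeff a' b u t) * frac b p * frac s q)" .
qed

lemma Node_in_trees: "s \<in> trees a \<Longrightarrow> b \<in> trees c \<Longrightarrow> Node () s b \<in> trees (a + c)"
  by (simp add: trees_def)

text \<open>A residue at a block inside the left subtree commutes with grafting a right subtree. Since \<open>p > 0\<close>, the
block may be the final part of the left subtree, but not its initial part.\<close>

lemma residue_coeff_inside_left:
  assumes "s \<in> trees M" "u \<in> trees M" "b \<in> trees c" "0 < p" "p + c \<le> M"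
  shows "residue_coeff p b u (Node () s r) = (\<Sum>u'\<in>trees (M - c). if u = Node () u' r then residue_coeff p b u' s else 0)"
proof (cases "split_block p c s")
  case None
  have "split_block p c (Node () s r) = None"
    using None assms leaves_pos[of r] by (simp add: trees_def del: leaves_pos)
  then have "residue_coeff p b u (Node () s r) = 0" using assms by (simp add: residue_coeff_def trees_def)
  moreover have "residue_coeff p b u' s = 0" for u' using None assms by (simp add: residue_coeff_def trees_def)
  ultimately show ?thesis by (simp cong: if_cong)
next
  case (Some x)
  then obtain e b' s' where x: "split_block p c s = Some (e, b', s')" by (cases x) auto
  have s': "s' \<in> trees (M - c)" using split_block_leaves[OF x] assms by (auto simp: trees_def)
  have "residue_coeff p b u (Node () s r) = (if b' = b \<and> Node () s' r = u then e else 0)"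
    using x assms by (auto simp: residue_coeff_def trees_def)
  moreover have "(\<Sum>u'\<in>trees (M - c). if u = Node () u' r then residue_coeff p b u' s else 0)
      = (\<Sum>u'\<in>trees (M - c). if s' = u' then if b' = b \<and> Node () s' r = u then e else 0 else 0)"
    using x assms by (intro sum.cong refl) (auto simp: residue_coeff_def trees_def)
  ultimately show ?thesis using s' by simp
qed

lemma residue_coeff_inside_right:
  assumes "s \<in> trees M" "r \<in> trees d" "b \<in> trees c" "0 < d" "d \<le> p" "p + c < d + M"
  shows "residue_coeff p b u (Node () r s) = (\<Sum>u'\<in>trees (M - c). if u = Node () r u' then residue_coeff (p - d) b u' s else 0)"
proof -
  have le: "\<not> p + leaves b \<le> leaves r"
    using assms leaves_pos[of b] by (simp add: trees_def del: leaves_pos)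
  show ?thesis
  proof (cases "split_block (p - d) c s")
    case None
    then show ?thesis using assms le by (auto simp: residue_coeff_def trees_def intro!: sum.neutral)
  next
    case (Some x)
    then obtain e b' s' where x: "split_block (p - d) c s = Some (e, b', s')" by (cases x) auto
    have s': "s' \<in> trees (M - c)" using split_block_leaves[OF x] assms by (auto simp: trees_def)
    have "residue_coeff p b u (Node () r s) = (if b' = b \<and> Node () r s' = u then e else 0)"
      using x assms le by (auto simp: residue_coeff_def trees_def)
    moreover have "(\<Sum>u'\<in>trees (M - c). if u = Node () r u' then residue_coeff (p - d) b u' s else 0)
        = (\<Sum>u'\<in>trees (M - c). if s' = u' then if b' = b \<and> Node () r s' = u then e else 0 else 0)"
      using x assms le by (intro sum.cong refl) (auto simp: residue_coeff_def trees_def)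
    ultimately show ?thesis using s' by simp
  qed
qed

section \<open>Traces of rotations\<close>

definition rotation_trace :: "nat \<Rightarrow> nat \<Rightarrow> rat" where
  "rotation_trace N m = (\<Sum>t\<in>trees N. rotation_coeff N m t t)"

text \<open>The trace of the operator on functions of \<open>M\<close> points that grafts \<open>b\<close> as the right subtree of the root,
rotates by \<open>m\<close>, and takes the coefficient of \<open>frac b\<close> in the residue at the block of \<open>c\<close> points that starts
at \<open>p\<close>.\<close>

definition right_trace :: "nat \<Rightarrow> nat \<Rightarrow> nat \<Rightarrow> nat \<Rightarrow> unit btree \<Rightarrow> rat" where
  "right_trace M c m p b = (\<Sum>s\<in>trees M. \<Sum>u\<in>trees (M + c).
     residue_coeff p b s u * rotation_coeff (M + c) m u (Node () s b))"

definition left_trace :: "nat \<Rightarrow> nat \<Rightarrow> nat \<Rightarrow> nat \<Rightarrow> unit btree \<Rightarrow> rat" where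
  "left_trace M c m p b = (\<Sum>s\<in>trees M. \<Sum>u\<in>trees (M + c).
     residue_coeff p b s u * rotation_coeff (M + c) m u (Node () b s))"

lemma trees_pos: "t \<in> trees N \<Longrightarrow> 0 < N"
  by (cases N) (auto simp: trees_0)

lemma right_trace_rotate:
  assumes b: "b \<in> trees c" and "p \<le> M"
    and rot: "m \<le> p \<and> p' = p - m \<and> m' = m \<or> p + c \<le> m \<and> m \<le> M + c \<and> p' = p + (M + c) - m \<and> m' = m - c"
  shows "right_trace M c m p b
    = (\<Sum>s\<in>trees M. \<Sum>u\<in>trees M. rotation_coeff M m' s u * residue_coeff p' b u (Node () s b))"
  unfolding right_trace_def
proof (rule sum.cong[OF refl])
  fix s assume s: "s \<in> trees M"
  show "(\<Sum>u\<in>trees (M + c). residue_coeff p b s u * rotation_coeff (M + c) m u (Node () s b))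
    = (\<Sum>u\<in>trees M. rotation_coeff M m' s u * residue_coeff p' b u (Node () s b))"
    using residue_coeff_rotation[OF Node_in_trees[OF s b] b, of s p m p' m'] s assms trees_pos[OF b] trees_pos[OF s]
    by simp
qed

lemma left_trace_rotate:
  assumes b: "b \<in> trees c" and "p \<le> M"
    and rot: "m \<le> p \<and> p' = p - m \<and> m' = m \<or> p + c \<le> m \<and> m \<le> M + c \<and> p' = p + (M + c) - m \<and> m' = m - c"
  shows "left_trace M c m p b
    = (\<Sum>s\<in>trees M. \<Sum>u\<in>trees M. rotation_coeff M m' s u * residue_coeff p' b u (Node () b s))"
  unfolding left_trace_def
proof (rule sum.cong[OF refl])
  fix s assume s: "s \<in> trees M"
  have "Node () b s \<in> trees (M + c)" using Node_in_trees[OF b s] by (simp add: add.commute)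
  then show "(\<Sum>u\<in>trees (M + c). residue_coeff p b s u * rotation_coeff (M + c) m u (Node () b s))
    = (\<Sum>u\<in>trees M. rotation_coeff M m' s u * residue_coeff p' b u (Node () b s))"
    using residue_coeff_rotation[OF _ b, of "Node () b s" "M + c" s p m p' m'] s assms trees_pos[OF b] trees_pos[OF s]
    by simp
qed

text \<open>The residue is moved past the rotation, which shifts the block to \<open>p - m\<close>, and then past the grafting,
because the block is now inside the left subtree. By \<open>tr (A B) = tr (B A)\<close> it may be put in front
again, and the operator acts on \<open>c\<close> points less.\<close>

lemma right_trace_step:
  assumes b: "b \<in> trees c" and p: "m < p" "p \<le> M" "p - m + c \<le> M"
  shows "right_trace M c m p b = right_trace (M - c) c m (p - m) b"
proof -
  have "right_trace M c m p b
      = (\<Sum>s\<in>trees M. \<Sum>u\<in>trees M. rotation_coeff M m s u * residue_coeff (p - m) b u (Node () s b))"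
    by (rule right_trace_rotate[OF b]) (use p in auto)
  also have "\<dots> = (\<Sum>s\<in>trees M. \<Sum>u\<in>trees M. \<Sum>u'\<in>trees (M - c).
      if u = Node () u' b then residue_coeff (p - m) b u' s * rotation_coeff M m s u else 0)"
    by (intro sum.cong refl)
      (use p in \<open>simp add: residue_coeff_inside_left[OF _ _ b] sum_distrib_left if_distrib mult.commute cong: if_cong\<close>)
  also have "\<dots> = (\<Sum>s\<in>trees M. \<Sum>u'\<in>trees (M - c). \<Sum>u\<in>trees M.
      if u = Node () u' b then residue_coeff (p - m) b u' s * rotation_coeff M m s u else 0)"
    by (rule sum.cong[OF refl sum.swap])
  also have "\<dots> = (\<Sum>s\<in>trees M. \<Sum>u'\<in>trees (M - c).
      residue_coeff (p - m) b u' s * rotation_coeff M m s (Node () u' b))"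
  proof (intro sum.cong refl)
    fix s u' assume "u' \<in> trees (M - c)"
    then have "Node () u' b \<in> trees M" using Node_in_trees[OF _ b, of u' "M - c"] p by simp
    then show "(\<Sum>u\<in>trees M. if u = Node () u' b then residue_coeff (p - m) b u' s * rotation_coeff M m s u else 0)
      = residue_coeff (p - m) b u' s * rotation_coeff M m s (Node () u' b)" by simp
  qed
  also have "\<dots> = right_trace (M - c) c m (p - m) b"
    using p unfolding right_trace_def by (subst sum.swap) simp
  finally show ?thesis .
qed

lemma left_trace_step:
  assumes b: "b \<in> trees c" and "p \<le> M" "c \<le> p'" "p' < M"
    and rot: "m \<le> p \<and> p' = p - m \<and> m' = m \<or> p + c \<le> m \<and> m \<le> M + c \<and> p' = p + (M + c) - m \<and> m' = m - c"
  shows "left_trace M c m p b = left_trace (M - c) c m' (p' - c) b"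
proof -
  have "left_trace M c m p b
      = (\<Sum>s\<in>trees M. \<Sum>u\<in>trees M. rotation_coeff M m' s u * residue_coeff p' b u (Node () b s))"
    by (rule left_trace_rotate[OF b \<open>p \<le> M\<close> rot])
  also have "\<dots> = (\<Sum>s\<in>trees M. \<Sum>u\<in>trees M. \<Sum>u'\<in>trees (M - c).
      if u = Node () b u' then residue_coeff (p' - c) b u' s * rotation_coeff M m' s u else 0)"
    by (intro sum.cong refl)
      (use assms(3,4) trees_pos[OF b] in \<open>simp add: residue_coeff_inside_right[OF _ b b] sum_distrib_left if_distrib
        mult.commute cong: if_cong\<close>)
  also have "\<dots> = (\<Sum>s\<in>trees M. \<Sum>u'\<in>trees (M - c). \<Sum>u\<in>trees M.
      if u = Node () b u' then residue_coeff (p' - c) b u' s * rotation_coeff M m' s u else 0)"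
    by (rule sum.cong[OF refl sum.swap])
  also have "\<dots> = (\<Sum>s\<in>trees M. \<Sum>u'\<in>trees (M - c).
      residue_coeff (p' - c) b u' s * rotation_coeff M m' s (Node () b u'))"
  proof (intro sum.cong refl)
    fix s u' assume "u' \<in> trees (M - c)"
    then have "Node () b u' \<in> trees M" using Node_in_trees[OF b, of u' "M - c"] assms(3,4) by simp
    then show "(\<Sum>u\<in>trees M. if u = Node () b u' then residue_coeff (p' - c) b u' s * rotation_coeff M m' s u else 0)
      = residue_coeff (p' - c) b u' s * rotation_coeff M m' s (Node () b u')" by simp
  qed
  also have "\<dots> = left_trace (M - c) c m' (p' - c) b"
    using assms(3,4) unfolding left_trace_def by (subst sum.swap) simp
  finally show ?thesis .
qed

text \<open>The rotation moves the block to the end. There the residue removes exactly the tree that has been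
grafted, and a rotation of the remaining points is left.\<close>

lemma right_trace_end:
  assumes b: "b \<in> trees c" and "r \<le> M"
  shows "right_trace M c (r + c) r b = rotation_trace M r"
proof -
  have "right_trace M c (r + c) r b
      = (\<Sum>s\<in>trees M. \<Sum>u\<in>trees M. rotation_coeff M r s u * residue_coeff M b u (Node () s b))"
    by (rule right_trace_rotate[OF b]) (use assms in auto)
  also have "\<dots> = (\<Sum>s\<in>trees M. \<Sum>u\<in>trees M. if u = s then rotation_coeff M r s u else 0)"
  proof (intro sum.cong refl)
    fix s u assume su: "s \<in> trees M" "u \<in> trees M"
    then have "residue_coeff (M + c - c) b u (Node () s b) = (if Node () s b = Node () u b then 1 else 0)"
      using trees_pos[OF b] trees_pos[OF su(1)] b Node_in_trees[OF su(1) b]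
      by (intro residue_coeff_right_end) auto
    then show "rotation_coeff M r s u * residue_coeff M b u (Node () s b) = (if u = s then rotation_coeff M r s u else 0)"
      by simp
  qed
  finally show ?thesis by (simp add: rotation_trace_def)
qed

text \<open>The same for an initial block, where the residue has a minus sign.\<close>

lemma left_trace_end:
  assumes b: "b \<in> trees c" and "r \<le> M"
  shows "left_trace M c r r b = - rotation_trace M r"
proof -
  have "left_trace M c r r b
      = (\<Sum>s\<in>trees M. \<Sum>u\<in>trees M. rotation_coeff M r s u * residue_coeff 0 b u (Node () b s))"
    by (rule left_trace_rotate[OF b]) (use assms in auto)
  also have "\<dots> = (\<Sum>s\<in>trees M. \<Sum>u\<in>trees M. if u = s then - rotation_coeff M r s u else 0)"
  proof (intro sum.cong refl)
    fix s u assume su: "s \<in> trees M" "u \<in> trees M"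
    then have "residue_coeff 0 b u (Node () b s) = (if Node () b s = Node () b u then -1 else 0)"
      using trees_pos[OF b] trees_pos[OF su(1)] b
      by (intro residue_coeff_left_end[of _ "M + c"]) auto
    then show "rotation_coeff M r s u * residue_coeff 0 b u (Node () b s) = (if u = s then - rotation_coeff M r s u else 0)"
      by simp
  qed
  finally show ?thesis by (simp add: rotation_trace_def sum_negf)
qed

text \<open>The rotation by half of the points exchanges the two subtrees of the root, so only the grafting of \<open>b\<close>
onto \<open>b\<close> itself contributes.\<close>

lemma right_trace_full:
  assumes b: "b \<in> trees m"
  shows "right_trace m m m m b = - 1"
proof -
  have "right_trace m m m m b
      = (\<Sum>s\<in>trees m. \<Sum>u\<in>trees m. rotation_coeff m m s u * residue_coeff 0 b u (Node () s b))"
    by (rule right_trace_rotate[OF b]) auto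
  also have "\<dots> = (\<Sum>s\<in>trees m. \<Sum>u\<in>trees m. if u = b then if s = b then -1 else 0 else 0)"
  proof (intro sum.cong refl)
    fix s u assume su: "s \<in> trees m" "u \<in> trees m"
    then have "residue_coeff 0 b u (Node () s b) = (if Node () s b = Node () b u then -1 else 0)"
      using trees_pos[OF b] b by (intro residue_coeff_left_end[of _ "m + m"]) auto
    then show "rotation_coeff m m s u * residue_coeff 0 b u (Node () s b) = (if u = b then if s = b then -1 else 0 else 0)"
      using rotation_coeff_self[OF su] by auto
  qed
  finally show ?thesis using b by simp
qed

text \<open>Here \<open>m = r + c\<close>, and \<open>q\<close> is the number of steps until the block reaches the position \<open>r = m - c\<close>.\<close>

lemma right_trace_chain:
  assumes b: "b \<in> trees c" and "0 < r" "q < d"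
  shows "right_trace (d * r + q * c) c (r + c) (q * (r + c) + r) b = rotation_trace (d * r) r"
  using \<open>q < d\<close>
proof (induction q)
  case 0
  then show ?case using right_trace_end[OF b, of r "d * r"] by simp
next
  case (Suc q)
  then obtain e where "d = q + 2 + e" using less_imp_add_positive[of "Suc q" d] by (metis Suc_leI add.assoc add_2_eq_Suc' le_Suc_ex plus_1_eq_Suc)
  have "right_trace (d * r + Suc q * c) c (r + c) (Suc q * (r + c) + r) b
      = right_trace (d * r + Suc q * c - c) c (r + c) (Suc q * (r + c) + r - (r + c)) b"
    by (rule right_trace_step[OF b]) (use \<open>d = _\<close> \<open>0 < r\<close> in \<open>auto simp: algebra_simps\<close>)
  also have "d * r + Suc q * c - c = d * r + q * c" by simp
  also have "Suc q * (r + c) + r - (r + c) = q * (r + c) + r" by simp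
  finally show ?case using Suc by simp
qed

lemma left_trace_chain:
  assumes b: "b \<in> trees c" and "0 < r" "q < d"
  shows "left_trace (d * r + q * c) c r (q * (r + c) + r) b = - rotation_trace (d * r) r"
  using \<open>q < d\<close>
proof (induction q)
  case 0
  then show ?case using left_trace_end[OF b, of r "d * r"] by simp
next
  case (Suc q)
  then obtain e where "d = q + 2 + e" using less_imp_add_positive[of "Suc q" d] by (metis Suc_leI add.assoc add_2_eq_Suc' le_Suc_ex plus_1_eq_Suc)
  have "left_trace (d * r + Suc q * c) c r (Suc q * (r + c) + r) b
      = left_trace (d * r + Suc q * c - c) c r (Suc q * (r + c) - c) b"
    by (rule left_trace_step[OF b]) (use \<open>d = _\<close> \<open>0 < r\<close> in \<open>auto simp: algebra_simps\<close>)
  also have "d * r + Suc q * c - c = d * r + q * c" by simp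
  also have "Suc q * (r + c) - c = q * (r + c) + r" by simp
  finally show ?case using Suc by simp
qed

lemma right_trace_full_chain:
  assumes b: "b \<in> trees m"
  shows "right_trace (Suc q * m) m m (Suc q * m) b = - 1"
proof (induction q)
  case 0
  then show ?case using right_trace_full[OF b] by simp
next
  case (Suc q)
  have "right_trace (Suc (Suc q) * m) m m (Suc (Suc q) * m) b
      = right_trace (Suc (Suc q) * m - m) m m (Suc (Suc q) * m - m) b"
    by (rule right_trace_step[OF b]) (use trees_pos[OF b] in auto)
  then show ?case using Suc by simp
qed

text \<open>The diagonal coefficients are residues at a final block.\<close>

lemma sum_rotation_coeff_right:
  assumes b: "b \<in> trees c" and "c < N"
  shows "(\<Sum>s\<in>trees (N - c). rotation_coeff N m (Node () s b) (Node () s b)) = right_trace (N - c) c m (N - c) b"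
  unfolding right_trace_def
proof (rule sum.cong[OF refl])
  fix s assume s: "s \<in> trees (N - c)"
  have "(\<Sum>u\<in>trees N. residue_coeff (N - c) b s u * rotation_coeff N m u (Node () s b))
      = (\<Sum>u\<in>trees N. if u = Node () s b then rotation_coeff N m u (Node () s b) else 0)"
    by (intro sum.cong refl) (simp add: residue_coeff_right_end[OF s b] trees_pos[OF b] assms)
  also have "\<dots> = rotation_coeff N m (Node () s b) (Node () s b)"
    using Node_in_trees[OF s b] assms by simp
  finally show "rotation_coeff N m (Node () s b) (Node () s b) = (\<Sum>u\<in>trees (N - c + c).
      residue_coeff (N - c) b s u * rotation_coeff (N - c + c) m u (Node () s b))" using assms by simp
qed

lemma sum_rotation_coeff_left:
  assumes b: "b \<in> trees c" and "c < N"
  shows "(\<Sum>s\<in>trees (N - c). rotation_coeff N m (Node () b s) (Node () b s)) = - left_trace (N - c) c m 0 b"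
  unfolding left_trace_def
proof (subst sum_negf[symmetric], rule sum.cong[OF refl])
  fix s assume s: "s \<in> trees (N - c)"
  have "(\<Sum>u\<in>trees N. residue_coeff 0 b s u * rotation_coeff N m u (Node () b s))
      = (\<Sum>u\<in>trees N. if u = Node () b s then - rotation_coeff N m u (Node () b s) else 0)"
    by (intro sum.cong refl) (simp add: residue_coeff_left_end[OF s b] trees_pos[OF b] assms)
  also have "\<dots> = - rotation_coeff N m (Node () b s) (Node () b s)"
    using Node_in_trees[OF b s] assms by simp
  finally show "rotation_coeff N m (Node () b s) (Node () b s) = - (\<Sum>u\<in>trees (N - c + c).
      residue_coeff 0 b s u * rotation_coeff (N - c + c) m u (Node () b s))" using assms by simp
qed

text \<open>The final block of \<open>N - c\<close> points is rotated to a block that consists of leaves of the left subtree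
of the root and of some, but not all, leaves of the right subtree. This is not the set of leaves of a
subtree, so the residue vanishes.\<close>

lemma rotation_coeff_diagonal_zero:
  assumes l: "l \<in> trees c" and b: "b \<in> trees (N - c)" and c: "0 < m" "m \<le> c" "c + m < N"
  shows "rotation_coeff N m (Node () l b) (Node () l b) = 0"
proof -
  have t: "Node () l b \<in> trees N" using Node_in_trees[OF l b] c by simp
  have l': "l \<in> trees (N - (N - c))" using l c by simp
  have "rotation_coeff N m (Node () l b) (Node () l b)
      = (\<Sum>u\<in>trees N. if u = Node () l b then rotation_coeff N m u (Node () l b) else 0)"
    using t by simp
  also have "\<dots> = (\<Sum>u\<in>trees N. residue_coeff c b l u * rotation_coeff N m u (Node () l b))"
    by (intro sum.cong refl) (use residue_coeff_right_end[OF l' b] c in simp)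
  also have "\<dots> = (\<Sum>u\<in>trees (N - (N - c)). rotation_coeff (N - (N - c)) m l u * residue_coeff (c - m) b u (Node () l b))"
    by (rule residue_coeff_rotation[OF t b l']) (use c in auto)
  also have "\<dots> = 0"
  proof (intro sum.neutral ballI)
    fix u
    have "split_block (c - m) (N - c) (Node () l b) = None"
      using l b c by (auto simp: trees_def)
    then show "rotation_coeff (N - (N - c)) m l u * residue_coeff (c - m) b u (Node () l b) = 0"
      using b by (simp add: residue_coeff_def trees_def)
  qed
  finally show ?thesis .
qed

text \<open>The trace is split according to the number \<open>c\<close> of leaves of the left subtree of the root. If \<open>c < m\<close> or
\<open>d m - c < m\<close>, the copies of the smaller subtree are removed one after another; for \<open>c = d m - m\<close> every right
subtree contributes \<open>- 1\<close>; all other contributions vanish.\<close>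

lemma rotation_trace_rec:
  assumes "1 \<le> m" "2 \<le> d"
  shows "rotation_trace (d * m) m = - of_nat (card (trees m))
    + 2 * (\<Sum>c\<in>{1..<m}. of_nat (card (trees c)) * rotation_trace (d * (m - c)) (m - c))"
proof -
  let ?N = "d * m" and ?T = "\<lambda>c. of_nat (card (trees c)) * rotation_trace (d * (m - c)) (m - c)"
  define f where "f c = (\<Sum>l\<in>trees c. \<Sum>r\<in>trees (?N - c). rotation_coeff ?N m (Node () l r) (Node () l r))" for c
  obtain e where d: "d = e + 2" using assms(2) by (metis add.commute le_Suc_ex)
  have N: "?N = e * m + 2 * m" by (simp add: d algebra_simps)
  have left: "f c = ?T c" if c: "c \<in> {1..<m}" for c
  proof -
    obtain r where m: "m = r + c" and "0 < r" using c by (metis atLeastLessThan_iff add.commute less_imp_add_positive)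
    have "(\<Sum>s\<in>trees (?N - c). rotation_coeff ?N m (Node () l s) (Node () l s)) = rotation_trace (d * r) r"
      if l: "l \<in> trees c" for l
    proof -
      have "left_trace (?N - c) c m 0 l = left_trace (?N - c - c) c r (?N - m - c) l"
        by (rule left_trace_step[OF l]) (use c m N \<open>0 < r\<close> in \<open>auto simp: algebra_simps\<close>)
      also have "?N - c - c = d * r + e * c" by (simp add: m d algebra_simps)
      also have "?N - m - c = e * (r + c) + r" by (simp add: m d algebra_simps)
      also have "left_trace (d * r + e * c) c r (e * (r + c) + r) l = - rotation_trace (d * r) r"
        by (rule left_trace_chain[OF l \<open>0 < r\<close>]) (simp add: d)
      finally show ?thesis using sum_rotation_coeff_left[OF l, of ?N m] c N by simp
    qed
    then show ?thesis by (simp add: f_def m)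
  qed
  have right: "f (?N - c) = ?T c" if c: "c \<in> {1..<m}" for c
  proof -
    obtain r where m: "m = r + c" and "0 < r" using c by (metis atLeastLessThan_iff add.commute less_imp_add_positive)
    have Nc: "c < ?N" "?N - (?N - c) = c" using c N by auto
    have "(\<Sum>s\<in>trees (?N - c). rotation_coeff ?N m (Node () s b) (Node () s b)) = rotation_trace (d * r) r"
      if b: "b \<in> trees c" for b
    proof -
      have 1: "?N - c = d * r + (e + 1) * c" "?N - c = (e + 1) * (r + c) + r"
        by (simp_all add: m d algebra_simps)
      have "right_trace (d * r + (e + 1) * c) c (r + c) ((e + 1) * (r + c) + r) b = rotation_trace (d * r) r"
        by (rule right_trace_chain[OF b \<open>0 < r\<close>]) (simp add: d)
      then show ?thesis using sum_rotation_coeff_right[OF b Nc(1), of m] 1 m by metis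
    qed
    then show ?thesis unfolding f_def Nc(2) by (subst sum.swap) (simp add: m)
  qed
  have full: "f (?N - m) = - of_nat (card (trees m))"
  proof -
    have Nm: "m < ?N" "?N - (?N - m) = m" "?N - m = Suc e * m" using assms N by auto
    have "(\<Sum>s\<in>trees (?N - m). rotation_coeff ?N m (Node () s b) (Node () s b)) = - 1"
      if b: "b \<in> trees m" for b
      using sum_rotation_coeff_right[OF b Nm(1), of m] right_trace_full_chain[OF b, of e] unfolding Nm(3) by simp
    then show ?thesis unfolding f_def Nm(2) by (subst sum.swap) simp
  qed
  have middle: "f c = 0" if "c \<in> {m..<?N - m}" for c
    unfolding f_def using that assms
    by (intro sum.neutral ballI rotation_coeff_diagonal_zero) auto
  have "rotation_trace ?N m = (\<Sum>c\<in>{1..<?N}. f c)"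
    unfolding rotation_trace_def f_def using assms N by (intro sum_trees_Node) simp
  also have "\<dots> = (\<Sum>c\<in>{1..<m}. f c) + (\<Sum>c\<in>{m..<?N - m}. f c) + (\<Sum>c\<in>{?N - m..<?N}. f c)"
    using assms N by (simp add: sum.atLeastLessThan_concat)
  also have "(\<Sum>c\<in>{?N - m..<?N}. f c) = f (?N - m) + (\<Sum>c\<in>{Suc (?N - m)..<?N}. f c)"
    using assms N by (intro sum.atLeast_Suc_lessThan) simp
  also have "(\<Sum>c\<in>{Suc (?N - m)..<?N}. f c) = (\<Sum>c\<in>{1..<m}. f (?N - c))"
    by (rule sum.reindex_bij_witness[of _ "\<lambda>c. ?N - c" "\<lambda>c. ?N - c"]) (use N in auto)
  also have "(\<Sum>c\<in>{1..<m}. f c) + (\<Sum>c\<in>{m..<?N - m}. f c) + (f (?N - m) + (\<Sum>c\<in>{1..<m}. f (?N - c)))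
      = (\<Sum>c\<in>{1..<m}. f c) + (\<Sum>c\<in>{m..<?N - m}. f c) + f (?N - m) + (\<Sum>c\<in>{1..<m}. f (?N - c))"
    by simp
  also have "\<dots> = (\<Sum>c\<in>{1..<m}. ?T c) + 0 + - of_nat (card (trees m)) + (\<Sum>c\<in>{1..<m}. ?T c)"
    using left right full middle by (intro arg_cong2[of _ _ _ _ "(+)"] sum.cong sum.neutral) auto
  finally show ?thesis by simp
qed

lemma rotation_trace_divisor:
  assumes "1 \<le> m" "2 \<le> d"
  shows "rotation_trace (d * m) m = - of_nat ((2 * m) choose m) / 2"
proof -
  have "- rotation_trace (d * m) m = of_nat ((2 * m) choose m) / 2"
  proof (rule half_central_binomial_unique[of "\<lambda>m. - rotation_trace (d * m) m"])
    fix m :: nat assume "1 \<le> m"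
    then show "- rotation_trace (d * m) m = of_nat (card (trees m))
      + 2 * (\<Sum>c\<in>{1..<m}. of_nat (card (trees c)) * - rotation_trace (d * (m - c)) (m - c))"
      using rotation_trace_rec[OF _ assms(2), of m] by (simp add: sum_negf)
  qed (rule assms(1))
  then show ?thesis by simp
qed

text \<open>A coefficient is up to sign a residue at the initial or the final block. The rotation by \<open>m\<close> keeps one
of these two blocks contiguous, so \<open>residue_coeff_rotation\<close> expresses it by rotations of fewer points.\<close>

lemma rotation_coeff_Ints:
  assumes "m \<le> N" "s \<in> trees N" "t \<in> trees N"
  shows "rotation_coeff N m s t \<in> \<int>"
  using assms
proof (induction N arbitrary: m s t rule: less_induct)
  case (less N)
  have residue_coeff_Ints: "residue_coeff a b s t \<in> \<int>" for a b s t
  proof -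
    have "e \<in> \<int>" if "split_block a c t = Some (e, x)" for a c e x t
      using that by (induction t arbitrary: a x) (auto split: if_splits)
    then show ?thesis by (auto simp: residue_coeff_def split: option.split)
  qed
  show ?case
  proof (cases s)
    case Leaf
    then have "N = 1" using less.prems by (simp add: trees_def)
    then have "t = s" "N mod 1 = 0" using less.prems Leaf by (auto simp: trees_1)
    moreover have "rotation_coeff N m s t = rotation_coeff N 0 s t"
      by (rule rotation_coeff_mod) (simp add: \<open>N = 1\<close>)
    ultimately show ?thesis using less.prems by (simp add: rotation_coeff_0)
  next
    case (Node g l b)
    define c where "c = leaves l"
    have c: "0 < c" "c < N" "l \<in> trees c" "b \<in> trees (N - c)" "l \<in> trees (N - (N - c))"
      using less.prems(2) Node leaves_pos[of b] leaves_pos[of l]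
      by (auto simp: c_def trees_def Suc_le_eq simp del: leaves_pos)
    have s: "s = Node () l b" using Node by simp
    show ?thesis
    proof (cases "m \<le> c")
      case True
      have "rotation_coeff N m s t = (\<Sum>u\<in>trees N. if u = s then rotation_coeff N m u t else 0)"
        using less.prems by simp
      also have "\<dots> = (\<Sum>u\<in>trees N. residue_coeff c b l u * rotation_coeff N m u t)"
        by (intro sum.cong refl) (use residue_coeff_right_end[OF c(5,4)] c s in simp)
      also have "\<dots> = (\<Sum>u\<in>trees (N - (N - c)). rotation_coeff (N - (N - c)) m l u * residue_coeff (c - m) b u t)"
        by (rule residue_coeff_rotation[OF less.prems(3) c(4,5)]) (use c True in auto)
      also have "\<dots> \<in> \<int>"
        by (intro Ints_sum Ints_mult less.IH residue_coeff_Ints) (use c True in auto)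
      finally show ?thesis .
    next
      case False
      have "- rotation_coeff N m s t = (\<Sum>u\<in>trees N. if u = s then - rotation_coeff N m u t else 0)"
        using less.prems by simp
      also have "\<dots> = (\<Sum>u\<in>trees N. residue_coeff 0 l b u * rotation_coeff N m u t)"
        by (intro sum.cong refl) (use residue_coeff_left_end[OF c(4,3)] c s in simp)
      also have "\<dots> = (\<Sum>u\<in>trees (N - c). rotation_coeff (N - c) (m - c) b u * residue_coeff (N - m) l u t)"
        by (rule residue_coeff_rotation[OF less.prems(3) c(3,4)]) (use c False less.prems(1) in auto)
      also have "\<dots> \<in> \<int>"
        by (intro Ints_sum Ints_mult less.IH residue_coeff_Ints) (use c False less.prems(1) in auto)
      finally show ?thesis by (metis Ints_minus minus_minus)
    qed
  qed
qed

lemma rotation_coeff_mat_pow: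
  assumes A: "\<And>s t. s \<in> trees N \<Longrightarrow> t \<in> trees N \<Longrightarrow> of_int (A s t) = rotation_coeff N m s t"
    and "s \<in> trees N" "t \<in> trees N"
  shows "of_int (mat_pow (trees N) A k s t) = rotation_coeff N (k * m) s t"
  using assms(2,3)
proof (induction k arbitrary: s)
  case 0
  then show ?case by (simp add: rotation_coeff_0)
next
  case (Suc k)
  have "of_int (mat_pow (trees N) A (Suc k) s t)
      = (\<Sum>u\<in>trees N. of_int (A s u) * of_int (mat_pow (trees N) A k u t) :: rat)" by simp
  also have "\<dots> = (\<Sum>u\<in>trees N. rotation_coeff N m s u * rotation_coeff N (k * m) u t)"
    using Suc A by (intro sum.cong refl) simp
  also have "\<dots> = rotation_coeff N (k * m + m) s t"
    by (rule rotation_coeff_add[symmetric]) (use Suc.prems in auto)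
  finally show ?case by (simp add: add.commute)
qed

text \<open>The matrix of the rotation by \<open>p k\<close> is the \<open>p\<close>-th power of the integer matrix of the rotation by \<open>k\<close>.\<close>

lemma rotation_trace_gcd:
  assumes "0 < N"
  shows "rotation_trace N k = rotation_trace N (gcd k N)"
proof -
  define A where "A m s t = \<lfloor>rotation_coeff N m s t\<rfloor>" for m s t
  have A: "of_int (A m s t) = rotation_coeff N m s t" if "s \<in> trees N" "t \<in> trees N" for m s t
  proof -
    have "rotation_coeff N m s t = rotation_coeff N (m mod N) s t" by (rule rotation_coeff_mod) simp
    also have "\<dots> \<in> \<int>" using that assms by (intro rotation_coeff_Ints) auto
    finally show ?thesis by (simp add: A_def of_int_floor)
  qed
  define \<theta> where "\<theta> m = (\<Sum>t\<in>trees N. A m t t)" for m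
  have \<theta>: "of_int (\<theta> m) = rotation_trace N m" for m
    by (simp add: \<theta>_def rotation_trace_def A)
  have "\<theta> k = \<theta> (gcd k N)"
  proof (rule frobenius_periodic_gcd[OF assms])
    fix k
    have "rotation_trace N (k + N) = rotation_trace N k"
      unfolding rotation_trace_def by (intro sum.cong refl rotation_coeff_mod) simp
    then show "\<theta> (k + N) = \<theta> k" by (simp add: \<theta>[symmetric])
  next
    fix p k :: nat assume p: "prime p"
    have "of_int (mat_pow (trees N) (A k) p t t) = rotation_coeff N (p * k) t t" if "t \<in> trees N" for t
      by (rule rotation_coeff_mat_pow[OF A that that])
    then have "of_int (\<Sum>t\<in>trees N. mat_pow (trees N) (A k) p t t) = rotation_trace N (p * k)"
      by (simp add: rotation_trace_def)
    then have "(\<Sum>t\<in>trees N. mat_pow (trees N) (A k) p t t) = \<theta> (p * k)"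
      by (simp only: \<theta>[symmetric] of_int_eq_iff)
    then show "[\<theta> (p * k) = \<theta> k] (mod int p)"
      using trace_prime_power_cong[OF finite_trees p, of N "A k"] by (simp add: \<theta>_def)
  qed
  then show ?thesis by (simp add: \<theta>[symmetric])
qed

lemma rotation_trace_0: "rotation_trace N 0 = of_nat (card (trees N))"
  by (simp add: rotation_trace_def rotation_coeff_0)

lemma rotation_trace_nontrivial:
  assumes "\<not> N dvd k" "0 < N"
  shows "rotation_trace N k = - of_nat ((2 * gcd k N) choose gcd k N) / 2"
proof -
  define m where "m = gcd k N"
  obtain d where d: "N = d * m" by (metis m_def dvd_def gcd_dvd2 mult.commute)
  have "m \<noteq> N" using assms(1) by (metis m_def gcd_dvd1)
  then have "d \<noteq> 1" "d \<noteq> 0" using d assms(2) by auto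
  then have "2 \<le> d" by linarith
  moreover have "1 \<le> m" using assms(2) by (simp add: m_def Suc_le_eq)
  ultimately have "rotation_trace N m = - of_nat ((2 * m) choose m) / 2"
    unfolding d by (rule rotation_trace_divisor[rotated])
  then show ?thesis using rotation_trace_gcd[OF assms(2), of k] unfolding m_def by simp
qed

context dend_anticyclic
begin

lemma dend_coord_tau_funpow:
  assumes "1 \<le> n" "t \<in> trees (n + 1)" "s \<in> trees (n + 1)"
  shows "dend_coord n s ((\<tau> n ^^ k) (dend_basis t)) = rotation_coeff (n + 1) (k * n) s t"
proof -
  have mem: "(\<tau> n ^^ k) x \<in> Dend n" if "x \<in> Dend n" for x k
    using that by (induction k) (auto intro: tau_closed[OF _ assms(1)])
  have mould: "dend_mould n v ((\<tau> n ^^ k) x) = dend_mould n (rotate_points (n + 1) (k * n) v) x"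
    if "x \<in> Dend n" "inj_on v {..n}" for x k v
    using that(2)
  proof (induction k arbitrary: v)
    case 0
    have R: "inj_on (rotate_points (n + 1) 0 v) {..n}"
      using inj_on_rotate_points[of v "n + 1" 0] 0 by (simp add: lessThan_Suc_atMost)
    have "frac u (rotate_points (n + 1) 0 v) = frac u v" if "u \<in> trees (n + 1)" for u
      using that by (intro frac_cong) (simp add: rotate_points_def trees_def)
    then show ?case using dend_mould_coord[OF \<open>x \<in> Dend n\<close> assms(1)] 0 R by simp
  next
    case (Suc k)
    have R: "inj_on (rotate_points (n + 1) n v) {..n}"
      using inj_on_rotate_points[of v "n + 1" n] Suc.prems by (simp add: lessThan_Suc_atMost)
    have "dend_mould n v ((\<tau> n ^^ Suc k) x) = dend_mould n (rotate_points (n + 1) n v) ((\<tau> n ^^ k) x)"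
      using dend_mould_tau[OF mem[OF \<open>x \<in> Dend n\<close>] assms(1) Suc.prems] by simp
    also have "\<dots> = dend_mould n (rotate_points (n + 1) (k * n) (rotate_points (n + 1) n v)) x"
      by (rule Suc.IH[OF R])
    finally show ?case by (simp add: rotate_points_rotate_points add.commute)
  qed
  have b: "dend_basis t \<in> Dend n" by (rule dend_basis_in_Dend[OF assms(2,1)])
  show ?thesis
  proof (rule dend_coord_unique[OF mem[OF b] assms(1,3)])
    fix v :: "nat \<Rightarrow> rat" assume v: "inj_on v {..n}"
    have R: "inj_on (rotate_points (n + 1) (k * n) v) {..n}"
      using inj_on_rotate_points[of v "n + 1" "k * n"] v by (simp add: lessThan_Suc_atMost)
    show "dend_mould n v ((\<tau> n ^^ k) (dend_basis t))
      = (\<Sum>s\<in>trees (n + 1). rotation_coeff (n + 1) (k * n) s t * frac s v)"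
      unfolding mould[OF b v] dend_mould_basis[OF assms(2,1) R]
      using frac_rotate_points[OF assms(2)] v by (simp add: lessThan_Suc_atMost)
  qed
qed

text \<open>As \<open>\<tau>\<close> is the rotation by \<open>n\<close>, its \<open>k\<close>-th power is the rotation by \<open>k n\<close>.\<close>

lemma frobenius_char_Dend:
  assumes "1 \<le> n"
  shows "frobenius_char (n + 1) (sym_component Dend n) (sym_act \<tau> n)
    = (1 / of_nat (n + 1)) *\<^sub>Q (\<Sum>k\<le>n. rotation_trace (n + 1) (k * n)
        *\<^sub>Q psum ((n + 1) div gcd k (n + 1)) ^ gcd k (n + 1))"
proof -
  have "linear_on (Dend n) (\<tau> n)" "\<tau> n ` Dend n \<subseteq> Dend n"
    using tau_add tau_scale tau_closed assms by (auto simp: linear_on_def)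
  from frobenius_char_sym_component[where P = Dend and n = n and \<tau> = \<tau>, OF coordinates_on_Dend[OF assms] this]
  show ?thesis by (simp add: rotation_trace_def dend_coord_tau_funpow[OF assms, simplified])
qed

end

section \<open>The characteristic function\<close>

definition homogeneous :: "nat \<Rightarrow> symfun \<Rightarrow> bool" where
  "homogeneous N f \<longleftrightarrow> (\<forall>M. sf_coeff f M \<noteq> 0 \<longrightarrow> size M = N)"

lemma homogeneous_psum: "homogeneous k (psum k)"
  by (auto simp: homogeneous_def psum.rep_eq split: if_splits)

lemma homogeneous_mult:
  assumes "homogeneous a f" "homogeneous b g"
  shows "homogeneous (a + b) (f * g)"
  unfolding homogeneous_def
proof (intro allI impI)
  fix M assume "sf_coeff (f * g) M \<noteq> 0"
  then obtain A where A: "A \<subseteq># M" "sf_coeff f A * sf_coeff g (M - A) \<noteq> 0"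
    unfolding times_symfun.rep_eq by (metis (mono_tags, lifting) mem_Collect_eq sum.neutral)
  then have "size A = a" "size (M - A) = b" using assms by (auto simp: homogeneous_def)
  then show "size M = a + b"
    using A(1) by (metis add.commute diff_add_inverse le_add_diff_inverse size_Diff_submset size_mset_mono)
qed

lemma homogeneous_power: "homogeneous a f \<Longrightarrow> homogeneous (k * a) (f ^ k)"
proof (induction k)
  case 0
  show ?case by (simp add: homogeneous_def one_symfun.rep_eq)
next
  case (Suc k)
  then show ?case using homogeneous_mult[of a f "k * a" "f ^ k"] by simp
qed

lemma homogeneous_scaleQ: "homogeneous a f \<Longrightarrow> homogeneous a (c *\<^sub>Q f)"
  by (simp add: homogeneous_def scaleQ_symfun.rep_eq)

lemma homogeneous_sum: "(\<And>i. i \<in> I \<Longrightarrow> homogeneous a (f i)) \<Longrightarrow> homogeneous a (sum f I)"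
proof (induction I rule: infinite_finite_induct)
  case (insert i I)
  have "homogeneous a (f i)" "homogeneous a (sum f I)" using insert by blast+
  then have "sf_coeff (f i + sum f I) M \<noteq> 0 \<Longrightarrow> size M = a" for M
    by (cases "sf_coeff (f i) M = 0") (auto simp: homogeneous_def plus_symfun.rep_eq)
  then show ?case using insert.hyps by (simp add: homogeneous_def)
qed (simp_all add: homogeneous_def zero_symfun.rep_eq)

lemma sf_coeff_infsum_single:
  assumes "\<And>n. n \<in> I \<Longrightarrow> sf_coeff (F n) M \<noteq> 0 \<Longrightarrow> n = k"
  shows "sf_coeff (sf_infsum F I) M = (if k \<in> I then sf_coeff (F k) M else 0)"
proof -
  have "sf_coeff (sf_infsum F I) M = (\<Sum>n | n \<in> I \<and> sf_coeff (F n) M \<noteq> 0. sf_coeff (F n) M)"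
    by (simp add: sf_infsum.rep_eq)
  also have "\<dots> = (\<Sum>n\<in>(if k \<in> I then {k} else {}). sf_coeff (F n) M)"
    by (rule sum.mono_neutral_cong_left) (use assms in \<open>auto split: if_splits\<close>)
  finally show ?thesis by simp
qed

lemma sum_gcd_totient:
  fixes H :: "nat \<Rightarrow> 'a::rat_vector"
  assumes "0 < N"
  shows "(\<Sum>k<N. H (gcd k N)) = (\<Sum>d | d dvd N. of_nat (totient d) *\<^sub>Q H (N div d))"
proof -
  let ?D = "{d. d dvd N}"
  have fin: "finite ?D" using assms by simp
  have card: "card {k\<in>{..<N}. gcd k N = N div d} = totient d" if "d dvd N" for d
  proof -
    have "bij_betw (\<lambda>k. if k = 0 then N else k) {k\<in>{..<N}. gcd k N = N div d} {k\<in>{0<..N}. gcd k N = N div d}"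
      by (rule bij_betw_byWitness[of _ "\<lambda>k. if k = N then 0 else k"]) (use assms in auto)
    then have "card {k\<in>{..<N}. gcd k N = N div d} = card {k\<in>{0<..N}. gcd k N = N div d}"
      by (rule bij_betw_same_card)
    also have "\<dots> = totient (N div (N div d))"
      using card_gcd_eq_totient[of N "N div d"] assms that by auto
    also have "N div (N div d) = d" using that assms by (metis dvd_mult_div_cancel nonzero_mult_div_cancel_right mult_is_0 not_gr_zero)
    finally show ?thesis .
  qed
  have inj: "inj_on (\<lambda>d. N div d) ?D"
    using assms by (intro inj_onI) (metis dvd_div_eq_0_iff dvd_mult_div_cancel mem_Collect_eq mult_cancel_right not_gr_zero)
  have dvd: "N div gcd k N dvd N" for k by (metis dvd_mult_div_cancel dvd_triv_right gcd_dvd2)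
  have img: "gcd k N \<in> (\<lambda>d. N div d) ` ?D" for k
    by (rule image_eqI[of _ _ "N div gcd k N"]) (use assms dvd in \<open>auto simp: dvd_div_eq_mult div_div_eq_right\<close>)
  have "(\<Sum>k<N. H (gcd k N)) = (\<Sum>y\<in>(\<lambda>d. N div d) ` ?D. \<Sum>k | k \<in> {..<N} \<and> gcd k N = y. H (gcd k N))"
    by (rule sum.group[symmetric]) (use fin img in auto)
  also have "\<dots> = (\<Sum>d\<in>?D. \<Sum>k | k \<in> {..<N} \<and> gcd k N = N div d. H (gcd k N))"
    by (simp add: sum.reindex[OF inj])
  also have "\<dots> = (\<Sum>d\<in>?D. of_nat (totient d) *\<^sub>Q H (N div d))"
  proof (rule sum.cong[OF refl])
    fix d assume d: "d \<in> ?D"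
    have "(\<Sum>k | k \<in> {..<N} \<and> gcd k N = N div d. H (gcd k N)) = (\<Sum>k | k \<in> {..<N} \<and> gcd k N = N div d. H (N div d))"
      by (rule sum.cong) auto
    also have "\<dots> = of_nat (card {k\<in>{..<N}. gcd k N = N div d}) *\<^sub>Q H (N div d)"
      by (rule rat_vec.sum_constant_scale)
    finally show "(\<Sum>k | k \<in> {..<N} \<and> gcd k N = N div d. H (gcd k N)) = of_nat (totient d) *\<^sub>Q H (N div d)"
      using card d by simp
  qed
  finally show ?thesis .
qed

text \<open>With all \<open>p\<^sub>d\<close> replaced by \<open>1\<close> this is the number of necklaces with \<open>n\<close> black and \<open>n\<close> white beads.\<close>

definition necklace_term :: "nat \<Rightarrow> symfun" where
  "necklace_term n = (1 / (2 * of_nat n)) *\<^sub>Q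
     (\<Sum>d | d dvd n. of_nat (totient d * ((2 * n div d) choose (n div d))) *\<^sub>Q psum d ^ (n div d))"

lemma homogeneous_necklace_term: "homogeneous n (necklace_term n)"
  unfolding necklace_term_def
proof (intro homogeneous_scaleQ homogeneous_sum)
  fix d assume "d \<in> {d. d dvd n}"
  then show "homogeneous n (psum d ^ (n div d))"
    using homogeneous_power[OF homogeneous_psum[of d], of "n div d"] by simp
qed

lemma half_central_binomial_trees:
  assumes "1 \<le> N"
  shows "(of_nat ((2 * N) choose N) :: rat) / 2 = (2 * of_nat N - 1) * of_nat (card (trees N))"
proof -
  obtain k where N: "N = Suc k" using assms by (cases N) auto
  have "Suc k * ((2 * Suc k) choose Suc k) = 2 * (2 * k + 1) * (Suc k * card (trees (Suc k)))"
    by (simp only: Suc_times_central_binomial card_trees)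
  also have "\<dots> = Suc k * (2 * (2 * k + 1) * card (trees (Suc k)))" by (simp only: mult_ac)
  finally have "Suc k * ((2 * Suc k) choose Suc k) = Suc k * (2 * (2 * k + 1) * card (trees (Suc k)))" .
  then have "((2 * Suc k) choose Suc k) = 2 * (2 * k + 1) * card (trees (Suc k))"
    by (simp only: mult_cancel1) simp
  then have "(of_nat ((2 * Suc k) choose Suc k) :: rat) = of_nat (2 * (2 * k + 1) * card (trees (Suc k)))"
    by (simp only:)
  then show ?thesis unfolding N by (simp add: algebra_simps del: binomial_Suc_Suc)
qed

text \<open>Substituting \<open>p\<^sub>1\<close> into \<open>y = x + y\<^sup>2\<close> gives \<open>(1 - 2y)\<^sup>2 = 1 - 4 p\<^sub>1\<close>.\<close>

lemma sf_sqrt_tree_series: "sf_sqrt (1 - 4 * psum 1) = 1 - 2 * subst_psum_1 tree_series"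
proof (rule sf_sqrt_eqI)
  let ?Y = "subst_psum_1 tree_series"
  have add: "subst_psum_1 (f + g) = subst_psum_1 f + subst_psum_1 g" for f g
    by (rule symfun_eqI) (simp add: subst_psum_1.rep_eq plus_symfun.rep_eq distrib_right)
  have X: "subst_psum_1 fps_X = psum 1"
  proof (rule symfun_eqI)
    fix M
    show "sf_coeff (subst_psum_1 fps_X) M = sf_coeff (psum 1) M"
      using psum_1_pow_coeff_size[of 1 M] by (cases "size M = 1") (auto simp: subst_psum_1.rep_eq)
  qed
  have "?Y = subst_psum_1 (fps_X + tree_series ^ 2)" using tree_series_quadratic by simp
  also have "\<dots> = psum 1 + ?Y ^ 2" by (simp only: add X power2_eq_square subst_psum_1_mult)
  finally have Y: "?Y - ?Y ^ 2 = psum 1" by (simp add: algebra_simps)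
  have "(1 - 2 * ?Y) ^ 2 = 1 - 4 * (?Y - ?Y ^ 2)" by (simp add: power2_eq_square algebra_simps)
  then show "(1 - 2 * ?Y) ^ 2 = 1 - 4 * psum 1" unfolding Y .
  have "sf_coeff (2 * ?Y) {#} = 0"
    by (simp add: symfun_mult_const_coeff subst_psum_1.rep_eq tree_series_def trees_0)
  then show "sf_coeff (1 - 2 * ?Y) {#} = 1" by (simp add: minus_symfun.rep_eq one_symfun.rep_eq)
qed

lemma sf_coeff_double: "sf_coeff (2 * f) M = 2 * sf_coeff f M"
proof -
  have "2 * f = f + f" by simp
  then show ?thesis by (simp only: plus_symfun.rep_eq)
qed

context dend_anticyclic
begin

text \<open>Summing the trace \<open>- \<onehalf> (2g choose g)\<close> over all \<open>k < N\<close> yields the necklace term. The summand for \<open>k = 0\<close> is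
the number of trees instead, and the correction is \<open>2 N\<close> times this number.\<close>

lemma frobenius_char_Dend_necklace:
  assumes "1 \<le> n"
  shows "frobenius_char (n + 1) (sym_component Dend n) (sym_act \<tau> n)
    = (2 * of_nat (card (trees (n + 1)))) *\<^sub>Q psum 1 ^ (n + 1) - necklace_term (n + 1)"
proof -
  define N where "N = n + 1"
  have N: "2 \<le> N" "n = N - 1" using assms by (auto simp: N_def)
  define H where "H g = (- of_nat ((2 * g) choose g) / 2) *\<^sub>Q psum (N div g) ^ g" for g
  have coprime: "coprime n N" by (simp add: N_def)
  have summand: "rotation_trace N (k * n) *\<^sub>Q psum (N div gcd k N) ^ gcd k N
      = H (gcd k N) + (if k = 0 then (of_nat (card (trees N)) + of_nat ((2 * N) choose N) / 2) *\<^sub>Q psum 1 ^ N else 0)"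
    if "k \<in> {..<N}" for k
  proof (cases "k = 0")
    case True
    then show ?thesis using N by (simp add: H_def rotation_trace_0 scaleQ_add_left)
  next
    case False
    have "\<not> N dvd k" using False that by (auto dest: dvd_imp_le)
    then have "\<not> N dvd k * n" using coprime by (simp add: coprime_dvd_mult_left_iff coprime_commute)
    moreover have "gcd (k * n) N = gcd k N" using coprime by (metis gcd_mult_left_right_cancel coprime_commute)
    ultimately show ?thesis using False N rotation_trace_nontrivial[of N "k * n"] by (simp add: H_def)
  qed
  have "(\<Sum>k\<le>n. rotation_trace N (k * n) *\<^sub>Q psum (N div gcd k N) ^ gcd k N)
      = (\<Sum>k<N. H (gcd k N) + (if k = 0 then (of_nat (card (trees N)) + of_nat ((2 * N) choose N) / 2) *\<^sub>Q psum 1 ^ N else 0))"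
    by (rule sum.cong[OF _ summand]) (auto simp: N_def)
  also have "\<dots> = (\<Sum>d | d dvd N. of_nat (totient d) *\<^sub>Q H (N div d))
      + (of_nat (card (trees N)) + of_nat ((2 * N) choose N) / 2) *\<^sub>Q psum 1 ^ N"
    using N by (simp add: sum.distrib sum_gcd_totient)
  also have "of_nat (card (trees N)) + of_nat ((2 * N) choose N) / 2
      = (of_nat N * (2 * of_nat (card (trees N))) :: rat)"
    using half_central_binomial_trees[of N] N by (simp add: algebra_simps)
  also have "(\<Sum>d | d dvd N. of_nat (totient d) *\<^sub>Q H (N div d)) = - (of_nat N *\<^sub>Q necklace_term N)"
  proof -
    have "of_nat (totient d) *\<^sub>Q H (N div d)
        = (- 1 / 2) *\<^sub>Q of_nat (totient d * ((2 * N div d) choose (N div d))) *\<^sub>Q psum d ^ (N div d)"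
      if d: "d \<in> {d. d dvd N}" for d
    proof -
      have "N div (N div d) = d" "2 * (N div d) = 2 * N div d" using d N by (auto simp: div_mult_swap elim!: dvdE)
      then show ?thesis by (simp add: H_def scaleQ_scaleQ)
    qed
    then have "(\<Sum>d | d dvd N. of_nat (totient d) *\<^sub>Q H (N div d)) = (- 1 / 2) *\<^sub>Q
       (\<Sum>d | d dvd N. of_nat (totient d * ((2 * N div d) choose (N div d))) *\<^sub>Q psum d ^ (N div d))"
      unfolding rat_vec.scale_sum_right by (rule sum.cong[OF refl])
    then show ?thesis using N by (simp add: necklace_term_def scaleQ_scaleQ flip: rat_vec.scale_minus_left)
  qed
  finally have sum: "(\<Sum>k\<le>n. rotation_trace N (k * n) *\<^sub>Q psum (N div gcd k N) ^ gcd k N)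
      = - (of_nat N *\<^sub>Q necklace_term N) + (of_nat N * (2 * of_nat (card (trees N)))) *\<^sub>Q psum 1 ^ N" .
  have "(1 / z) *\<^sub>Q (- (z *\<^sub>Q f) + (z * x) *\<^sub>Q g) = x *\<^sub>Q g - f" if "z \<noteq> 0" for z x :: rat and f g :: symfun
    using that by (simp add: rat_vec.scale_right_diff_distrib scaleQ_scaleQ)
  then show ?thesis
    using frobenius_char_Dend[OF assms] N unfolding N_def[symmetric] sum by simp
qed

end

theorem theorem6p2:
  fixes \<tau> :: "nat \<Rightarrow> dend \<Rightarrow> dend"
  assumes "ns_anticyclic_operad Dend dend_unit dend_comp \<tau>"
    and "\<forall>x\<in>Dend 1. \<tau> 1 x = - x"
    and "\<tau> 2 dend_succ = dend_prec"
    and "\<tau> 2 dend_prec = - dend_prec - dend_succ"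
  shows "Ch (sym_component Dend) (sym_act \<tau>) =
    1 - psum 1 - sf_sqrt (1 - 4 * psum 1)
      - sf_infsum (\<lambda>n. (1 / (2 * of_nat n)) *\<^sub>Q
          (\<Sum>d | d dvd n. of_nat (totient d * ((2 * n div d) choose (n div d))) *\<^sub>Q
             psum d ^ (n div d))) {1..}"
proof -
  interpret dend_anticyclic \<tau>
    using assms by (intro dend_anticyclic.intro dend_anticyclic_axioms.intro)
  let ?E = "\<lambda>n. frobenius_char (n + 1) (sym_component Dend n) (sym_act \<tau> n)"
  have E: "?E n = (2 * of_nat (card (trees (n + 1)))) *\<^sub>Q psum 1 ^ (n + 1) - necklace_term (n + 1)"
    if "n \<in> {1..}" for n using frobenius_char_Dend_necklace[of n] that by simp
  have "Ch (sym_component Dend) (sym_act \<tau>) = 2 * subst_psum_1 tree_series - psum 1 - sf_infsum necklace_term {1..}"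
  proof (rule symfun_eqI)
    fix M :: "nat multiset"
    define c where "c k = sf_coeff (psum 1 ^ k) M" for k
    \<comment> \<open>Everything is compared at one monomial \<open>M\<close>, which sees only the summands of degree \<open>size M\<close>.\<close>
    have E_size: "n = size M - 1" if "n \<in> {1..}" "sf_coeff (?E n) M \<noteq> 0" for n
    proof -
      have "c (n + 1) \<noteq> 0 \<or> sf_coeff (necklace_term (n + 1)) M \<noteq> 0"
        using that(2) unfolding E[OF that(1)] by (auto simp: c_def minus_symfun.rep_eq scaleQ_symfun.rep_eq)
      then have "size M = n + 1"
        using homogeneous_necklace_term[of "n + 1"] psum_1_pow_coeff_size[of "n + 1" M]
        by (auto simp: homogeneous_def c_def)
      then show ?thesis by simp
    qed
    have lhs: "sf_coeff (Ch (sym_component Dend) (sym_act \<tau>)) M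
        = (if size M - 1 \<in> {1..} then sf_coeff (?E (size M - 1)) M else 0)"
      unfolding Ch_def by (rule sf_coeff_infsum_single) (use E_size in blast)
    have Q: "sf_coeff (sf_infsum necklace_term {1..}) M
        = (if size M \<in> {1..} then sf_coeff (necklace_term (size M)) M else 0)"
      by (rule sf_coeff_infsum_single) (use homogeneous_necklace_term in \<open>auto simp: homogeneous_def\<close>)
    have rhs: "sf_coeff (2 * subst_psum_1 tree_series - psum 1 - sf_infsum necklace_term {1..}) M
        = 2 * of_nat (card (trees (size M))) * c (size M) - c 1
          - (if size M \<in> {1..} then sf_coeff (necklace_term (size M)) M else 0)"
      unfolding minus_symfun.rep_eq Q
      by (simp add: sf_coeff_double subst_psum_1.rep_eq tree_series_def c_def)
    have c1: "c 1 = 0" if "size M \<noteq> 1"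
      using psum_1_pow_coeff_size[of 1 M] that by (auto simp: c_def)
    consider "size M = 0" | "size M = 1" | "2 \<le> size M" by linarith
    then show "sf_coeff (Ch (sym_component Dend) (sym_act \<tau>)) M
        = sf_coeff (2 * subst_psum_1 tree_series - psum 1 - sf_infsum necklace_term {1..}) M"
    proof cases
      case 1
      then show ?thesis unfolding lhs rhs using c1 by (simp add: trees_0)
    next
      case 2
      have "sf_coeff (necklace_term 1) M = c 1"
        by (simp add: necklace_term_def scaleQ_symfun.rep_eq c_def)
      then show ?thesis unfolding lhs rhs 2 by (simp add: trees_1)
    next
      case 3
      then show ?thesis unfolding lhs rhs using c1 E[of "size M - 1"]
        by (simp add: minus_symfun.rep_eq scaleQ_symfun.rep_eq c_def)
    qed
  qed
  also have "sf_infsum necklace_term {1..} = sf_infsum (\<lambda>n. (1 / (2 * of_nat n)) *\<^sub>Q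
      (\<Sum>d | d dvd n. of_nat (totient d * ((2 * n div d) choose (n div d))) *\<^sub>Q psum d ^ (n div d))) {1..}"
    by (rule arg_cong[of _ _ "\<lambda>F. sf_infsum F {1..}"]) (simp add: fun_eq_iff necklace_term_def)
  finally show ?thesis unfolding sf_sqrt_tree_series by simp
qed

end
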